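(* Let $\mathbf{u}=(u_n)$ be a $TB$-sequence in an abelian group $G$ and let $H$ be an arbitrary subgroup of $G$ containing $\langle\mathbf{u}\rangle$. Then $\tau_{\mathbf{u}}$ is the finest precompact extension on $G$ of $\tau_{\mathbf{u}}(H)$. In particular, $\tau_{\mathbf{u}}|_H=\tau_{\mathbf{u}}(H)$.
   Context: All topological groups are Hausdorff and abelian. A group topology on $G$ is precompact if it is Hausdorff and for every neighborhood $U$ of $0$ there is a finite $F\subseteq G$ with $F+U=G$. A sequence $\mathbf{u}=(u_n)$ in an abelian group $G$ is a $TB$-sequence if there is a precompact group topology on $G$ in which $u_n\to0$; then $\tau_{\mathbf{u}}$ denotes the finest precompact group topology on $G$ in which $u_n\to 0$. $\langle\mathbf{u}\rangle$ is the subgroup generated by the terms of $\mathbf{u}$. If $\mathbf{u}$ is a $TB$-sequence in $G$ and $H$ is a subgroup containing $\langle\mathbf{u}\rangle$, then $\mathbf{u}$ is a $TB$-sequence in $H$, and $\tau_{\mathbf{u}}(H)$ denotes the finest precompact group topology on $H$ in which $\mathbf{u}$ converges to $0$. A precompact group topology $\zeta^\ast$ on $G$ is the finest precompact extension of a precompact topology $\zeta$ on a subgroup $H$ if $\zeta^\ast|_H=\zeta$ and $\tau'\le\zeta^\ast$ for every precompact group topology $\tau'$ on $G$ with $\tau'|_H=\zeta$. *)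

theory Defs
  imports
    "HOL-Analysis.Analysis"
    "HOL-Algebra.Algebra"
begin

text \<open>
  Abelian groups are HOL-Algebra groups, written multiplicatively: the neutral element
  \<open>\<one>\<close> plays the role of \<open>0\<close> and \<open>F <#> U\<close> that of \<open>F + U\<close>.
  A subgroup \<open>H\<close> of \<open>G\<close>, seen as a group in its own right, is \<open>G\<lparr>carrier := H\<rparr>\<close>.
\<close>

definition topology_le :: "'a topology \<Rightarrow> 'a topology \<Rightarrow> bool"
  where "topology_le S T \<longleftrightarrow> (\<forall>U. openin S U \<longrightarrow> openin T U)"

definition group_topology :: "('a, 'b) monoid_scheme \<Rightarrow> 'a topology \<Rightarrow> bool"
  where "group_topology G T \<longleftrightarrow>
    topspace T = carrier G \<and>
    continuous_map (prod_topology T T) T (\<lambda>(x, y). x \<otimes>\<^bsub>G\<^esub> y) \<and>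
    continuous_map T T (\<lambda>x. inv\<^bsub>G\<^esub> x)"

text \<open>Neighbourhoods are not required to be open.\<close>

definition precompact_group_topology :: "('a, 'b) monoid_scheme \<Rightarrow> 'a topology \<Rightarrow> bool"
  where "precompact_group_topology G T \<longleftrightarrow>
    group_topology G T \<and> Hausdorff_space T \<and>
    (\<forall>U. U \<subseteq> carrier G \<and> (\<exists>V. openin T V \<and> \<one>\<^bsub>G\<^esub> \<in> V \<and> V \<subseteq> U) \<longrightarrow>
         (\<exists>F. finite F \<and> F \<subseteq> carrier G \<and> F <#>\<^bsub>G\<^esub> U = carrier G))"

text \<open>
  The range condition is needed because \<^const>\<open>limitin\<close> only constrains the terms of the
  sequence from some index on.
\<close>

definition TB_sequence :: "('a, 'b) monoid_scheme \<Rightarrow> (nat \<Rightarrow> 'a) \<Rightarrow> bool"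
  where "TB_sequence G u \<longleftrightarrow>
    range u \<subseteq> carrier G \<and>
    (\<exists>T. precompact_group_topology G T \<and> limitin T u \<one>\<^bsub>G\<^esub> sequentially)"

definition is_finest_TB_topology ::
    "('a, 'b) monoid_scheme \<Rightarrow> (nat \<Rightarrow> 'a) \<Rightarrow> 'a topology \<Rightarrow> bool"
  where "is_finest_TB_topology G u T \<longleftrightarrow>
    precompact_group_topology G T \<and> limitin T u \<one>\<^bsub>G\<^esub> sequentially \<and>
    (\<forall>T'. precompact_group_topology G T' \<and> limitin T' u \<one>\<^bsub>G\<^esub> sequentially
          \<longrightarrow> topology_le T' T)"

text \<open>
  The topology \<open>\<tau>\<^sub>u\<close> of \<open>G\<close>; the topology \<open>\<tau>\<^sub>u(H)\<close> of a subgroup is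
  \<open>TB_topology (G\<lparr>carrier := H\<rparr>) u\<close>.
\<close>

definition TB_topology :: "('a, 'b) monoid_scheme \<Rightarrow> (nat \<Rightarrow> 'a) \<Rightarrow> 'a topology"
  where "TB_topology G u = (THE T. is_finest_TB_topology G u T)"

definition finest_precompact_extension ::
    "('a, 'b) monoid_scheme \<Rightarrow> 'a set \<Rightarrow> 'a topology \<Rightarrow> 'a topology \<Rightarrow> bool"
  where "finest_precompact_extension G H \<zeta> \<zeta>' \<longleftrightarrow>
    precompact_group_topology (G\<lparr>carrier := H\<rparr>) \<zeta> \<and>
    precompact_group_topology G \<zeta>' \<and>
    subtopology \<zeta>' H = \<zeta> \<and>
    (\<forall>T'. precompact_group_topology G T' \<and> subtopology T' H = \<zeta> \<longrightarrow> topology_le T' \<zeta>')"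

end

theory Submission
  imports Defs
begin

text \<open>
  Write \<open>\<tau>\<close> for the finest precompact topology on \<open>G\<close> in which \<open>u\<close> tends to the neutral element, and
  \<open>\<zeta>\<close> for that on \<open>H\<close>. The restriction of \<open>\<tau>\<close> to \<open>H\<close> is precompact and \<open>u\<close> converges in it, so it is
  coarser than \<open>\<zeta>\<close>. And if a precompact topology on \<open>G\<close> restricts to \<open>\<zeta>\<close>, then \<open>u\<close> converges in it,
  so it is coarser than \<open>\<tau>\<close>. What has to be shown is that \<open>\<zeta>\<close> is coarser than the restriction
  of \<open>\<tau>\<close>.

  This is where characters come in. If \<open>\<xi>\<close> is a character of \<open>G\<close> along which \<open>u\<close> tends to \<open>1\<close>, then
  \<open>\<tau>\<close> together with the topology induced by \<open>\<xi>\<close> is again precompact, so \<open>\<xi>\<close> is \<open>\<tau>\<close>-continuous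
  (\<open>finest_TB_character_open\<close>). Hence it suffices that every \<open>\<zeta>\<close>-neighbourhood \<open>V\<close> of the neutral
  element contains the set of all \<open>x\<close> in \<open>H\<close> at which finitely many characters of \<open>G\<close>, each
  \<open>\<zeta>\<close>-continuous on \<open>H\<close>, are close to \<open>1\<close>: along these characters \<open>u\<close> tends to \<open>1\<close>. This combines
  the theorem of Peter and Weyl for precompact abelian groups with the extension of characters
  from \<open>H\<close> to \<open>G\<close>. Both are obtained at once from positive definite functions, in four steps.

  \<^item> A Birkhoff-Kakutani length function \<open>d\<close> on \<open>H\<close> describes \<open>V\<close> and finer and finer neighbourhoods
    (\<open>tb_length_function\<close>).
  \<^item> Functions that are Lipschitz for \<open>d\<close> have an invariant mean (\<open>has_mean_exists\<close>). The mean of the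
    products of a bump function with its translates is a \<open>\<zeta>\<close>-continuous positive definite function \<open>p\<close>
    on \<open>H\<close> that vanishes off \<open>V\<close>.
  \<^item> Below a continuous positive definite function \<open>r\<close> on \<open>H\<close> there is a positive multiple of a
    character \<open>\<xi>\<close> of \<open>G\<close> (\<open>dominated_character\<close>). The normalised positive definite functions on \<open>G\<close>
    form a compact convex set whose extreme points are characters. On this set the mean of
    \<open>r * cnj \<phi>\<close> over \<open>H\<close> is affine and upper semicontinuous in \<open>\<phi>\<close>, so its maximum \<open>c\<close> is attained at
    a character \<open>\<xi>\<close>, and \<open>r - c \<xi>\<close> is positive definite because subtracting its mean from a positive
    definite function leaves a positive definite function (\<open>posdef_minus_mean\<close>). Total boundedness
    keeps \<open>c\<close> away from zero. Maximising over functions on \<open>G\<close>, although the mean sees only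
    \<open>H\<close>, yields a character of \<open>G\<close> without a separate extension argument.
  \<^item> Splitting off such multiples repeatedly approximates \<open>p\<close> uniformly by finite combinations of
    characters (\<open>posdef_approx_characters\<close>). Where all these characters are close to \<open>1\<close>, \<open>p\<close> does not
    vanish, so these points lie in \<open>V\<close>. Each of these characters is continuous because \<open>p\<close>
    dominates it (\<open>totally_bounded_length_characters\<close>).
\<close>

section \<open>Positive definite functions\<close>

text \<open>A list of pairs \<open>(x, a)\<close> stands for the formal sum of the point masses \<open>a\<close> at \<open>x\<close>, as in
  the group algebra. Repeated points are harmless, so that formal sums are added by appending
  lists and every identity between forms is proved by induction on lists.\<close>

definition sesq :: "('a, 'b) monoid_scheme \<Rightarrow> ('a \<Rightarrow> complex) \<Rightarrow> ('a \<times> complex) list \<Rightarrow> ('a \<times> complex) list \<Rightarrow> complex"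
  where "sesq G \<phi> xs ys =
    (\<Sum>(x, a)\<leftarrow>xs. \<Sum>(y, b)\<leftarrow>ys. a * cnj b * \<phi> (x \<otimes>\<^bsub>G\<^esub> inv\<^bsub>G\<^esub> y))"

definition supported :: "'a set \<Rightarrow> ('a \<times> complex) list \<Rightarrow> bool"
  where "supported H xs \<longleftrightarrow> fst ` set xs \<subseteq> H"

definition scaled :: "complex \<Rightarrow> ('a \<times> complex) list \<Rightarrow> ('a \<times> complex) list"
  where "scaled c = map (\<lambda>(x, a). (x, c * a))"

definition shift :: "('a, 'b) monoid_scheme \<Rightarrow> 'a \<Rightarrow> ('a \<times> complex) list \<Rightarrow> ('a \<times> complex) list"
  where "shift G h = map (\<lambda>(x, a). (h \<otimes>\<^bsub>G\<^esub> x, a))"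

text \<open>Only values on \<open>H\<close> enter, so that the same function can be considered on a subgroup. Symmetry
  is demanded separately because a nonnegative real part of the form does not imply it.\<close>

definition posdef :: "('a, 'b) monoid_scheme \<Rightarrow> 'a set \<Rightarrow> ('a \<Rightarrow> complex) \<Rightarrow> bool"
  where "posdef G H \<phi> \<longleftrightarrow>
    (\<forall>x\<in>H. \<phi> (inv\<^bsub>G\<^esub> x) = cnj (\<phi> x)) \<and>
    (\<forall>xs. supported H xs \<longrightarrow> 0 \<le> Re (sesq G \<phi> xs xs))"

lemma supported_simps [simp]:
  "supported H []"
  "supported H (p # xs) \<longleftrightarrow> fst p \<in> H \<and> supported H xs"
  "supported H (xs @ ys) \<longleftrightarrow> supported H xs \<and> supported H ys"
  "supported H (scaled c xs) \<longleftrightarrow> supported H xs"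
  by (force simp: supported_def scaled_def)+

lemma scaled_simps [simp]:
  "scaled c [] = []" "scaled c ((x, a) # xs) = (x, c * a) # scaled c xs"
  "scaled c (xs @ ys) = scaled c xs @ scaled c ys"
  by (auto simp: scaled_def)

lemma shift_simps [simp]:
  "shift G h [] = []" "shift G h ((x, a) # xs) = (h \<otimes>\<^bsub>G\<^esub> x, a) # shift G h xs"
  "shift G h (xs @ ys) = shift G h xs @ shift G h ys"
  by (auto simp: shift_def)

lemma sesq_Nil [simp]: "sesq G \<phi> [] ys = 0" "sesq G \<phi> xs [] = 0"
  by (simp_all add: sesq_def case_prod_beta')

lemma sesq_append_left: "sesq G \<phi> (xs @ xs') ys = sesq G \<phi> xs ys + sesq G \<phi> xs' ys"
  by (simp add: sesq_def)

lemma sesq_append_right: "sesq G \<phi> xs (ys @ ys') = sesq G \<phi> xs ys + sesq G \<phi> xs ys'"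
  by (simp add: sesq_def case_prod_beta' sum_list_addf)

lemmas sesq_append = sesq_append_left sesq_append_right

lemma sesq_Cons_left: "sesq G \<phi> ((x, a) # xs) ys = sesq G \<phi> [(x, a)] ys + sesq G \<phi> xs ys"
  by (simp add: sesq_def)

lemma sesq_Cons_right: "sesq G \<phi> xs ((y, b) # ys) = sesq G \<phi> xs [(y, b)] + sesq G \<phi> xs ys"
  by (simp add: sesq_def case_prod_beta' sum_list_addf)

lemma sesq_single [simp]: "sesq G \<phi> [(x, a)] [(y, b)] = a * cnj b * \<phi> (x \<otimes>\<^bsub>G\<^esub> inv\<^bsub>G\<^esub> y)"
  by (simp add: sesq_def)

lemma sesq_scale_left: "sesq G \<phi> (scaled c xs) ys = c * sesq G \<phi> xs ys"
  by (simp add: sesq_def scaled_def case_prod_beta' comp_def sum_list_const_mult[symmetric] mult.assoc)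

lemma sesq_scale_right: "sesq G \<phi> xs (scaled c ys) = cnj c * sesq G \<phi> xs ys"
  by (simp add: sesq_def scaled_def case_prod_beta' comp_def sum_list_const_mult[symmetric] mult_ac)

lemmas sesq_scale = sesq_scale_left sesq_scale_right

lemma sesq_fun_add: "sesq G (\<lambda>x. \<phi> x + \<psi> x) xs ys = sesq G \<phi> xs ys + sesq G \<psi> xs ys"
  by (simp add: sesq_def case_prod_beta' sum_list_addf distrib_left)

lemma sesq_fun_cmult: "sesq G (\<lambda>x. c * \<phi> x) xs ys = c * sesq G \<phi> xs ys"
  by (simp add: sesq_def case_prod_beta' sum_list_const_mult[symmetric] mult_ac)

lemma sesq_fun_diff: "sesq G (\<lambda>x. \<phi> x - \<psi> x) xs ys = sesq G \<phi> xs ys - sesq G \<psi> xs ys"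
  using sesq_fun_add[of G \<phi> "\<lambda>x. (-1) * \<psi> x" xs ys] sesq_fun_cmult[of G "-1" \<psi> xs ys] by simp

lemma sesq_fun_const: "sesq G (\<lambda>x. c) xs xs = c * (cmod (\<Sum>(x, a)\<leftarrow>xs. a))\<^sup>2"
proof -
  have *: "(\<Sum>p\<leftarrow>ys. cnj (snd p)) = cnj (\<Sum>p\<leftarrow>ys. snd p)" for ys :: "('a \<times> complex) list"
    by (induction ys) auto
  have "sesq G (\<lambda>x. c) xs xs = (\<Sum>p\<leftarrow>xs. snd p) * cnj (\<Sum>p\<leftarrow>xs. snd p) * c"
    by (simp add: sesq_def case_prod_beta' sum_list_const_mult sum_list_mult_const *)
  thus ?thesis by (simp add: complex_norm_square[symmetric] case_prod_beta' mult.commute)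
qed

lemma sesq_filter_left:
  "sesq G \<phi> xs ys = sesq G \<phi> (filter P xs) ys + sesq G \<phi> (filter (\<lambda>p. \<not> P p) xs) ys"
proof (induction xs)
  case (Cons p xs)
  obtain x a where p: "p = (x, a)" by force
  show ?case using Cons sesq_Cons_left[of G \<phi> x a xs ys]
      sesq_Cons_left[of G \<phi> x a "filter P xs" ys]
      sesq_Cons_left[of G \<phi> x a "filter (\<lambda>p. \<not> P p) xs" ys] p by auto
qed auto

lemma sesq_filter_right:
  "sesq G \<phi> xs ys = sesq G \<phi> xs (filter P ys) + sesq G \<phi> xs (filter (\<lambda>p. \<not> P p) ys)"
proof (induction ys)
  case (Cons p ys)
  obtain x a where p: "p = (x, a)" by force
  show ?case using Cons sesq_Cons_right[of G \<phi> xs x a ys]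
      sesq_Cons_right[of G \<phi> xs x a "filter P ys"]
      sesq_Cons_right[of G \<phi> xs x a "filter (\<lambda>p. \<not> P p) ys"] p by auto
qed auto

lemma sesq_cong:
  assumes "\<And>p q. p \<in> set xs \<Longrightarrow> q \<in> set ys \<Longrightarrow>
    \<phi> (fst p \<otimes>\<^bsub>G\<^esub> inv\<^bsub>G\<^esub> fst q) = \<psi> (fst p \<otimes>\<^bsub>G\<^esub> inv\<^bsub>G\<^esub> fst q)"
  shows "sesq G \<phi> xs ys = sesq G \<psi> xs ys"
  unfolding sesq_def case_prod_beta' using assms
  by (intro arg_cong[of _ _ sum_list] map_cong refl) auto

lemma sesq_concat_left: "sesq G \<phi> (concat (map F ws)) ys = (\<Sum>w\<leftarrow>ws. sesq G \<phi> (F w) ys)"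
  by (induction ws) (auto simp: sesq_append)

lemma sesq_concat_right: "sesq G \<phi> xs (concat (map F ws)) = (\<Sum>w\<leftarrow>ws. sesq G \<phi> xs (F w))"
  by (induction ws) (auto simp: sesq_append)

lemma nonneg_quadratic_discriminant:
  fixes a b c :: real
  assumes "\<And>t. 0 \<le> a + 2 * t * b + t\<^sup>2 * c"
  shows "b\<^sup>2 \<le> a * c"
proof (cases "c = 0")
  case True
  have "b = 0"
  proof (rule ccontr)
    assume "b \<noteq> 0"
    with assms[of "-(a + 1) / (2 * b)"] True show False by (simp add: field_simps)
  qed
  thus ?thesis using True by simp
next
  case False
  have "0 \<le> c"
  proof (rule ccontr)
    assume n: "\<not> 0 \<le> c"
    have "0 \<le> 2 * a + 2 * t\<^sup>2 * c" for t
      using assms[of t] assms[of "-t"] by simp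
    from this[of "sqrt ((\<bar>a\<bar> + 1) / (- c))"]
    have "0 \<le> 2 * a + 2 * ((\<bar>a\<bar> + 1) / (- c)) * c"
      using n by (subst (asm) real_sqrt_pow2) (auto simp: divide_nonneg_neg)
    with n show False by auto
  qed
  with False have "0 < c" by simp
  have "0 \<le> a - b\<^sup>2 / c"
    using assms[of "- b / c"] \<open>0 < c\<close> by (simp add: field_simps power2_eq_square)
  with \<open>0 < c\<close> show ?thesis by (simp add: field_simps)
qed

context comm_group
begin

lemma supported_shift:
  "subgroup H G \<Longrightarrow> h \<in> H \<Longrightarrow> supported H xs \<Longrightarrow> supported H (shift G h xs)"
  by (auto simp: supported_def shift_def subgroup.m_closed)

lemma quotient_mem: "subgroup H G \<Longrightarrow> x \<in> H \<Longrightarrow> y \<in> H \<Longrightarrow> x \<otimes> inv y \<in> H"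
  by (simp add: subgroup.m_closed subgroup.m_inv_closed)

lemma inv_quotient: "x \<in> carrier G \<Longrightarrow> y \<in> carrier G \<Longrightarrow> inv (x \<otimes> inv y) = y \<otimes> inv x"
  by (simp add: inv_mult m_comm)

lemma quotient_translate:
  assumes "h \<in> carrier G" "x \<in> carrier G" "y \<in> carrier G"
  shows "(h \<otimes> x) \<otimes> inv (h \<otimes> y) = x \<otimes> inv y"
proof -
  have "h \<otimes> (inv h \<otimes> (x \<otimes> inv y)) = x \<otimes> inv y"
    using assms by (simp add: m_assoc[symmetric])
  thus ?thesis
    using assms by (simp add: inv_mult m_assoc m_lcomm[of x "inv h"])
qed

lemma sesq_shift:
  assumes "h \<in> carrier G" "supported (carrier G) xs" "supported (carrier G) ys"
  shows "sesq G \<phi> (shift G h xs) (shift G h ys) = sesq G \<phi> xs ys"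
  unfolding sesq_def shift_def case_prod_beta' map_map comp_def fst_conv snd_conv
  using assms
  by (intro arg_cong[of _ _ sum_list] map_cong refl)
     (auto simp: supported_def quotient_translate image_subset_iff)

lemma supported_carrier: "subgroup H G \<Longrightarrow> supported H xs \<Longrightarrow> supported (carrier G) xs"
  using subgroup.subset by (fastforce simp: supported_def)

lemma sesq_hermitian:
  assumes H: "subgroup H G" and "\<forall>x\<in>H. \<phi> (inv x) = cnj (\<phi> x)"
    and "supported H xs" "supported H ys"
  shows "sesq G \<phi> ys xs = cnj (sesq G \<phi> xs ys)"
  using assms(3)
proof (induction xs)
  case (Cons p xs)
  obtain x a where p: "p = (x, a)" by force
  have "sesq G \<phi> ys [(x, a)] = cnj (sesq G \<phi> [(x, a)] ys)"
    using assms(4)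
  proof (induction ys)
    case (Cons q ys)
    obtain y b where q: "q = (y, b)" by force
    have xy: "x \<in> H" "y \<in> H" using p q \<open>supported H (p # xs)\<close> Cons.prems by auto
    have "\<phi> (inv (x \<otimes> inv y)) = cnj (\<phi> (x \<otimes> inv y))"
      using assms(2) quotient_mem[OF H xy] by blast
    moreover have "inv (x \<otimes> inv y) = y \<otimes> inv x"
      using xy subgroup.mem_carrier[OF H] by (intro inv_quotient) auto
    ultimately have "\<phi> (y \<otimes> inv x) = cnj (\<phi> (x \<otimes> inv y))" by simp
    thus ?case
      using Cons unfolding q sesq_Cons_left[of G \<phi> y b ys] sesq_Cons_right[of G \<phi> "[(x,a)]" y b ys]
      by simp
  qed auto
  thus ?case
    using Cons unfolding p sesq_Cons_left[of G \<phi> x a xs] sesq_Cons_right[of G \<phi> ys x a xs]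
    by simp
qed auto

lemma posdef_hermitian:
  assumes "subgroup H G" "posdef G H \<phi>" "supported H xs" "supported H ys"
  shows "sesq G \<phi> ys xs = cnj (sesq G \<phi> xs ys)"
  using sesq_hermitian[OF assms(1) _ assms(3,4)] assms(2) unfolding posdef_def by blast

lemma posdef_nonneg: "posdef G H \<phi> \<Longrightarrow> supported H xs \<Longrightarrow> 0 \<le> Re (sesq G \<phi> xs xs)"
  by (simp add: posdef_def)

text \<open>The discriminant bounds the real part of the form; rotating one argument by a unimodular factor
  turns this into a bound for the modulus.\<close>

lemma posdef_Cauchy_Schwarz:
  assumes H: "subgroup H G" and \<phi>: "posdef G H \<phi>" and s: "supported H xs" "supported H ys"
  shows "(cmod (sesq G \<phi> xs ys))\<^sup>2 \<le> Re (sesq G \<phi> xs xs) * Re (sesq G \<phi> ys ys)"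
proof -
  have re: "(Re (sesq G \<phi> xs ys))\<^sup>2 \<le> Re (sesq G \<phi> xs xs) * Re (sesq G \<phi> ys ys)"
    if s: "supported H xs" "supported H ys" for xs ys
  proof (rule nonneg_quadratic_discriminant)
    fix t :: real
    have "0 \<le> Re (sesq G \<phi> (xs @ scaled t ys) (xs @ scaled t ys))"
      using s by (intro posdef_nonneg[OF \<phi>]) simp
    also have "\<dots> = Re (sesq G \<phi> xs xs) + 2 * t * Re (sesq G \<phi> xs ys) + t\<^sup>2 * Re (sesq G \<phi> ys ys)"
      using posdef_hermitian[OF H \<phi> s]
      by (simp add: sesq_append sesq_scale algebra_simps power2_eq_square)
    finally show "0 \<le> Re (sesq G \<phi> xs xs) + 2 * t * Re (sesq G \<phi> xs ys) + t\<^sup>2 * Re (sesq G \<phi> ys ys)" .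
  qed
  let ?z = "sesq G \<phi> xs ys"
  show ?thesis
  proof (cases "?z = 0")
    case True
    thus ?thesis using posdef_nonneg[OF \<phi>] s by simp
  next
    case False
    \<comment> \<open>rotate so that the product becomes real and nonnegative\<close>
    define w where "w = cnj (sgn ?z)"
    have "?z * cnj ?z = complex_of_real (cmod ?z) * complex_of_real (cmod ?z)"
      by (simp only: complex_norm_square[symmetric] power2_eq_square of_real_mult)
    hence w: "w * ?z = cmod ?z" "w * cnj w = 1"
      using False by (simp_all add: w_def sgn_eq field_simps)
    have "sesq G \<phi> (scaled w xs) (scaled w xs) = (w * cnj w) * sesq G \<phi> xs xs"
      by (simp add: sesq_scale mult_ac)
    hence "sesq G \<phi> (scaled w xs) (scaled w xs) = sesq G \<phi> xs xs"
      using w(2) by simp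
    moreover have "sesq G \<phi> (scaled w xs) ys = cmod ?z"
      using w(1) by (simp only: sesq_scale)
    ultimately show ?thesis
      using re[of "scaled w xs" ys] s by simp
  qed
qed

lemma posdef_one:
  assumes H: "subgroup H G" and \<phi>: "posdef G H \<phi>"
  shows "Im (\<phi> \<one>) = 0" "0 \<le> Re (\<phi> \<one>)" "\<phi> \<one> = complex_of_real (Re (\<phi> \<one>))"
proof -
  have 1: "\<one> \<in> H" using H by (rule subgroup.one_closed)
  hence "\<phi> (inv \<one>) = cnj (\<phi> \<one>)" using \<phi> by (simp add: posdef_def del: inv_one)
  hence "\<phi> \<one> = cnj (\<phi> \<one>)" by simp
  thus i: "Im (\<phi> \<one>) = 0" by (simp add: complex_eq_iff)
  show "0 \<le> Re (\<phi> \<one>)" using posdef_nonneg[OF \<phi>, of "[(\<one>, 1)]"] 1 by simp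
  show "\<phi> \<one> = complex_of_real (Re (\<phi> \<one>))" using i by (simp add: complex_eq_iff)
qed

lemma posdef_bound:
  assumes H: "subgroup H G" and \<phi>: "posdef G H \<phi>" and x: "x \<in> H"
  shows "cmod (\<phi> x) \<le> Re (\<phi> \<one>)"
proof -
  have c: "x \<in> carrier G" "\<one> \<in> H" using subgroup.mem_carrier[OF H x] subgroup.one_closed[OF H] .
  have "(cmod (\<phi> x))\<^sup>2 \<le> Re (\<phi> \<one>) * Re (\<phi> \<one>)"
    using posdef_Cauchy_Schwarz[OF H \<phi>, of "[(x, 1)]" "[(\<one>, 1)]"] x c by simp
  thus ?thesis using posdef_one(2)[OF H \<phi>] by (metis power2_eq_square power2_le_imp_le)
qed

lemma posdef_add: "posdef G H \<phi> \<Longrightarrow> posdef G H \<psi> \<Longrightarrow> posdef G H (\<lambda>x. \<phi> x + \<psi> x)"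
  by (simp add: posdef_def sesq_fun_add)

lemma posdef_cmult: "posdef G H \<phi> \<Longrightarrow> 0 \<le> c \<Longrightarrow> posdef G H (\<lambda>x. complex_of_real c * \<phi> x)"
  by (simp add: posdef_def sesq_fun_cmult)

lemma sesq_cong_on:
  assumes H: "subgroup H G" and "\<And>x. x \<in> H \<Longrightarrow> \<phi> x = \<psi> x" "supported H xs" "supported H ys"
  shows "sesq G \<phi> xs ys = sesq G \<psi> xs ys"
  using assms by (intro sesq_cong) (auto simp: supported_def quotient_mem image_subset_iff)

lemma posdef_cong:
  assumes H: "subgroup H G" and eq: "\<And>x. x \<in> H \<Longrightarrow> \<phi> x = \<psi> x" and "posdef G H \<phi>"
  shows "posdef G H \<psi>"
  using assms(3) sesq_cong_on[OF H eq] by (auto simp: posdef_def subgroup.m_inv_closed[OF H] simp flip: eq)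

lemma posdef_subgroup:
  "subgroup H G \<Longrightarrow> subgroup K G \<Longrightarrow> K \<subseteq> H \<Longrightarrow> posdef G H \<phi> \<Longrightarrow> posdef G K \<phi>"
  by (auto simp: posdef_def supported_def)

lemma posdef_cnj:
  assumes "posdef G H \<phi>" shows "posdef G H (\<lambda>x. cnj (\<phi> x))"
proof -
  have "sesq G (\<lambda>x. cnj (\<phi> x)) xs ys = cnj (sesq G \<phi> (map (apsnd cnj) xs) (map (apsnd cnj) ys))"
    for xs ys
  proof -
    have *: "cnj (sum_list zs) = sum_list (map cnj zs)" for zs by (induction zs) auto
    show ?thesis by (simp add: sesq_def case_prod_beta' comp_def *)
  qed
  moreover have "supported H xs \<Longrightarrow> supported H (map (apsnd cnj) xs)" for xs
    by (auto simp: supported_def)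
  ultimately show ?thesis using assms by (simp add: posdef_def)
qed

end

section \<open>Products of positive definite functions\<close>

definition psd_kernel :: "nat \<Rightarrow> (nat \<Rightarrow> nat \<Rightarrow> complex) \<Rightarrow> bool"
  where "psd_kernel n K \<longleftrightarrow> (\<forall>i<n. \<forall>j<n. K j i = cnj (K i j)) \<and>
    (\<forall>b. 0 \<le> Re (\<Sum>i<n. \<Sum>j<n. b i * cnj (b j) * K i j))"

lemma psd_kernel_hermitian: "psd_kernel n K \<Longrightarrow> i < n \<Longrightarrow> j < n \<Longrightarrow> K j i = cnj (K i j)"
  unfolding psd_kernel_def by blast

lemma psd_kernel_nonneg: "psd_kernel n K \<Longrightarrow> 0 \<le> Re (\<Sum>i<n. \<Sum>j<n. b i * cnj (b j) * K i j)"
  unfolding psd_kernel_def by blast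

lemma psd_kernel_mono:
  assumes "psd_kernel (Suc n) K" shows "psd_kernel n K"
  unfolding psd_kernel_def
proof (intro conjI allI impI)
  fix b :: "nat \<Rightarrow> complex"
  have "0 \<le> Re (\<Sum>i<Suc n. \<Sum>j<Suc n. (b(n := 0)) i * cnj ((b(n := 0)) j) * K i j)"
    using assms unfolding psd_kernel_def by blast
  thus "0 \<le> Re (\<Sum>i<n. \<Sum>j<n. b i * cnj (b j) * K i j)" by simp
qed (use psd_kernel_hermitian[OF assms] less_SucI in blast)

lemma psd_kernel_diagonal:
  assumes K: "psd_kernel n K" and i: "i < n"
  shows "K i i = complex_of_real (Re (K i i))" "0 \<le> Re (K i i)"
proof -
  have "K i i = cnj (K i i)" using assms unfolding psd_kernel_def by blast
  thus "K i i = complex_of_real (Re (K i i))" by (simp add: complex_eq_iff)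
  define b :: "nat \<Rightarrow> complex" where "b = (\<lambda>j. if j = i then 1 else 0)"
  have "0 \<le> Re (\<Sum>k<n. \<Sum>j<n. b k * cnj (b j) * K k j)"
    using K unfolding psd_kernel_def by blast
  also have "(\<Sum>k<n. \<Sum>j<n. b k * cnj (b j) * K k j) = (\<Sum>k<n. if k = i then K i i else 0)"
    by (intro sum.cong refl) (use i in \<open>auto simp: b_def if_distrib[of cnj] if_distrib[of "\<lambda>x. x * _"] cong: if_cong\<close>)
  also have "\<dots> = K i i" using i by simp
  finally show "0 \<le> Re (K i i)" .
qed

lemma psd_kernel_two_points:
  assumes K: "psd_kernel n K" and ij: "i < n" "j < n" "i \<noteq> j"
  shows "0 \<le> (cmod a)\<^sup>2 * Re (K i i) + 2 * Re (a * cnj b * K i j) + (cmod b)\<^sup>2 * Re (K j j)"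
proof -
  define c :: "nat \<Rightarrow> complex" where "c = (\<lambda>k. if k = i then a else if k = j then b else 0)"
  have c: "(\<Sum>k<n. c k * F k) = a * F i + b * F j" for F :: "nat \<Rightarrow> complex"
  proof -
    have "(\<Sum>k<n. c k * F k) = (\<Sum>k\<in>{i, j}. c k * F k)"
      using ij by (intro sum.mono_neutral_right) (auto simp: c_def)
    thus ?thesis using ij by (simp add: c_def)
  qed
  have cc: "(\<Sum>k<n. cnj (c k) * F k) = cnj a * F i + cnj b * F j" for F :: "nat \<Rightarrow> complex"
    using c[of "\<lambda>k. cnj (F k)"] by (metis (no_types, lifting) cnj_sum complex_cnj_add complex_cnj_cnj complex_cnj_mult sum.cong)
  have "0 \<le> Re (\<Sum>k<n. \<Sum>l<n. c k * cnj (c l) * K k l)"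
    using K unfolding psd_kernel_def by blast
  also have "(\<Sum>k<n. \<Sum>l<n. c k * cnj (c l) * K k l) = (\<Sum>k<n. c k * (\<Sum>l<n. cnj (c l) * K k l))"
    by (simp add: sum_distrib_left mult.assoc)
  also have "\<dots> = a * (cnj a * K i i + cnj b * K i j) + b * (cnj a * K j i + cnj b * K j j)"
    by (simp only: c cc)
  also have "K j i = cnj (K i j)" using psd_kernel_hermitian[OF K ij(1,2)] .
  also have "Re (a * (cnj a * K i i + cnj b * K i j) + b * (cnj a * cnj (K i j) + cnj b * K j j)) =
     Re (a * cnj a * K i i) + 2 * Re (a * cnj b * K i j) + Re (b * cnj b * K j j)"
    by (simp add: algebra_simps)
  finally show ?thesis by (simp add: complex_norm_square[symmetric] del: of_real_power)
qed

text \<open>One step of Gaussian elimination with the last index as pivot. If the pivot vanishes, the whole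
  row does, by testing with a large multiple of its entry. Otherwise \<open>K'\<close> is the Schur complement;
  its form at \<open>b\<close> is the form of \<open>K\<close> at the extension of \<open>b\<close> that minimises it.\<close>

lemma psd_kernel_pivot:
  assumes K: "psd_kernel (Suc n) K"
  obtains v K' where "psd_kernel n K'"
    "\<And>i j. i < Suc n \<Longrightarrow> j < Suc n \<Longrightarrow> K i j = v i * cnj (v j) + (if i = n \<or> j = n then 0 else K' i j)"
proof (cases "Re (K n n) = 0")
  case True
  hence nn: "K n n = 0" using psd_kernel_diagonal[OF K, of n] by simp
  have row: "K i n = 0" if "i < n" for i
  proof (rule ccontr)
    assume nz: "K i n \<noteq> 0"
    define t where "t = (Re (K i i) + 1) / (2 * (cmod (K i n))\<^sup>2)"
    have "0 \<le> Re (K i i) + 2 * Re (1 * cnj (- t * K i n) * K i n)"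
      using psd_kernel_two_points[OF K, of i n 1 "- complex_of_real t * K i n"] that nn by simp
    moreover have "Re (1 * cnj (- t * K i n) * K i n) = - t * (cmod (K i n))\<^sup>2"
      unfolding cmod_power2 by (simp add: power2_eq_square algebra_simps)
    ultimately have "0 \<le> Re (K i i) - 2 * t * (cmod (K i n))\<^sup>2" by simp
    also have "\<dots> = -1" using nz by (simp add: t_def field_simps)
    finally show False by simp
  qed
  have col: "K n i = 0" if "i < n" for i
  proof -
    have "K n i = cnj (K i n)" using psd_kernel_hermitian[OF K, of i n] that by simp
    thus ?thesis using row[OF that] by simp
  qed
  show ?thesis
    using row col nn by (intro that[of K "\<lambda>_. 0"] psd_kernel_mono[OF K]) (auto simp: less_Suc_eq)
next
  case False
  define d where "d = Re (K n n)"
  have d: "0 < d" "K n n = complex_of_real d"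
    using False psd_kernel_diagonal[OF K, of n] by (auto simp: d_def)
  define v where "v = (\<lambda>i. K i n / complex_of_real (sqrt d))"
  have cK: "cnj (K j n) = K n j" if "j < Suc n" for j
    using psd_kernel_hermitian[OF K, of j n] that by simp
  have vv: "v i * cnj (v j) = K i n * K n j / d" if "j < Suc n" for i j
  proof -
    have "complex_of_real (sqrt d) * complex_of_real (sqrt d) = d"
      using d by (simp flip: of_real_mult)
    thus ?thesis using cK[OF that] by (simp add: v_def)
  qed
  define K' where "K' = (\<lambda>i j. K i j - v i * cnj (v j))"
  have "psd_kernel n K'"
    unfolding psd_kernel_def
  proof (intro conjI allI impI)
    fix i j assume "i < n" "j < n"
    hence "K j i = cnj (K i j)" using psd_kernel_hermitian[OF K, of i j] by simp
    thus "K' j i = cnj (K' i j)" by (simp add: K'_def)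
  next
    fix b :: "nat \<Rightarrow> complex"
    define z where "z = (\<Sum>i<n. b i * K i n)"
    \<comment> \<open>the minimising last coordinate\<close>
    define c where "c = b(n := - z / d)"
    have zc: "cnj z = (\<Sum>j<n. cnj (b j) * K n j)" by (simp add: z_def cK)
    have cb: "c i = b i" if "i < n" for i using that by (simp add: c_def)
    have "0 \<le> Re (\<Sum>i<Suc n. \<Sum>j<Suc n. c i * cnj (c j) * K i j)"
      using K unfolding psd_kernel_def by blast
    also have "(\<Sum>i<Suc n. \<Sum>j<Suc n. c i * cnj (c j) * K i j) =
        (\<Sum>i<n. \<Sum>j<n. b i * cnj (b j) * K i j) + (\<Sum>i<n. b i * cnj (c n) * K i n)
        + ((\<Sum>j<n. c n * cnj (b j) * K n j) + c n * cnj (c n) * K n n)"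
      by (simp add: cb sum.distrib)
    also have "(\<Sum>i<n. b i * cnj (c n) * K i n) = cnj (c n) * z"
      by (simp add: z_def sum_distrib_left mult_ac)
    also have "(\<Sum>j<n. c n * cnj (b j) * K n j) = c n * cnj z"
      by (simp add: zc sum_distrib_left mult_ac)
    also have "(\<Sum>i<n. \<Sum>j<n. b i * cnj (b j) * K i j) + cnj (c n) * z + (c n * cnj z + c n * cnj (c n) * K n n)
       = (\<Sum>i<n. \<Sum>j<n. b i * cnj (b j) * K i j) - z * cnj z / d"
      using d by (simp add: c_def field_simps)
    also have "\<dots> = (\<Sum>i<n. \<Sum>j<n. b i * cnj (b j) * K' i j)"
    proof -
      have "z * cnj z / d = (\<Sum>i<n. \<Sum>j<n. b i * cnj (b j) * (v i * cnj (v j)))"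
        unfolding zc by (simp add: z_def sum_product sum_divide_distrib vv mult_ac)
      thus ?thesis by (simp add: K'_def right_diff_distrib sum_subtractf)
    qed
    finally show "0 \<le> Re (\<Sum>i<n. \<Sum>j<n. b i * cnj (b j) * K' i j)" .
  qed
  moreover have "K i j = v i * cnj (v j) + (if i = n \<or> j = n then 0 else K' i j)"
    if "i < Suc n" "j < Suc n" for i j
    using vv[OF that(2), of i] d by (auto simp: K'_def)
  ultimately show ?thesis using that by blast
qed

text \<open>Schur's product theorem, one pivot at a time: for the rank-one summand split off from \<open>K\<close> the
  claim is semidefiniteness of \<open>L\<close>, and the rest of \<open>K\<close> has one index less.\<close>

lemma psd_kernel_Schur:
  assumes "psd_kernel n K" "psd_kernel n L"
  shows "0 \<le> Re (\<Sum>i<n. \<Sum>j<n. K i j * L i j)"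
  using assms
proof (induction n arbitrary: K)
  case (Suc n)
  obtain v K' where K': "psd_kernel n K'"
    "\<And>i j. i < Suc n \<Longrightarrow> j < Suc n \<Longrightarrow> K i j = v i * cnj (v j) + (if i = n \<or> j = n then 0 else K' i j)"
    using psd_kernel_pivot[OF Suc.prems(1)] by metis
  have "(\<Sum>i<Suc n. \<Sum>j<Suc n. K i j * L i j) =
      (\<Sum>i<Suc n. \<Sum>j<Suc n. v i * cnj (v j) * L i j + (if i = n \<or> j = n then 0 else K' i j) * L i j)"
    by (intro sum.cong refl) (simp add: K'(2) distrib_right)
  also have "\<dots> = (\<Sum>i<Suc n. \<Sum>j<Suc n. v i * cnj (v j) * L i j) + (\<Sum>i<n. \<Sum>j<n. K' i j * L i j)"
    unfolding sum.distrib by simp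
  finally show ?case
    using Suc.IH[OF K'(1) psd_kernel_mono[OF Suc.prems(2)]] psd_kernel_nonneg[OF Suc.prems(2), of v]
    by (simp only: plus_complex.simps)
qed simp

context comm_group
begin

lemma sesq_nth:
  "sesq G \<phi> xs xs = (\<Sum>i<length xs. \<Sum>j<length xs. snd (xs ! i) * cnj (snd (xs ! j)) * \<phi> (fst (xs ! i) \<otimes> inv (fst (xs ! j))))"
  by (simp add: sesq_def case_prod_beta' sum_list_sum_nth atLeast0LessThan)

lemma posdef_kernel:
  assumes H: "subgroup H G" and \<phi>: "posdef G H \<phi>" and s: "supported H xs"
  shows "psd_kernel (length xs) (\<lambda>i j. snd (xs ! i) * cnj (snd (xs ! j)) * \<phi> (fst (xs ! i) \<otimes> inv (fst (xs ! j))))"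
  unfolding psd_kernel_def
proof (intro conjI allI impI)
  fix i j assume "i < length xs" "j < length xs"
  hence m: "fst (xs ! i) \<in> H" "fst (xs ! j) \<in> H" using s by (auto simp: supported_def)
  have "\<phi> (inv (fst (xs ! i) \<otimes> inv fst (xs ! j))) = cnj (\<phi> (fst (xs ! i) \<otimes> inv fst (xs ! j)))"
    using \<phi> quotient_mem[OF H m] unfolding posdef_def by blast
  moreover have "inv (fst (xs ! i) \<otimes> inv fst (xs ! j)) = fst (xs ! j) \<otimes> inv fst (xs ! i)"
    using m subgroup.mem_carrier[OF H] by (intro inv_quotient) auto
  ultimately show "snd (xs ! j) * cnj (snd (xs ! i)) * \<phi> (fst (xs ! j) \<otimes> inv fst (xs ! i)) =
      cnj (snd (xs ! i) * cnj (snd (xs ! j)) * \<phi> (fst (xs ! i) \<otimes> inv fst (xs ! j)))" by simp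
next
  fix b :: "nat \<Rightarrow> complex"
  define ys where "ys = map (\<lambda>i. (fst (xs ! i), b i * snd (xs ! i))) [0..<length xs]"
  have "supported H ys" using s by (auto simp: ys_def supported_def)
  hence "0 \<le> Re (sesq G \<phi> ys ys)" by (rule posdef_nonneg[OF \<phi>])
  also have "sesq G \<phi> ys ys = (\<Sum>i<length xs. \<Sum>j<length xs. b i * cnj (b j) *
      (snd (xs ! i) * cnj (snd (xs ! j)) * \<phi> (fst (xs ! i) \<otimes> inv (fst (xs ! j)))))"
    unfolding sesq_nth by (simp add: ys_def mult_ac)
  finally show "0 \<le> Re (\<Sum>i<length xs. \<Sum>j<length xs. b i * cnj (b j) *
      (snd (xs ! i) * cnj (snd (xs ! j)) * \<phi> (fst (xs ! i) \<otimes> inv (fst (xs ! j)))))" .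
qed

lemma posdef_mult:
  assumes H: "subgroup H G" and \<phi>: "posdef G H \<phi>" and \<psi>: "posdef G H \<psi>"
  shows "posdef G H (\<lambda>x. \<phi> x * \<psi> x)"
  unfolding posdef_def
proof (intro conjI ballI allI impI)
  fix xs assume s: "supported H xs"
  define ys where "ys = map (\<lambda>p. (fst p, 1 :: complex)) xs"
  have s': "supported H ys" using s by (auto simp: ys_def supported_def)
  have "0 \<le> Re (\<Sum>i<length xs. \<Sum>j<length xs. (snd (xs ! i) * cnj (snd (xs ! j)) * \<phi> (fst (xs ! i) \<otimes> inv (fst (xs ! j))))
     * \<psi> (fst (xs ! i) \<otimes> inv (fst (xs ! j))))"
    using psd_kernel_Schur[OF posdef_kernel[OF H \<phi> s], of
        "\<lambda>i j. snd (ys ! i) * cnj (snd (ys ! j)) * \<psi> (fst (ys ! i) \<otimes> inv (fst (ys ! j)))"]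
      posdef_kernel[OF H \<psi> s']
    by (simp add: ys_def)
  thus "0 \<le> Re (sesq G (\<lambda>x. \<phi> x * \<psi> x) xs xs)" by (simp add: sesq_nth mult_ac)
qed (use assms in \<open>auto simp: posdef_def\<close>)

end

section \<open>Means of positive definite functions\<close>

text \<open>A nonempty list of points stands for the uniform distribution on its entries, with
  multiplicity. Appending lists of equal length averages two distributions, and \<open>prods\<close> is their
  convolution.\<close>

definition unif :: "'a list \<Rightarrow> ('a \<times> complex) list"
  where "unif zs = map (\<lambda>z. (z, 1 / of_nat (length zs))) zs"

lemma supported_unif [simp]: "supported H (unif zs) \<longleftrightarrow> set zs \<subseteq> H"
  by (auto simp: supported_def unif_def image_image)

lemma shift_unif: "shift G h (unif zs) = unif (map (\<lambda>z. h \<otimes>\<^bsub>G\<^esub> z) zs)"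
  by (simp add: shift_def unif_def)

definition prods :: "('a, 'b) monoid_scheme \<Rightarrow> 'a list \<Rightarrow> 'a list \<Rightarrow> 'a list"
  where "prods G ws zs = concat (map (\<lambda>w. map (\<lambda>z. w \<otimes>\<^bsub>G\<^esub> z) zs) ws)"

lemma length_prods: "length (prods G ws zs) = length ws * length zs"
  by (induction ws) (auto simp: prods_def)

lemma set_prods: "set (prods G ws zs) = (\<Union>w\<in>set ws. (\<lambda>z. w \<otimes>\<^bsub>G\<^esub> z) ` set zs)"
  by (auto simp: prods_def)

lemma sum_list_prods: "(\<Sum>x\<leftarrow>prods G ws zs. F x) = (\<Sum>w\<leftarrow>ws. \<Sum>z\<leftarrow>zs. F (w \<otimes>\<^bsub>G\<^esub> z))"
  by (induction ws) (auto simp: prods_def comp_def)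

lemma unif_prods:
  "unif (prods G ws zs) = scaled (1 / of_nat (length ws)) (concat (map (\<lambda>w. shift G w (unif zs)) ws))"
proof -
  have "map (\<lambda>x. (x, c * d :: complex)) (prods G ws zs) =
      scaled c (concat (map (\<lambda>w. shift G w (map (\<lambda>z. (z, d)) zs)) ws))" for c d
    by (induction ws) (auto simp: prods_def scaled_def shift_def)
  from this[of "1 / of_nat (length ws)" "1 / of_nat (length zs)"]
  show ?thesis by (simp add: unif_def[of "prods G ws zs"] length_prods) (simp add: unif_def)
qed

lemma unif_append:
  assumes "length zs = length ys"
  shows "unif (zs @ ys) = scaled (1/2) (unif zs @ unif ys)"
  using assms by (auto simp: unif_def scaled_def field_simps)

context comm_group
begin

lemma prods_closed: "subgroup H G \<Longrightarrow> set ws \<subseteq> H \<Longrightarrow> set zs \<subseteq> H \<Longrightarrow> set (prods G ws zs) \<subseteq> H"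
  by (fastforce simp: set_prods intro: subgroup.m_closed)

text \<open>All translates of a vector have the same norm, so by Cauchy-Schwarz their mean has at most
  this norm.\<close>

lemma posdef_unif_prods_le:
  assumes H: "subgroup H G" and \<phi>: "posdef G H \<phi>" and ws: "set ws \<subseteq> H" "ws \<noteq> []" and zs: "set zs \<subseteq> H"
  shows "Re (sesq G \<phi> (unif (prods G ws zs)) (unif (prods G ws zs))) \<le> Re (sesq G \<phi> (unif zs) (unif zs))"
proof -
  let ?q = "Re (sesq G \<phi> (unif zs) (unif zs))"
  let ?n = "real (length ws)"
  have cross: "Re (sesq G \<phi> (shift G w (unif zs)) (shift G w' (unif zs))) \<le> ?q"
    if "w \<in> H" "w' \<in> H" for w w'
  proof -
    have c: "sesq G \<phi> (shift G v (unif zs)) (shift G v (unif zs)) = sesq G \<phi> (unif zs) (unif zs)"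
      if "v \<in> H" for v
      using that zs subgroup.subset[OF H] by (intro sesq_shift) auto
    have "(cmod (sesq G \<phi> (shift G w (unif zs)) (shift G w' (unif zs))))\<^sup>2 \<le> ?q * ?q"
      using posdef_Cauchy_Schwarz[OF H \<phi>, of "shift G w (unif zs)" "shift G w' (unif zs)"]
        that zs by (simp add: c supported_shift[OF H])
    hence "cmod (sesq G \<phi> (shift G w (unif zs)) (shift G w' (unif zs))) \<le> ?q"
      using posdef_nonneg[OF \<phi>, of "unif zs"] zs
      by (metis power2_eq_square power2_le_imp_le supported_unif)
    thus ?thesis using complex_Re_le_cmod order_trans by blast
  qed
  define Y where "Y = concat (map (\<lambda>w. shift G w (unif zs)) ws)"
  have "sesq G \<phi> Y Y = (\<Sum>w\<leftarrow>ws. sesq G \<phi> (shift G w (unif zs)) Y)"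
    unfolding Y_def by (rule sesq_concat_left)
  also have "\<dots> = (\<Sum>w\<leftarrow>ws. \<Sum>w'\<leftarrow>ws. sesq G \<phi> (shift G w (unif zs)) (shift G w' (unif zs)))"
    unfolding Y_def by (simp only: sesq_concat_right)
  finally have "Re (sesq G \<phi> Y Y) =
      (\<Sum>w\<leftarrow>ws. \<Sum>w'\<leftarrow>ws. Re (sesq G \<phi> (shift G w (unif zs)) (shift G w' (unif zs))))"
  proof -
    have *: "Re (sum_list xs) = sum_list (map Re xs)" for xs by (induction xs) auto
    assume "sesq G \<phi> Y Y = (\<Sum>w\<leftarrow>ws. \<Sum>w'\<leftarrow>ws. sesq G \<phi> (shift G w (unif zs)) (shift G w' (unif zs)))"
    thus ?thesis by (simp add: * comp_def)
  qed
  moreover have "Re (sesq G \<phi> (unif (prods G ws zs)) (unif (prods G ws zs))) = Re (sesq G \<phi> Y Y) / ?n\<^sup>2"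
    unfolding unif_prods Y_def[symmetric] by (simp add: sesq_scale power2_eq_square)
  ultimately have "Re (sesq G \<phi> (unif (prods G ws zs)) (unif (prods G ws zs))) =
      (\<Sum>w\<leftarrow>ws. \<Sum>w'\<leftarrow>ws. Re (sesq G \<phi> (shift G w (unif zs)) (shift G w' (unif zs)))) / ?n\<^sup>2"
    by simp
  also have "\<dots> \<le> (\<Sum>w\<leftarrow>ws. \<Sum>w'\<leftarrow>ws. ?q) / ?n\<^sup>2"
    using cross ws by (intro divide_right_mono sum_list_mono) auto
  also have "\<dots> = ?q" using ws by (simp add: sum_list_triv power2_eq_square)
  finally show ?thesis .
qed

text \<open>This is the norm-minimising argument behind the mean ergodic theorem. A convex combination \<open>\<nu>\<close> of
  translates whose norm is almost minimal is almost invariant, by the parallelogram law. Hence the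
  products of \<open>\<nu>\<close> with all point masses are nearly the same number, which must be the squared norm
  of \<open>\<nu>\<close>; expanding the square of \<open>xs - s \<nu>\<close>, with \<open>s\<close> the sum of the coefficients of
  \<open>xs\<close>, gives the claim.\<close>

lemma posdef_minus_mean:
  assumes H: "subgroup H G" and \<psi>: "posdef G H \<psi>"
    and c: "\<And>zs. set zs \<subseteq> H \<Longrightarrow> zs \<noteq> [] \<Longrightarrow> c \<le> Re (sesq G \<psi> (unif zs) (unif zs))"
  shows "posdef G H (\<lambda>x. \<psi> x - complex_of_real c)"
proof -
  define q where "q = (\<lambda>zs. Re (sesq G \<psi> (unif zs) (unif zs)))"
  define A where "A = {zs. set zs \<subseteq> H \<and> zs \<noteq> []}"
  define m where "m = Inf (q ` A)"
  have 1: "\<one> \<in> H" using subgroup.one_closed[OF H] .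
  have A: "[\<one>] \<in> A" using 1 by (simp add: A_def)
  have bdd: "bdd_below (q ` A)" using c by (auto simp: q_def A_def bdd_below_def)
  have m_le: "m \<le> q zs" if "zs \<in> A" for zs unfolding m_def using bdd that by (rule cINF_lower)
  have "c \<le> m" unfolding m_def
  proof (rule cINF_greatest)
    show "A \<noteq> {}" using A by blast
  qed (use c in \<open>auto simp: A_def q_def\<close>)
  have main: "m * (cmod s)\<^sup>2 - 4 * cmod s * (\<Sum>(x, a)\<leftarrow>xs. cmod a) * sqrt (Re (\<psi> \<one>) * (4 * e)) \<le> Re (sesq G \<psi> xs xs)"
    if xs: "supported H xs" and s: "s = (\<Sum>(x, a)\<leftarrow>xs. a)" and e: "0 < e" for xs s e
  proof -
    obtain zs where zs: "zs \<in> A" "q zs < m + e"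
      using cInf_lessD[of "q ` A" "m + e"] A e unfolding m_def by auto
    define \<nu> where "\<nu> = unif zs"
    define \<epsilon> where "\<epsilon> = sqrt (Re (\<psi> \<one>) * (4 * e))"
    have zH: "set zs \<subseteq> H" "zs \<noteq> []" and s\<nu>: "supported H \<nu>"
      using zs by (auto simp: A_def \<nu>_def)
    define g where "g = (\<lambda>a. sesq G \<psi> [(a, 1)] \<nu>)"
    have g: "cmod (g a - g \<one>) \<le> \<epsilon>" if a: "a \<in> H" for a
    proof -
      let ?\<nu> = "shift G a \<nu>"
      have sh: "supported H ?\<nu>" using supported_shift[OF H a s\<nu>] .
      have aG: "a \<in> carrier G" using subgroup.mem_carrier[OF H a] .
      have inv1: "sesq G \<psi> ?\<nu> ?\<nu> = sesq G \<psi> \<nu> \<nu>"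
        using aG supported_carrier[OF H s\<nu>] by (intro sesq_shift)
      have inv2: "sesq G \<psi> [(a, 1)] ?\<nu> = g \<one>"
        using sesq_shift[OF aG, of "[(\<one>, 1)]" \<nu> \<psi>] supported_carrier[OF H s\<nu>] aG by (simp add: g_def)
      have z': "zs @ map (\<lambda>z. a \<otimes> z) zs \<in> A"
        using zH a by (auto simp: A_def subgroup.m_closed[OF H])
      \<comment> \<open>parallelogram law: the sum is large by minimality, so the difference is small\<close>
      define P where "P = \<nu> @ ?\<nu>"
      define M where "M = \<nu> @ scaled (-1) ?\<nu>"
      have "m \<le> q (zs @ map (\<lambda>z. a \<otimes> z) zs)" using m_le z' by blast
      also have "\<dots> = Re (sesq G \<psi> P P) / 4"
        by (simp add: q_def unif_append sesq_scale sesq_append P_def \<nu>_def shift_unif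
            add_divide_distrib)
      finally have P: "4 * m \<le> Re (sesq G \<psi> P P)" by simp
      have "Re (sesq G \<psi> P P) + Re (sesq G \<psi> M M) = 2 * q zs + 2 * Re (sesq G \<psi> ?\<nu> ?\<nu>)"
        by (simp add: P_def M_def sesq_append sesq_scale q_def \<nu>_def)
      hence "Re (sesq G \<psi> M M) \<le> 4 * e" using P zs(2) unfolding inv1 by (simp add: q_def \<nu>_def)
      hence "Re (\<psi> \<one>) * Re (sesq G \<psi> M M) \<le> Re (\<psi> \<one>) * (4 * e)"
        using posdef_one(2)[OF H \<psi>] by (intro mult_left_mono)
      moreover have "(cmod (sesq G \<psi> [(a, 1)] M))\<^sup>2 \<le> Re (\<psi> \<one>) * Re (sesq G \<psi> M M)"
        using posdef_Cauchy_Schwarz[OF H \<psi>, of "[(a, 1)]" M] a aG s\<nu> sh by (simp add: M_def)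
      ultimately have "cmod (sesq G \<psi> [(a, 1)] M) \<le> \<epsilon>"
        unfolding \<epsilon>_def by (intro real_le_rsqrt) simp
      thus ?thesis by (simp add: M_def sesq_append sesq_scale inv2) (simp add: g_def)
    qed
    have lin: "cmod (sesq G \<psi> ys \<nu> - (\<Sum>(x, a)\<leftarrow>ys. a) * g \<one>) \<le> (\<Sum>(x, a)\<leftarrow>ys. cmod a) * \<epsilon>"
      if "supported H ys" for ys
      using that
    proof (induction ys)
      case (Cons p ys)
      obtain x a where p: "p = (x, a)" by force
      have "sesq G \<psi> [(x, a)] \<nu> = a * g x"
        using sesq_scale_left[of G \<psi> a "[(x, 1)]" \<nu>] by (simp add: g_def)
      hence "sesq G \<psi> (p # ys) \<nu> - (\<Sum>(x, a)\<leftarrow>p # ys. a) * g \<one>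
        = a * (g x - g \<one>) + (sesq G \<psi> ys \<nu> - (\<Sum>(x, a)\<leftarrow>ys. a) * g \<one>)"
        using sesq_Cons_left[of G \<psi> x a ys \<nu>] by (simp add: p algebra_simps)
      also have "cmod \<dots> \<le> cmod a * cmod (g x - g \<one>) + cmod (sesq G \<psi> ys \<nu> - (\<Sum>(x, a)\<leftarrow>ys. a) * g \<one>)"
        using norm_triangle_ineq by (metis norm_mult)
      also have "\<dots> \<le> cmod a * \<epsilon> + (\<Sum>(x, a)\<leftarrow>ys. cmod a) * \<epsilon>"
        using Cons p g by (intro add_mono mult_left_mono) auto
      finally show ?case by (simp add: p algebra_simps)
    qed simp
    have "(\<Sum>(x, a)\<leftarrow>\<nu>. a) = 1" "(\<Sum>(x, a)\<leftarrow>\<nu>. cmod a) = 1"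
      using zH by (simp_all add: \<nu>_def unif_def comp_def sum_list_triv norm_divide)
    with lin[OF s\<nu>] have \<nu>1: "cmod (sesq G \<psi> \<nu> \<nu> - g \<one>) \<le> \<epsilon>" by simp
    define N where "N = (\<Sum>(x, a)\<leftarrow>xs. cmod a)"
    have sN: "cmod s \<le> N" unfolding s N_def by (induction xs) (auto intro: norm_triangle_le)
    hence N: "0 \<le> N" using norm_ge_zero order_trans by blast
    have "cmod (sesq G \<psi> xs \<nu> - s * sesq G \<psi> \<nu> \<nu>) \<le>
        cmod (sesq G \<psi> xs \<nu> - s * g \<one>) + cmod (s * (sesq G \<psi> \<nu> \<nu> - g \<one>))"
      by (rule order_trans[OF _ norm_triangle_ineq4]) (simp add: algebra_simps)
    also have "\<dots> \<le> N * \<epsilon> + N * \<epsilon>"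
      using lin[OF xs] \<nu>1 sN N unfolding s[symmetric] N_def[symmetric] norm_mult
      by (intro add_mono mult_mono) auto
    finally have d: "cmod (sesq G \<psi> xs \<nu> - s * sesq G \<psi> \<nu> \<nu>) \<le> 2 * N * \<epsilon>" by simp
    have qr: "sesq G \<psi> \<nu> \<nu> = complex_of_real (q zs)"
    proof -
      have "sesq G \<psi> \<nu> \<nu> = cnj (sesq G \<psi> \<nu> \<nu>)" using posdef_hermitian[OF H \<psi> s\<nu> s\<nu>] .
      thus ?thesis by (simp add: complex_eq_iff q_def \<nu>_def)
    qed
    have "Re (cnj s * (s * sesq G \<psi> \<nu> \<nu> - sesq G \<psi> xs \<nu>)) \<le> cmod s * (2 * N * \<epsilon>)"
      by (rule order_trans[OF complex_Re_le_cmod])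
         (use d in \<open>simp add: norm_mult norm_minus_commute mult_left_mono\<close>)
    moreover have "cnj s * (s * sesq G \<psi> \<nu> \<nu>) = complex_of_real ((cmod s)\<^sup>2 * q zs)"
      by (simp add: qr complex_norm_square mult_ac del: of_real_power)
    ultimately have d': "(cmod s)\<^sup>2 * q zs - Re (cnj s * sesq G \<psi> xs \<nu>) \<le> cmod s * (2 * N * \<epsilon>)"
      by (simp only: right_diff_distrib minus_complex.sel Re_complex_of_real)
    have "0 \<le> Re (sesq G \<psi> (xs @ scaled (- s) \<nu>) (xs @ scaled (- s) \<nu>))"
      using xs s\<nu> by (intro posdef_nonneg[OF \<psi>]) simp
    also have "\<dots> = Re (sesq G \<psi> xs xs) - 2 * Re (cnj s * sesq G \<psi> xs \<nu>) + Re (cnj s * (s * sesq G \<psi> \<nu> \<nu>))"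
      using posdef_hermitian[OF H \<psi> xs s\<nu>] by (simp add: sesq_append sesq_scale algebra_simps)
    also have "cnj s * (s * sesq G \<psi> \<nu> \<nu>) = complex_of_real ((cmod s)\<^sup>2 * q zs)"
      by (simp add: qr complex_norm_square mult_ac del: of_real_power)
    finally have "(cmod s)\<^sup>2 * q zs - 4 * cmod s * N * \<epsilon> \<le> Re (sesq G \<psi> xs xs)"
      using d' by simp
    moreover have "(cmod s)\<^sup>2 * m \<le> (cmod s)\<^sup>2 * q zs"
      using m_le[OF zs(1)] by (intro mult_left_mono) auto
    ultimately show ?thesis unfolding N_def \<epsilon>_def by (simp add: mult.commute)
  qed
  show ?thesis
    unfolding posdef_def
  proof (intro conjI ballI allI impI)
    fix xs assume xs: "supported H xs"
    define s where "s = (\<Sum>(x, a)\<leftarrow>xs. a)"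
    define N where "N = (\<Sum>(x, a)\<leftarrow>xs. cmod a)"
    have "filterlim (\<lambda>e. m * (cmod s)\<^sup>2 - 4 * cmod s * N * sqrt (Re (\<psi> \<one>) * (4 * e)))
       (nhds (m * (cmod s)\<^sup>2 - 4 * cmod s * N * sqrt (Re (\<psi> \<one>) * (4 * 0)))) (at_right 0)"
      by (intro tendsto_intros)
    hence "m * (cmod s)\<^sup>2 - 4 * cmod s * N * sqrt (Re (\<psi> \<one>) * (4 * 0)) \<le> Re (sesq G \<psi> xs xs)"
      by (rule tendsto_upperbound)
         (use main[OF xs s_def] in \<open>auto simp: eventually_at_filter N_def\<close>)
    moreover have "c * (cmod s)\<^sup>2 \<le> m * (cmod s)\<^sup>2" using \<open>c \<le> m\<close> by (intro mult_right_mono) auto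
    ultimately show "0 \<le> Re (sesq G (\<lambda>x. \<psi> x - complex_of_real c) xs xs)"
      by (simp add: sesq_fun_diff sesq_fun_const s_def del: of_real_power)
  qed (use \<psi> in \<open>auto simp: posdef_def\<close>)
qed

text \<open>Vectors supported in different cosets of \<open>H\<close> are orthogonal, and a vector supported in one
  coset is a translate of a vector supported in \<open>H\<close>.\<close>

lemma posdef_extend_zero:
  assumes H: "subgroup H G" and \<phi>: "posdef G H \<phi>"
  shows "posdef G (carrier G) (\<lambda>x. if x \<in> H then \<phi> x else 0)"
proof -
  let ?\<phi> = "\<lambda>x. if x \<in> H then \<phi> x else 0"
  have "0 \<le> Re (sesq G ?\<phi> xs xs)" if "supported (carrier G) xs" for xs
    using that
  proof (induction "length xs" arbitrary: xs rule: less_induct)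
    case less
    show ?case
    proof (cases xs)
      case (Cons p xs')
      define h where "h = fst p"
      have h: "h \<in> carrier G" using Cons less.prems by (simp add: h_def)
      define P where "P = (\<lambda>q :: 'a \<times> complex. inv h \<otimes> fst q \<in> H)"
      let ?a = "filter P xs" and ?b = "filter (\<lambda>q. \<not> P q) xs"
      have car: "fst q \<in> carrier G" if "q \<in> set xs" for q using less.prems that by (auto simp: supported_def)
      have "P p" using h H by (simp add: P_def h_def subgroup.one_closed)
      hence "length ?b < length xs" using Cons
        by (metis length_filter_less list.set_intros(1))
      moreover have sb: "supported (carrier G) ?b" "supported (carrier G) ?a"
        using car by (auto simp: supported_def)
      ultimately have b: "0 \<le> Re (sesq G ?\<phi> ?b ?b)" using less.hyps by blast
      have split: "fst r \<otimes> inv fst q \<notin> H \<and> fst q \<otimes> inv fst r \<notin> H" if "q \<in> set ?a" "r \<in> set ?b" for q r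
      proof -
        have q: "fst q \<in> carrier G" "inv h \<otimes> fst q \<in> H" and r: "fst r \<in> carrier G" "inv h \<otimes> fst r \<notin> H"
          using that car by (auto simp: P_def)
        have "fst r \<otimes> inv fst q \<in> H \<Longrightarrow> (fst r \<otimes> inv fst q) \<otimes> (inv h \<otimes> fst q) \<in> H"
          using q subgroup.m_closed[OF H] by blast
        moreover have "(fst r \<otimes> inv fst q) \<otimes> (inv h \<otimes> fst q) = inv h \<otimes> fst r"
        proof -
          have "(fst r \<otimes> inv fst q) \<otimes> (inv h \<otimes> fst q) = (inv h \<otimes> fst r) \<otimes> (inv fst q \<otimes> fst q)"
            using q r h by (simp only: m_ac m_closed inv_closed)
          thus ?thesis using q r h by simp
        qed
        ultimately have 1: "fst r \<otimes> inv fst q \<notin> H" using r by auto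
        have "inv (fst q \<otimes> inv fst r) = fst r \<otimes> inv fst q" using q r by (intro inv_quotient)
        with 1 show ?thesis using subgroup.m_inv_closed[OF H] by metis
      qed
      have cross: "sesq G ?\<phi> ?a ?b = 0" "sesq G ?\<phi> ?b ?a = 0"
      proof -
        have "sesq G ?\<phi> ?a ?b = sesq G (\<lambda>x. 0) ?a ?b" "sesq G ?\<phi> ?b ?a = sesq G (\<lambda>x. 0) ?b ?a"
          using split by (intro sesq_cong; simp)+
        thus "sesq G ?\<phi> ?a ?b = 0" "sesq G ?\<phi> ?b ?a = 0"
          using sesq_fun_cmult[of G 0 "\<lambda>x. 0"] by auto
      qed
      have sh: "supported H (shift G (inv h) ?a)"
        by (auto simp: supported_def shift_def P_def)
      have "sesq G ?\<phi> ?a ?a = sesq G ?\<phi> (shift G (inv h) ?a) (shift G (inv h) ?a)"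
        using h sb by (simp add: sesq_shift)
      also have "\<dots> = sesq G \<phi> (shift G (inv h) ?a) (shift G (inv h) ?a)"
        by (rule sesq_cong_on[OF H _ sh sh]) simp
      finally have "0 \<le> Re (sesq G ?\<phi> ?a ?a)" using posdef_nonneg[OF \<phi> sh] by simp
      moreover have "sesq G ?\<phi> xs xs = sesq G ?\<phi> ?a ?a + sesq G ?\<phi> ?b ?b"
        using sesq_filter_left[of G ?\<phi> xs xs P] sesq_filter_right[of G ?\<phi> ?a xs P]
          sesq_filter_right[of G ?\<phi> ?b xs P] cross by simp
      ultimately show ?thesis using b by simp
    qed simp
  qed
  moreover have "?\<phi> (inv x) = cnj (?\<phi> x)" if "x \<in> carrier G" for x
  proof -
    have "inv x \<in> H \<longleftrightarrow> x \<in> H"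
      using subgroup.m_inv_closed[OF H, of x] subgroup.m_inv_closed[OF H, of "inv x"] inv_inv[OF that] by auto
    thus ?thesis using \<phi> by (auto simp: posdef_def)
  qed
  ultimately show ?thesis unfolding posdef_def by blast
qed

end

section \<open>Extreme positive definite functions\<close>

text \<open>The value zero off the carrier makes this a compact subset of a product of discs.\<close>

definition normalized_posdef :: "('a, 'b) monoid_scheme \<Rightarrow> ('a \<Rightarrow> complex) set"
  where "normalized_posdef G =
    {\<phi>. (\<forall>x. x \<notin> carrier G \<longrightarrow> \<phi> x = 0) \<and> \<phi> \<one>\<^bsub>G\<^esub> = 1 \<and> posdef G (carrier G) \<phi>}"

definition character :: "('a, 'b) monoid_scheme \<Rightarrow> ('a \<Rightarrow> complex) \<Rightarrow> bool"
  where "character G \<xi> \<longleftrightarrow>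
    (\<forall>x\<in>carrier G. \<forall>y\<in>carrier G. \<xi> (x \<otimes>\<^bsub>G\<^esub> y) = \<xi> x * \<xi> y) \<and>
    (\<forall>x\<in>carrier G. cmod (\<xi> x) = 1)"

text \<open>Only the first summand has to lie in the face; exchanging \<open>t\<close> and \<open>1 - t\<close> gives the second.
  The ambient topology is that of pointwise convergence.\<close>

definition face :: "('a, 'b) monoid_scheme \<Rightarrow> ('a \<Rightarrow> complex) set \<Rightarrow> bool"
  where "face G F \<longleftrightarrow> F \<subseteq> normalized_posdef G \<and> closed F \<and> F \<noteq> {} \<and>
    (\<forall>\<phi>\<in>normalized_posdef G. \<forall>\<psi>\<in>normalized_posdef G. \<forall>t::real. 0 < t \<and> t < 1 \<and>
      (\<lambda>x. of_real t * \<phi> x + of_real (1 - t) * \<psi> x) \<in> F \<longrightarrow> \<phi> \<in> F)"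

lemma continuous_on_sum_list:
  fixes f :: "'i \<Rightarrow> 'a::topological_space \<Rightarrow> 'b::topological_monoid_add"
  shows "(\<And>i. i \<in> set is \<Longrightarrow> continuous_on S (f i)) \<Longrightarrow> continuous_on S (\<lambda>x. \<Sum>i\<leftarrow>is. f i x)"
  by (induction "is") (auto intro!: continuous_intros)

lemma continuous_on_sesq:
  fixes F :: "'c::topological_space \<Rightarrow> 'a \<Rightarrow> complex"
  assumes "\<And>x. continuous_on S (\<lambda>\<phi>. F \<phi> x)"
  shows "continuous_on S (\<lambda>\<phi>. sesq G (F \<phi>) xs ys)"
  unfolding sesq_def case_prod_beta' by (intro continuous_on_sum_list continuous_intros assms)

lemma continuous_on_eval: "continuous_on S (\<lambda>\<phi> :: 'a \<Rightarrow> complex. \<phi> x)"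
  by (rule continuous_on_subset[OF continuous_on_product_coordinates]) simp

lemma closed_normalized_posdef: "closed (normalized_posdef G)"
  unfolding normalized_posdef_def posdef_def Ball_def imp_conv_disj
  by (intro closed_Collect_conj closed_Collect_all closed_Collect_disj closed_Collect_const
      closed_Collect_eq closed_Collect_le continuous_intros continuous_on_sesq continuous_on_eval)

context comm_group
begin

lemma normalized_posdef_bound:
  "\<phi> \<in> normalized_posdef G \<Longrightarrow> cmod (\<phi> x) \<le> 1"
  using posdef_bound[OF subgroup_self, of \<phi> x]
  by (cases "x \<in> carrier G") (auto simp: normalized_posdef_def)

lemma compact_normalized_posdef: "compact (normalized_posdef G)"
proof -
  have "compactin (product_topology (\<lambda>_. euclidean) UNIV) (PiE UNIV (\<lambda>_::'a. cball (0::complex) 1))"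
    unfolding compactin_PiE by simp
  hence "compact (PiE UNIV (\<lambda>_::'a. cball (0::complex) 1))"
    by (simp add: euclidean_product_topology)
  moreover have "normalized_posdef G = PiE UNIV (\<lambda>_::'a. cball (0::complex) 1) \<inter> normalized_posdef G"
    using normalized_posdef_bound by (auto simp: PiE_def Pi_def)
  ultimately show ?thesis using compact_Int_closed[OF _ closed_normalized_posdef] by metis
qed

lemma face_Inter:
  assumes "\<And>F. F \<in> \<F> \<Longrightarrow> face G F" "\<F> \<noteq> {}" "\<Inter>\<F> \<noteq> {}"
  shows "face G (\<Inter>\<F>)"
  unfolding face_def
proof (intro conjI ballI allI impI)
  show "\<Inter>\<F> \<subseteq> normalized_posdef G" using assms(1,2) unfolding face_def by blast
  show "closed (\<Inter>\<F>)" using assms(1) by (auto simp: face_def)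
  show "\<Inter>\<F> \<noteq> {}" by fact
  fix \<phi> \<psi> and t :: real
  assume "\<phi> \<in> normalized_posdef G" "\<psi> \<in> normalized_posdef G"
    "0 < t \<and> t < 1 \<and> (\<lambda>x. of_real t * \<phi> x + of_real (1 - t) * \<psi> x) \<in> \<Inter>\<F>"
  thus "\<phi> \<in> \<Inter>\<F>" using assms(1) unfolding face_def by blast
qed

text \<open>Zorn's lemma, applied to complements of faces; chains of faces have nonempty intersections by
  compactness.\<close>

lemma minimal_face:
  assumes F0: "face G F0"
  obtains M where "face G M" "M \<subseteq> F0" "\<And>F. face G F \<Longrightarrow> F \<subseteq> M \<Longrightarrow> F = M"
proof -
  define \<A> where "\<A> = {- F |F. face G F \<and> F \<subseteq> F0}"
  have "\<exists>M\<in>\<A>. \<forall>Z\<in>\<A>. M \<subseteq> Z \<longrightarrow> Z = M"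
  proof (rule subset_Zorn)
    fix \<C> assume \<C>: "subset.chain \<A> \<C>"
    show "\<exists>U\<in>\<A>. \<forall>Z\<in>\<C>. Z \<subseteq> U"
    proof (cases "\<C> = {}")
      case True
      thus ?thesis using F0 by (auto simp: \<A>_def)
    next
      case False
      define \<F> where "\<F> = uminus ` \<C>"
      have sub: "\<And>Z. Z \<in> \<C> \<Longrightarrow> Z \<in> \<A>" using \<C> by (auto simp: subset_chain_def)
      have fc: "face G F \<and> F \<subseteq> F0" if F: "F \<in> \<F>" for F
      proof -
        obtain Y where Y: "Y \<in> \<C>" "F = - Y" using F by (auto simp: \<F>_def)
        with sub obtain F' where "Y = - F'" "face G F'" "F' \<subseteq> F0" by (auto simp: \<A>_def)
        thus ?thesis using Y by simp
      qed
      have "normalized_posdef G \<inter> \<Inter>\<F> \<noteq> {}"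
      proof (rule compact_imp_fip[OF compact_normalized_posdef])
        fix F assume "F \<in> \<F>" thus "closed F" using fc by (simp add: face_def)
      next
        fix \<F>' assume fin: "finite \<F>'" and \<F>': "\<F>' \<subseteq> \<F>"
        show "normalized_posdef G \<inter> \<Inter>\<F>' \<noteq> {}"
        proof (cases "\<F>' = {}")
          case True
          thus ?thesis using F0 by (auto simp: face_def)
        next
          case ne: False
          have "F \<subseteq> F' \<or> F' \<subseteq> F" if F: "F \<in> \<F>" "F' \<in> \<F>" for F F'
          proof -
            have "- F \<in> \<C>" "- F' \<in> \<C>" using F by (auto simp: \<F>_def)
            hence "- F \<subseteq> - F' \<or> - F' \<subseteq> - F" using \<C> by (simp only: subset_chain_def)
            thus ?thesis by (simp only: Compl_subset_Compl_iff) blast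
          qed
          hence "subset.chain UNIV \<F>'"
            using \<F>' unfolding subset_chain_def by blast
          hence "\<Inter>\<F>' \<in> \<F>'" using Inter_in_chain[OF fin ne] by blast
          hence "face G (\<Inter>\<F>')" using fc \<F>' by blast
          thus ?thesis by (auto simp: face_def)
        qed
      qed
      hence "face G (\<Inter>\<F>)" using fc False by (intro face_Inter) (auto simp: \<F>_def)
      moreover have "\<Inter>\<F> \<subseteq> F0" using fc False by (auto simp: \<F>_def)
      ultimately have "- \<Inter>\<F> \<in> \<A>" by (auto simp: \<A>_def)
      moreover have "\<forall>Z\<in>\<C>. Z \<subseteq> - \<Inter>\<F>" by (auto simp: \<F>_def)
      ultimately show ?thesis by blast
    qed
  qed
  then obtain M where M: "face G M" "M \<subseteq> F0" "\<And>Z. Z \<in> \<A> \<Longrightarrow> - M \<subseteq> Z \<Longrightarrow> Z = - M"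
    by (auto simp: \<A>_def)
  show ?thesis
  proof (rule that[OF M(1,2)])
    fix F assume "face G F" "F \<subseteq> M"
    hence "- F \<in> \<A>" "- M \<subseteq> - F" using M(2) by (auto simp: \<A>_def)
    from M(3)[OF this] show "F = M" by simp
  qed
qed

text \<open>The functions in a face at which a real linear functional is maximal form a smaller face,
  so on a minimal face all evaluations are constant.\<close>

lemma minimal_face_singleton:
  assumes M: "face G M" and min: "\<And>F. face G F \<Longrightarrow> F \<subseteq> M \<Longrightarrow> F = M"
  obtains \<xi> where "M = {\<xi>}"
proof -
  have cM: "compact M"
    using compact_Int_closed[OF compact_normalized_posdef, of M] M by (simp add: face_def inf.absorb2)
  have const: "Re (c * \<phi> x) = Re (c * \<psi> x)" if \<phi>: "\<phi> \<in> M" and \<psi>: "\<psi> \<in> M" for c x \<phi> \<psi>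
  proof -
    have cont: "continuous_on S (\<lambda>\<phi>. Re (c * \<phi> x))" for S
      by (intro continuous_intros continuous_on_eval)
    obtain \<mu> where \<mu>: "\<mu> \<in> M" "\<And>\<phi>. \<phi> \<in> M \<Longrightarrow> Re (c * \<phi> x) \<le> Re (c * \<mu> x)"
      using continuous_attains_sup[OF cM _ cont] M by (auto simp: face_def)
    define F where "F = M \<inter> {\<phi>. Re (c * \<mu> x) \<le> Re (c * \<phi> x)}"
    have "face G F"
      unfolding face_def
    proof (intro conjI ballI allI impI)
      show "closed F" unfolding F_def using M
        by (intro closed_Int closed_Collect_le cont continuous_intros) (simp add: face_def)
      show "F \<subseteq> normalized_posdef G" "F \<noteq> {}" using M \<mu> by (auto simp: F_def face_def)
      fix \<phi>1 \<phi>2 and t :: real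
      assume n: "\<phi>1 \<in> normalized_posdef G" "\<phi>2 \<in> normalized_posdef G"
      assume t: "0 < t \<and> t < 1 \<and> (\<lambda>x. of_real t * \<phi>1 x + of_real (1 - t) * \<phi>2 x) \<in> F"
      have "(\<lambda>x. of_real (1 - t) * \<phi>2 x + of_real (1 - (1 - t)) * \<phi>1 x) = (\<lambda>x. of_real t * \<phi>1 x + of_real (1 - t) * \<phi>2 x)"
        by auto
      hence "(\<lambda>x. of_real (1 - t) * \<phi>2 x + of_real (1 - (1 - t)) * \<phi>1 x) \<in> M"
        "(\<lambda>x. of_real t * \<phi>1 x + of_real (1 - t) * \<phi>2 x) \<in> M"
        using t by (auto simp: F_def)
      moreover have "0 < 1 - t \<and> 1 - t < 1" using t by auto
      ultimately have m: "\<phi>1 \<in> M" "\<phi>2 \<in> M"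
        using M n t unfolding face_def by blast+
      have "Re (c * \<mu> x) \<le> Re (c * (of_real t * \<phi>1 x + of_real (1 - t) * \<phi>2 x))" using t by (simp add: F_def)
      also have "\<dots> = t * Re (c * \<phi>1 x) + (1 - t) * Re (c * \<phi>2 x)" by (simp add: algebra_simps)
      also have "\<dots> \<le> t * Re (c * \<phi>1 x) + (1 - t) * Re (c * \<mu> x)"
        using \<mu>(2)[OF m(2)] t by (intro add_left_mono mult_left_mono) auto
      finally have "t * Re (c * \<mu> x) \<le> t * Re (c * \<phi>1 x)" by (simp add: left_diff_distrib)
      hence "Re (c * \<mu> x) \<le> Re (c * \<phi>1 x)" using t by (simp only: mult_le_cancel_left_pos)
      thus "\<phi>1 \<in> F" using m by (simp add: F_def)
    qed
    hence "F = M" using min by (simp add: F_def)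
    hence "Re (c * \<mu> x) \<le> Re (c * \<phi> x)" "Re (c * \<mu> x) \<le> Re (c * \<psi> x)"
      using \<phi> \<psi> by (auto simp: F_def)
    thus ?thesis using \<mu>(2)[OF \<phi>] \<mu>(2)[OF \<psi>] by simp
  qed
  obtain \<xi> where \<xi>: "\<xi> \<in> M" using M by (auto simp: face_def)
  have "\<phi> = \<xi>" if "\<phi> \<in> M" for \<phi>
  proof
    fix x show "\<phi> x = \<xi> x"
      using const[OF that \<xi>, of 1 x] const[OF that \<xi>, of \<i> x] by (simp add: complex_eq_iff)
  qed
  thus ?thesis using \<xi> that by blast
qed

text \<open>Extremality freed from normalisation. The summands are rescaled to value \<open>1\<close> at the neutral
  element, unless one of them vanishes there and hence everywhere.\<close>

lemma extreme_posdef_proportional: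
  assumes F: "face G {\<xi>}" and \<psi>: "posdef G (carrier G) \<psi>1" "posdef G (carrier G) \<psi>2"
    and off: "\<And>x. x \<notin> carrier G \<Longrightarrow> \<psi>1 x = 0" "\<And>x. x \<notin> carrier G \<Longrightarrow> \<psi>2 x = 0"
    and sum: "\<And>x. \<xi> x = \<psi>1 x + \<psi>2 x"
  shows "\<psi>1 x = \<psi>1 \<one> * \<xi> x"
proof -
  note one1 = posdef_one[OF subgroup_self \<psi>(1)] and one2 = posdef_one[OF subgroup_self \<psi>(2)]
  define t where "t = Re (\<psi>1 \<one>)"
  have "\<xi> \<one> = 1" using F by (simp add: face_def normalized_posdef_def)
  hence t2: "Re (\<psi>2 \<one>) = 1 - t" using sum[of \<one>] by (simp add: t_def complex_eq_iff)
  have t01: "0 \<le> t" "t \<le> 1" using one1(2) one2(2) t2 by (auto simp: t_def)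
  have z1: "\<psi>1 x = 0" if "t = 0" for x
    using posdef_bound[OF subgroup_self \<psi>(1), of x] off(1)[of x] that
    by (cases "x \<in> carrier G") (auto simp: t_def)
  have z2: "\<psi>2 x = 0" if "t = 1" for x
    using posdef_bound[OF subgroup_self \<psi>(2), of x] off(2)[of x] that t2
    by (cases "x \<in> carrier G") auto
  consider "t = 0" | "t = 1" | "0 < t" "t < 1" using t01 by linarith
  thus ?thesis
  proof cases
    case 1 thus ?thesis using z1 by simp
  next
    case 2
    thus ?thesis using z2[OF 2] sum[of x] one1(3) by (simp add: t_def)
  next
    case 3
    define \<phi>1 where "\<phi>1 = (\<lambda>x. complex_of_real (1 / t) * \<psi>1 x)"
    define \<phi>2 where "\<phi>2 = (\<lambda>x. complex_of_real (1 / (1 - t)) * \<psi>2 x)"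
    have "\<phi>1 \<in> normalized_posdef G" "\<phi>2 \<in> normalized_posdef G"
      using 3 off posdef_cmult[OF \<psi>(1), of "1 / t"] posdef_cmult[OF \<psi>(2), of "1 / (1 - t)"] one1(3) one2(3) t2
      by (auto simp: normalized_posdef_def \<phi>1_def \<phi>2_def t_def[symmetric])
    moreover have "(\<lambda>x. of_real t * \<phi>1 x + of_real (1 - t) * \<phi>2 x) = \<xi>"
    proof
      fix x
      have "t * (1 / t) = 1" "(1 - t) * (1 / (1 - t)) = 1" using 3 by auto
      hence "complex_of_real t * complex_of_real (1 / t) = 1"
        "complex_of_real (1 - t) * complex_of_real (1 / (1 - t)) = 1"
        by (simp_all only: of_real_mult[symmetric] of_real_1)
      thus "of_real t * \<phi>1 x + of_real (1 - t) * \<phi>2 x = \<xi> x"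
        unfolding \<phi>1_def \<phi>2_def sum mult.assoc[symmetric] by (simp only: mult_1_left)
    qed
    ultimately have "\<phi>1 = \<xi>" using F 3 unfolding face_def by (metis (no_types, lifting) singleton_iff)
    hence "\<psi>1 x = t * \<xi> x" using 3 by (auto simp: \<phi>1_def)
    thus ?thesis using one1(3) by (simp add: t_def)
  qed
qed

text \<open>On a formal sum \<open>xs\<close> this form takes the value of the form of \<open>\<phi>\<close> on the sum of \<open>xs\<close> and \<open>c\<close>
  times its translate by \<open>y\<close>.\<close>

lemma posdef_twist:
  assumes \<phi>: "posdef G (carrier G) \<phi>" and y: "y \<in> carrier G" and c: "cmod c = 1"
  shows "posdef G (carrier G) (\<lambda>x. 2 * \<phi> x + (c * \<phi> (x \<otimes> y) + cnj c * \<phi> (x \<otimes> inv y)))"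
  unfolding posdef_def
proof (intro conjI ballI allI impI)
  fix x assume x: "x \<in> carrier G"
  have h: "\<phi> (inv z) = cnj (\<phi> z)" if "z \<in> carrier G" for z using \<phi> that by (simp add: posdef_def)
  have "inv x \<otimes> y = inv (x \<otimes> inv y)" "inv x \<otimes> inv y = inv (x \<otimes> y)"
    using x y by (simp_all add: inv_mult)
  thus "2 * \<phi> (inv x) + (c * \<phi> (inv x \<otimes> y) + cnj c * \<phi> (inv x \<otimes> inv y)) =
      cnj (2 * \<phi> x + (c * \<phi> (x \<otimes> y) + cnj c * \<phi> (x \<otimes> inv y)))"
    using x y by (simp add: h)
next
  fix xs assume xs: "supported (carrier G) xs"
  have car: "fst p \<in> carrier G" if "p \<in> set xs" for p using xs that by (auto simp: supported_def)
  let ?ys = "shift G y xs"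
  have "sesq G \<phi> ?ys xs = sesq G (\<lambda>x. \<phi> (x \<otimes> y)) xs xs"
    unfolding sesq_def shift_def case_prod_beta' map_map comp_def fst_conv snd_conv
    by (intro arg_cong[of _ _ sum_list] map_cong refl)
       (use car y in \<open>simp add: m_ac\<close>)
  moreover have "sesq G \<phi> xs ?ys = sesq G (\<lambda>x. \<phi> (x \<otimes> inv y)) xs xs"
    unfolding sesq_def shift_def case_prod_beta' map_map comp_def fst_conv snd_conv
    by (intro arg_cong[of _ _ sum_list] map_cong refl)
       (use car y in \<open>simp add: m_ac inv_mult\<close>)
  moreover have "sesq G \<phi> ?ys ?ys = sesq G \<phi> xs xs" using sesq_shift[OF y xs xs] .
  moreover have "c * cnj c = 1" using c by (metis complex_norm_square of_real_1 power_one)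
  ultimately have "sesq G (\<lambda>x. 2 * \<phi> x + (c * \<phi> (x \<otimes> y) + cnj c * \<phi> (x \<otimes> inv y))) xs xs =
      sesq G \<phi> (xs @ scaled c ?ys) (xs @ scaled c ?ys)"
    unfolding sesq_append sesq_scale sesq_fun_add sesq_fun_cmult
    by (simp add: algebra_simps)
  also have "0 \<le> Re \<dots>"
    using xs y subgroup_self supported_shift by (intro posdef_nonneg[OF \<phi>]) simp
  finally show "0 \<le> Re (sesq G (\<lambda>x. 2 * \<phi> x + (c * \<phi> (x \<otimes> y) + cnj c * \<phi> (x \<otimes> inv y))) xs xs)" .
qed

text \<open>Up to a factor \<open>4\<close>, \<open>\<xi>\<close> is the sum of its twists by \<open>c\<close> and by \<open>-c\<close>, so extremality makes
  each twist a multiple of \<open>\<xi>\<close>. The equations for \<open>c = 1\<close> and \<open>c = \<i>\<close> add up to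
  multiplicativity.\<close>

lemma extreme_posdef_character:
  assumes F: "face G {\<xi>}"
  shows "character G \<xi>"
proof -
  have \<xi>: "posdef G (carrier G) \<xi>" "\<xi> \<one> = 1" "\<And>x. x \<notin> carrier G \<Longrightarrow> \<xi> x = 0"
    using F by (auto simp: face_def normalized_posdef_def)
  have h: "\<xi> (inv z) = cnj (\<xi> z)" if "z \<in> carrier G" for z using \<xi>(1) that by (simp add: posdef_def)
  have tw: "c * \<xi> (x \<otimes> y) + cnj c * \<xi> (x \<otimes> inv y) = (c * \<xi> y + cnj c * cnj (\<xi> y)) * \<xi> x"
    if x: "x \<in> carrier G" and y: "y \<in> carrier G" and c: "cmod c = 1" for c x y
  proof -
    define \<psi> where "\<psi> = (\<lambda>d x. if x \<in> carrier G
        then complex_of_real (1/4) * (2 * \<xi> x + (d * \<xi> (x \<otimes> y) + cnj d * \<xi> (x \<otimes> inv y))) else 0)"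
    have p: "posdef G (carrier G) (\<psi> d)" if "cmod d = 1" for d
      by (rule posdef_cong[OF subgroup_self _ posdef_cmult[OF posdef_twist[OF \<xi>(1) y that], of "1/4"]])
         (auto simp: \<psi>_def)
    have "\<psi> c x = \<psi> c \<one> * \<xi> x"
    proof (rule extreme_posdef_proportional[OF F])
      show "posdef G (carrier G) (\<psi> c)" "posdef G (carrier G) (\<psi> (- c))" using c p by auto
    qed (auto simp: \<psi>_def \<xi>(3) field_simps)
    hence "4 * \<psi> c x = (4 * \<psi> c \<one>) * \<xi> x" by simp
    moreover have "4 * \<psi> c x = 2 * \<xi> x + (c * \<xi> (x \<otimes> y) + cnj c * \<xi> (x \<otimes> inv y))"
      using x by (simp add: \<psi>_def)
    moreover have "4 * \<psi> c \<one> = 2 + (c * \<xi> y + cnj c * cnj (\<xi> y))"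
      using y by (simp add: \<psi>_def \<xi>(2) h)
    ultimately show ?thesis by (simp add: algebra_simps)
  qed
  have mult: "\<xi> (x \<otimes> y) = \<xi> x * \<xi> y" if x: "x \<in> carrier G" and y: "y \<in> carrier G" for x y
  proof -
    have plus: "\<xi> (x \<otimes> y) + \<xi> (x \<otimes> inv y) = (\<xi> y + cnj (\<xi> y)) * \<xi> x"
      using tw[OF x y, of 1] by simp
    have minus: "\<xi> (x \<otimes> y) - \<xi> (x \<otimes> inv y) = (\<xi> y - cnj (\<xi> y)) * \<xi> x"
    proof -
      have "\<i> * (\<xi> (x \<otimes> y) - \<xi> (x \<otimes> inv y)) = \<i> * ((\<xi> y - cnj (\<xi> y)) * \<xi> x)"
        using tw[OF x y, of \<i>] by (simp add: algebra_simps)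
      thus ?thesis by (simp only: mult_cancel_left complex_i_not_zero simp_thms)
    qed
    have "2 * \<xi> (x \<otimes> y) = (\<xi> (x \<otimes> y) + \<xi> (x \<otimes> inv y)) + (\<xi> (x \<otimes> y) - \<xi> (x \<otimes> inv y))"
      by simp
    also have "\<dots> = 2 * (\<xi> x * \<xi> y)" unfolding plus minus by (simp add: algebra_simps)
    finally have "2 * \<xi> (x \<otimes> y) = 2 * (\<xi> x * \<xi> y)" .
    thus ?thesis by simp
  qed
  have "cmod (\<xi> x) = 1" if x: "x \<in> carrier G" for x
  proof -
    have "\<xi> x * cnj (\<xi> x) = 1" using mult[OF x, of "inv x"] x h[OF x] \<xi>(2) by simp
    hence "(cmod (\<xi> x))\<^sup>2 = 1" by (metis complex_norm_square of_real_eq_1_iff of_real_power)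
    thus ?thesis by (metis abs_norm_cancel real_sqrt_abs real_sqrt_one)
  qed
  with mult show ?thesis by (simp add: character_def)
qed

text \<open>This is the part of the Krein-Milman theorem that is needed: a face contains an extreme point.\<close>

lemma face_contains_character:
  assumes "face G F" obtains \<xi> where "\<xi> \<in> F" "character G \<xi>"
proof -
  obtain M where M: "face G M" "M \<subseteq> F" "\<And>F. face G F \<Longrightarrow> F \<subseteq> M \<Longrightarrow> F = M"
    using minimal_face[OF assms] by metis
  then obtain \<xi> where "M = {\<xi>}" using minimal_face_singleton by metis
  thus ?thesis using M extreme_posdef_character that by blast
qed

end

section \<open>Characters below a positive definite function\<close>

lemma sum_list_swap: "(\<Sum>x\<leftarrow>xs. \<Sum>y\<leftarrow>ys. f x y) = (\<Sum>y\<leftarrow>ys. \<Sum>x\<leftarrow>xs. f x y :: 'b :: comm_monoid_add)"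
  by (induction xs) (simp_all add: sum_list_addf)

context comm_group
begin

lemma sesq_unif_prods_commute:
  assumes "set ws \<subseteq> carrier G" "set zs \<subseteq> carrier G"
  shows "sesq G \<phi> (unif (prods G ws zs)) (unif (prods G ws zs)) =
    sesq G \<phi> (unif (prods G zs ws)) (unif (prods G zs ws))"
proof -
  have swap: "(\<Sum>x\<leftarrow>prods G ws zs. F x) = (\<Sum>x\<leftarrow>prods G zs ws. F x)" for F :: "'a \<Rightarrow> complex"
    unfolding sum_list_prods sum_list_swap[of _ zs ws]
    by (intro arg_cong[of _ _ sum_list] map_cong refl) (use assms m_comm in \<open>auto simp: subset_iff\<close>)
  have "sesq G \<phi> (unif xs) (unif xs) = (\<Sum>x\<leftarrow>xs. \<Sum>y\<leftarrow>xs. 1 / of_nat (length xs) * cnj (1 / of_nat (length xs)) * \<phi> (x \<otimes> inv y))"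
    for xs by (simp add: sesq_def unif_def comp_def)
  thus ?thesis unfolding swap by (simp only: swap length_prods mult.commute)
qed

lemma character_mult:
  "character G \<xi> \<Longrightarrow> x \<in> carrier G \<Longrightarrow> y \<in> carrier G \<Longrightarrow> \<xi> (x \<otimes> y) = \<xi> x * \<xi> y"
  by (simp add: character_def)

lemma character_one: "character G \<xi> \<Longrightarrow> \<xi> \<one> = 1"
proof -
  assume \<xi>: "character G \<xi>"
  have "\<xi> \<one> * \<xi> \<one> = \<xi> \<one> * 1" using character_mult[OF \<xi> one_closed one_closed] by simp
  moreover have "\<xi> \<one> \<noteq> 0" using \<xi> unfolding character_def by force
  ultimately show "\<xi> \<one> = 1" by (metis mult_left_cancel)
qed

lemma character_inv: "character G \<xi> \<Longrightarrow> x \<in> carrier G \<Longrightarrow> \<xi> (inv x) = cnj (\<xi> x)"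
proof -
  assume \<xi>: "character G \<xi>" and x: "x \<in> carrier G"
  have 1: "\<xi> x * \<xi> (inv x) = 1"
    using character_mult[OF \<xi> x inv_closed[OF x]] character_one[OF \<xi>] x by simp
  have "cmod (\<xi> x) = 1" using \<xi> x by (simp add: character_def)
  hence 2: "\<xi> x * cnj (\<xi> x) = 1" by (metis complex_norm_square of_real_1 power_one)
  from 1 2 show "\<xi> (inv x) = cnj (\<xi> x)" by (metis mult_cancel_left mult_zero_left zero_neq_one)
qed

lemma character_posdef:
  assumes \<xi>: "character G \<xi>" shows "posdef G (carrier G) \<xi>"
  unfolding posdef_def
proof (intro conjI ballI allI impI)
  fix xs assume xs: "supported (carrier G) xs"
  have eq: "sesq G \<xi> xs ys = (\<Sum>(x, a)\<leftarrow>xs. a * \<xi> x) * cnj (\<Sum>(x, a)\<leftarrow>ys. a * \<xi> x)"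
    if ys: "supported (carrier G) ys" for ys
  proof -
    have cn: "cnj (sum_list zs) = sum_list (map cnj zs)" for zs by (induction zs) auto
    have "sesq G \<xi> xs ys = (\<Sum>p\<leftarrow>xs. \<Sum>q\<leftarrow>ys. (snd p * \<xi> (fst p)) * cnj (snd q * \<xi> (fst q)))"
      unfolding sesq_def case_prod_beta'
    proof (intro arg_cong[of _ _ sum_list] map_cong refl)
      fix p q assume "p \<in> set xs" "q \<in> set ys"
      hence "fst p \<in> carrier G" "fst q \<in> carrier G" using xs ys by (auto simp: supported_def)
      moreover from this have "\<xi> (fst p \<otimes> inv fst q) = \<xi> (fst p) * \<xi> (inv fst q)"
        using \<xi> by (simp add: character_def)
      ultimately show "snd p * cnj (snd q) * \<xi> (fst p \<otimes> inv fst q) =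
          (snd p * \<xi> (fst p)) * cnj (snd q * \<xi> (fst q))"
        using character_inv[OF \<xi>] by simp
    qed
    thus ?thesis
      by (simp add: cn comp_def case_prod_beta' sum_list_const_mult sum_list_mult_const)
  qed
  show "0 \<le> Re (sesq G \<xi> xs xs)"
    unfolding eq[OF xs] complex_norm_square[symmetric] by simp
qed (use character_inv[OF \<xi>] in simp)

text \<open>Among the normalised positive definite functions \<open>\<phi>\<close> on \<open>G\<close>, maximise the mean of
  \<open>r * cnj \<phi>\<close> over \<open>H\<close>, that is, the infimum of its quadratic form over uniform
  distributions. The infimum is upper semicontinuous in \<open>\<phi>\<close>, and it is affine because a product
  of two uniform distributions does at least as well as either factor. Hence the maximisers form a
  face, and this face contains a character. The maximum is bounded below by the value at
  \<open>\<phi> = r / r(1)\<close>, extended by zero: by the pigeonhole principle a uniform distribution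
  charges some piece of the cover with mass at least \<open>1 / n\<close>.\<close>

lemma dominated_character:
  assumes H: "subgroup H G" and r: "posdef G H r" and \<rho>: "0 < Re (r \<one>)"
    and C: "finite C" "H \<subseteq> \<Union>C" "card C \<le> n" "0 < n"
    and \<kappa>: "0 \<le> \<kappa>" "\<And>P x y. P \<in> C \<Longrightarrow> x \<in> P \<Longrightarrow> y \<in> P \<Longrightarrow> x \<in> H \<Longrightarrow> y \<in> H \<Longrightarrow>
      \<kappa> \<le> (cmod (r (x \<otimes> inv y)))\<^sup>2"
    and c0: "(real n)\<^sup>2 * Re (r \<one>) * c0 \<le> \<kappa>"
  obtains \<xi> where "character G \<xi>" "posdef G H (\<lambda>x. r x - complex_of_real c0 * \<xi> x)"
proof -
  define Q where "Q = (\<lambda>\<phi> zs. Re (sesq G (\<lambda>x. r x * cnj (\<phi> x)) (unif zs) (unif zs)))"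
  define K where "K = (\<lambda>c. {\<phi> \<in> normalized_posdef G. \<forall>zs. set zs \<subseteq> H \<and> zs \<noteq> [] \<longrightarrow> c \<le> Q \<phi> zs})"
  define \<rho>0 where "\<rho>0 = Re (r \<one>)"
  have r1: "r \<one> = complex_of_real \<rho>0" using posdef_one(3)[OF H r] by (simp add: \<rho>0_def)
  have 1: "\<one> \<in> H" using subgroup.one_closed[OF H] .
  have pd: "posdef G H (\<lambda>x. r x * cnj (\<phi> x))" if "\<phi> \<in> normalized_posdef G" for \<phi>
    using that posdef_subgroup[OF subgroup_self H subgroup.subset[OF H]]
    by (intro posdef_mult[OF H r] posdef_cnj) (auto simp: normalized_posdef_def)
  have closedK: "closed (K c)" for c
    unfolding K_def Q_def normalized_posdef_def[symmetric] imp_conv_disj Collect_conj_eq Collect_mem_eq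
    by (intro closed_Int closed_normalized_posdef closed_Collect_all closed_Collect_disj
        closed_Collect_const closed_Collect_le continuous_intros continuous_on_sesq continuous_on_eval)
  have upper: "c \<le> \<rho>0" if "\<phi> \<in> K c" for \<phi> c
  proof -
    have "c \<le> Q \<phi> [\<one>]" using that 1 by (simp add: K_def)
    also have "\<dots> = \<rho>0" using that by (simp add: Q_def unif_def K_def normalized_posdef_def r1)
    finally show ?thesis .
  qed
  \<comment> \<open>the lower bound for the maximum\<close>
  define \<phi>0 where "\<phi>0 = (\<lambda>x. if x \<in> H then complex_of_real (1 / \<rho>0) * r x else 0)"
  have "\<phi>0 \<in> K c0"
    unfolding K_def
  proof (intro CollectI conjI allI impI)
    have "posdef G (carrier G) \<phi>0"
      unfolding \<phi>0_def using \<rho> by (intro posdef_extend_zero[OF H] posdef_cmult r) (simp add: \<rho>0_def)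
    moreover have "\<phi>0 \<one> = 1"
      using \<rho> 1 by (simp add: \<phi>0_def r1 flip: \<rho>0_def)
    moreover have "\<phi>0 x = 0" if "x \<notin> carrier G" for x
      using that subgroup.mem_carrier[OF H, of x] by (auto simp: \<phi>0_def)
    ultimately show "\<phi>0 \<in> normalized_posdef G" by (simp add: normalized_posdef_def)
    fix zs assume zs: "set zs \<subseteq> H \<and> zs \<noteq> []"
    define N where "N = length zs"
    have N: "0 < N" using zs by (simp add: N_def)
    define f where "f = (\<lambda>i j. (cmod (r (zs ! i \<otimes> inv (zs ! j))))\<^sup>2)"
    have zH: "zs ! i \<in> H" if "i < N" for i using zs that by (auto simp: N_def)
    have "sesq G (\<lambda>x. r x * cnj (\<phi>0 x)) (unif zs) (unif zs) =
        (\<Sum>i<N. \<Sum>j<N. complex_of_real (f i j / ((real N)\<^sup>2 * \<rho>0)))"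
    proof -
      have ph: "r (zs ! i \<otimes> inv (zs ! j)) * cnj (\<phi>0 (zs ! i \<otimes> inv (zs ! j))) = complex_of_real (f i j / \<rho>0)"
        if "i < N" "j < N" for i j
        using quotient_mem[OF H zH[OF that(1)] zH[OF that(2)]]
        by (simp add: \<phi>0_def f_def complex_norm_square mult_ac del: of_real_power)
      show ?thesis
        unfolding sesq_nth by (simp add: unif_def N_def[symmetric] ph power2_eq_square)
    qed
    hence Q: "Q \<phi>0 zs = (\<Sum>i<N. \<Sum>j<N. f i j) / ((real N)\<^sup>2 * \<rho>0)"
      by (simp add: Q_def sum_divide_distrib)
    define J where "J = (\<lambda>P. {i. i < N \<and> zs ! i \<in> P})"
    have "\<exists>P\<in>C. N \<le> n * card (J P)"
    proof (rule ccontr)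
      assume "\<not> ?thesis"
      hence small: "n * card (J P) < N" if "P \<in> C" for P using that by auto
      have ne: "C \<noteq> {}" using C(2) 1 by auto
      have "{..<N} \<subseteq> (\<Union>P\<in>C. J P)" using zH C(2) by (auto simp: J_def)
      hence "N \<le> card (\<Union>P\<in>C. J P)"
        using card_mono[of "\<Union>P\<in>C. J P" "{..<N}"] C(1) by (simp add: J_def)
      also have "\<dots> \<le> (\<Sum>P\<in>C. card (J P))" using card_UN_le[OF C(1)] .
      finally have "n * N \<le> (\<Sum>P\<in>C. n * card (J P))" by (simp add: sum_distrib_left[symmetric])
      also have "\<dots> < (\<Sum>P\<in>C. N)" using C(1) ne small by (intro sum_strict_mono)
      also have "\<dots> \<le> n * N" using C(3) by simp
      finally show False by simp
    qed
    then obtain P where P: "P \<in> C" "N \<le> n * card (J P)" by blast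
    have J: "J P \<subseteq> {..<N}" "finite (J P)" by (auto simp: J_def)
    have "(real N)\<^sup>2 * \<kappa> \<le> (real n * card (J P))\<^sup>2 * \<kappa>"
      using P(2) \<kappa>(1) by (intro mult_right_mono power_mono) (simp_all flip: of_nat_mult)
    also have "\<dots> = (real n)\<^sup>2 * (\<Sum>i\<in>J P. \<Sum>j\<in>J P. \<kappa>)" by (simp add: power2_eq_square)
    also have "\<dots> \<le> (real n)\<^sup>2 * (\<Sum>i\<in>J P. \<Sum>j\<in>J P. f i j)"
      using \<kappa>(2)[OF P(1)] zH by (intro mult_left_mono sum_mono) (auto simp: J_def f_def)
    also have "\<dots> \<le> (real n)\<^sup>2 * (\<Sum>i<N. \<Sum>j<N. f i j)"
    proof (rule mult_left_mono)
      have "(\<Sum>i\<in>J P. \<Sum>j\<in>J P. f i j) \<le> (\<Sum>i\<in>J P. \<Sum>j<N. f i j)"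
        using J by (intro sum_mono sum_mono2) (auto simp: f_def)
      also have "\<dots> \<le> (\<Sum>i<N. \<Sum>j<N. f i j)"
        using J by (intro sum_mono2) (auto simp: f_def intro!: sum_nonneg)
      finally show "(\<Sum>i\<in>J P. \<Sum>j\<in>J P. f i j) \<le> (\<Sum>i<N. \<Sum>j<N. f i j)" .
    qed simp
    finally have "(real N)\<^sup>2 * \<kappa> \<le> (real n)\<^sup>2 * (\<Sum>i<N. \<Sum>j<N. f i j)" .
    moreover have "(real N)\<^sup>2 * ((real n)\<^sup>2 * \<rho>0 * c0) \<le> (real N)\<^sup>2 * \<kappa>"
      using c0 by (intro mult_left_mono) (auto simp: \<rho>0_def)
    ultimately have "(real n)\<^sup>2 * ((real N)\<^sup>2 * \<rho>0 * c0) \<le> (real n)\<^sup>2 * (\<Sum>i<N. \<Sum>j<N. f i j)"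
      by (simp add: mult_ac)
    hence "(real N)\<^sup>2 * \<rho>0 * c0 \<le> (\<Sum>i<N. \<Sum>j<N. f i j)" using C(4) by simp
    thus "c0 \<le> Q \<phi>0 zs" unfolding Q using N \<rho> by (simp add: pos_le_divide_eq \<rho>0_def mult_ac)
  qed
  \<comment> \<open>the maximum is attained\<close>
  define c1 where "c1 = Sup {c. K c \<noteq> {}}"
  have bdd: "bdd_above {c. K c \<noteq> {}}" using upper by (auto simp: bdd_above_def)
  have c01: "c0 \<le> c1" unfolding c1_def using \<open>\<phi>0 \<in> K c0\<close> bdd by (intro cSup_upper) auto
  have mono: "K c \<subseteq> K c'" if "c' \<le> c" for c c' using that by (force simp: K_def)
  have "normalized_posdef G \<inter> (\<Inter>c\<in>{c. c < c1}. K c) \<noteq> {}"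
  proof (rule compact_imp_fip_image[OF compact_normalized_posdef])
    fix I assume I: "finite I" "I \<subseteq> {c. c < c1}"
    show "normalized_posdef G \<inter> (\<Inter>c\<in>I. K c) \<noteq> {}"
    proof (cases "I = {}")
      case True
      thus ?thesis using \<open>\<phi>0 \<in> K c0\<close> by (auto simp: K_def)
    next
      case False
      hence "Max I < c1" using I by auto
      then obtain c where c: "K c \<noteq> {}" "Max I < c"
        using less_cSupD[of "{c. K c \<noteq> {}}" "Max I"] \<open>\<phi>0 \<in> K c0\<close> unfolding c1_def by auto
      then obtain \<phi> where "\<phi> \<in> K c" by auto
      moreover from this have "\<phi> \<in> normalized_posdef G" by (simp add: K_def)
      moreover have "K c \<subseteq> K c'" if "c' \<in> I" for c'
        using Max_ge[OF I(1) that] c(2) by (intro mono) linarith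
      ultimately show ?thesis by blast
    qed
  qed (rule closedK)
  moreover have "(\<Inter>c\<in>{c. c < c1}. K c) \<inter> normalized_posdef G \<subseteq> K c1"
    by (auto simp: K_def intro: dense_le)
  ultimately have ne: "K c1 \<noteq> {}" by blast
  have "face G (K c1)"
    unfolding face_def
  proof (intro conjI ballI allI impI)
    show "K c1 \<subseteq> normalized_posdef G" by (auto simp: K_def)
    fix \<phi>1 \<phi>2 and t :: real
    assume n: "\<phi>1 \<in> normalized_posdef G" "\<phi>2 \<in> normalized_posdef G"
    assume t: "0 < t \<and> t < 1 \<and> (\<lambda>x. of_real t * \<phi>1 x + of_real (1 - t) * \<phi>2 x) \<in> K c1"
    show "\<phi>1 \<in> K c1"
    proof (rule ccontr)
      assume "\<phi>1 \<notin> K c1"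
      then obtain zs1 where z1: "set zs1 \<subseteq> H" "zs1 \<noteq> []" "Q \<phi>1 zs1 < c1"
        using n by (auto simp: K_def not_le)
      define e where "e = t * (c1 - Q \<phi>1 zs1) / (1 - t)"
      have e: "0 < e" "(1 - t) * e = t * (c1 - Q \<phi>1 zs1)" using t z1 by (auto simp: e_def)
      have "\<phi>2 \<notin> K (c1 + e)"
      proof
        assume "\<phi>2 \<in> K (c1 + e)"
        hence "c1 + e \<le> c1" unfolding c1_def using bdd by (intro cSup_upper) auto
        thus False using e by simp
      qed
      then obtain zs2 where z2: "set zs2 \<subseteq> H" "zs2 \<noteq> []" "Q \<phi>2 zs2 < c1 + e"
        using n by (auto simp: K_def not_le)
      define zs where "zs = prods G zs2 zs1"
      have zs: "set zs \<subseteq> H" "zs \<noteq> []"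
        using prods_closed[OF H z2(1) z1(1)] length_prods[of G zs2 zs1] z1(2) z2(2) by (auto simp: zs_def)
      have q1: "Q \<phi>1 zs \<le> Q \<phi>1 zs1"
        unfolding Q_def zs_def by (rule posdef_unif_prods_le[OF H pd[OF n(1)] z2(1,2) z1(1)])
      have "Q \<phi>2 zs = Q \<phi>2 (prods G zs1 zs2)"
        unfolding Q_def zs_def using z1(1) z2(1) subgroup.subset[OF H]
        by (subst sesq_unif_prods_commute) auto
      also have "\<dots> \<le> Q \<phi>2 zs2"
        unfolding Q_def by (rule posdef_unif_prods_le[OF H pd[OF n(2)] z1(1,2) z2(1)])
      finally have q2: "Q \<phi>2 zs < c1 + e" using z2(3) by simp
      have "(\<lambda>x. r x * cnj (of_real t * \<phi>1 x + of_real (1 - t) * \<phi>2 x)) =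
          (\<lambda>x. of_real t * (r x * cnj (\<phi>1 x)) + of_real (1 - t) * (r x * cnj (\<phi>2 x)))"
        by (auto simp: algebra_simps)
      hence "Q (\<lambda>x. of_real t * \<phi>1 x + of_real (1 - t) * \<phi>2 x) zs = t * Q \<phi>1 zs + (1 - t) * Q \<phi>2 zs"
        unfolding Q_def by (simp only: sesq_fun_add sesq_fun_cmult) simp
      moreover have "c1 \<le> Q (\<lambda>x. of_real t * \<phi>1 x + of_real (1 - t) * \<phi>2 x) zs"
        using t zs unfolding K_def by blast
      moreover have "t * Q \<phi>1 zs \<le> t * Q \<phi>1 zs1" using q1 t by (intro mult_left_mono) auto
      moreover have "(1 - t) * Q \<phi>2 zs < (1 - t) * (c1 + e)" using q2 t by (intro mult_strict_left_mono) auto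
      moreover have "(1 - t) * (c1 + e) = (1 - t) * c1 + t * (c1 - Q \<phi>1 zs1)"
        using e(2) by (simp only: distrib_left)
      ultimately show False by (simp add: algebra_simps)
    qed
  qed (use ne closedK in auto)
  then obtain \<xi> where \<xi>: "\<xi> \<in> K c1" "character G \<xi>" using face_contains_character by metis
  have \<xi>H: "posdef G H \<xi>"
    using posdef_subgroup[OF subgroup_self H subgroup.subset[OF H] character_posdef[OF \<xi>(2)]] .
  have "posdef G H (\<lambda>x. r x * cnj (\<xi> x) - complex_of_real c1)"
    using \<xi>(1) by (intro posdef_minus_mean[OF H pd]) (auto simp: K_def Q_def)
  hence "posdef G H (\<lambda>x. (r x * cnj (\<xi> x) - complex_of_real c1) * \<xi> x)"
    using \<xi>H by (rule posdef_mult[OF H])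
  hence A: "posdef G H (\<lambda>x. (r x * cnj (\<xi> x) - complex_of_real c1) * \<xi> x + complex_of_real (c1 - c0) * \<xi> x)"
    using c01 by (intro posdef_add posdef_cmult \<xi>H) auto
  have B: "(r x * cnj (\<xi> x) - complex_of_real c1) * \<xi> x + complex_of_real (c1 - c0) * \<xi> x =
      r x - complex_of_real c0 * \<xi> x" if "x \<in> H" for x
  proof -
    have "cmod (\<xi> x) = 1" using \<xi>(2) subgroup.mem_carrier[OF H that] by (simp add: character_def)
    hence "cnj (\<xi> x) * \<xi> x = 1" by (metis complex_norm_square of_real_1 power_one mult.commute)
    thus ?thesis by (simp add: algebra_simps)
  qed
  show ?thesis by (rule that[OF \<xi>(2)], rule posdef_cong[OF H _ A], rule B)
qed

lemma posdef_sum_characters: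
  assumes H: "subgroup H G" and ch: "\<forall>(c, \<xi>)\<in>set cs. 0 < c \<and> character G \<xi>"
  shows "posdef G H (\<lambda>x. \<Sum>(c, \<xi>)\<leftarrow>cs. complex_of_real c * \<xi> x)"
  using ch
proof (induction cs)
  case Nil
  thus ?case by (simp add: posdef_def sesq_def case_prod_beta')
next
  case (Cons q cs)
  obtain c \<xi> where q: "q = (c, \<xi>)" by force
  have "posdef G H \<xi>"
    using posdef_subgroup[OF subgroup_self H subgroup.subset[OF H] character_posdef[of \<xi>]] Cons.prems q by simp
  thus ?case using Cons q posdef_add[OF posdef_cmult, of H \<xi> c] by simp
qed

text \<open>Characters are split off until the sum of their coefficients is nearly maximal. What remains
  cannot have a large value at the neutral element: it inherits its modulus of continuity from
  \<open>p\<close>, so that another character could be split off with a coefficient bounded below.\<close>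

lemma posdef_approx_characters:
  assumes H: "subgroup H G" and p: "posdef G H p"
    and tb: "\<And>e. 0 < e \<Longrightarrow> \<exists>C. finite C \<and> H \<subseteq> \<Union>C \<and>
      (\<forall>P\<in>C. \<forall>x\<in>P. \<forall>y\<in>P. x \<in> H \<longrightarrow> y \<in> H \<longrightarrow> Re (p \<one>) - Re (p (x \<otimes> inv y)) < e)"
    and \<delta>: "0 < \<delta>"
  obtains cs :: "(real \<times> ('a \<Rightarrow> complex)) list"
    where "\<And>c \<xi>. (c, \<xi>) \<in> set cs \<Longrightarrow> 0 < c \<and> character G \<xi>"
      "posdef G H (\<lambda>x. p x - (\<Sum>(c, \<xi>)\<leftarrow>cs. complex_of_real c * \<xi> x))"
      "Re (p \<one>) - (\<Sum>(c, \<xi>)\<leftarrow>cs. c) < \<delta>"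
proof -
  define V where "V = {cs :: (real \<times> ('a \<Rightarrow> complex)) list. (\<forall>(c, \<xi>)\<in>set cs. 0 < c \<and> character G \<xi>) \<and>
    posdef G H (\<lambda>x. p x - (\<Sum>(c, \<xi>)\<leftarrow>cs. complex_of_real c * \<xi> x))}"
  define S where "S = (\<lambda>cs :: (real \<times> ('a \<Rightarrow> complex)) list. \<Sum>(c, \<xi>)\<leftarrow>cs. c)"
  define rem where "rem = (\<lambda>cs x. p x - (\<Sum>(c, \<xi>)\<leftarrow>cs. complex_of_real c * \<xi> x))"
  have 1: "\<one> \<in> H" using subgroup.one_closed[OF H] .
  have rem1: "Re (rem cs \<one>) = Re (p \<one>) - S cs" if "\<forall>(c, \<xi>)\<in>set cs. 0 < c \<and> character G \<xi>" for cs
    using that unfolding rem_def S_def by (induction cs) (auto simp: character_one)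
  have pos: "posdef G H (rem cs)" "S cs \<le> Re (p \<one>)" if "cs \<in> V" for cs
  proof -
    show "posdef G H (rem cs)" using that by (simp add: V_def rem_def)
    from posdef_one(2)[OF H this] show "S cs \<le> Re (p \<one>)" using rem1[of cs] that by (simp add: V_def)
  qed
  have "[] \<in> V" using p by (simp add: V_def)
  have bdd: "bdd_above (S ` V)" using pos by (auto simp: bdd_above_def)
  have "\<exists>cs\<in>V. Re (p \<one>) - S cs < \<delta>"
  proof (rule ccontr)
    assume "\<not> ?thesis"
    hence big: "\<delta> \<le> Re (p \<one>) - S cs" if "cs \<in> V" for cs using that by (auto simp: not_less)
    have p1: "0 < Re (p \<one>)" using big[OF \<open>[] \<in> V\<close>] \<delta> by (simp add: S_def)
    obtain C where C: "finite C" "H \<subseteq> \<Union>C"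
      "\<And>P x y. P \<in> C \<Longrightarrow> x \<in> P \<Longrightarrow> y \<in> P \<Longrightarrow> x \<in> H \<Longrightarrow> y \<in> H \<Longrightarrow> Re (p \<one>) - Re (p (x \<otimes> inv y)) < \<delta> / 2"
      using tb[of "\<delta> / 2"] \<delta> by auto
    have n: "0 < card C" using C 1 by (auto simp: card_gt_0_iff)
    define \<eta> where "\<eta> = (\<delta> / 2)\<^sup>2 / ((real (card C))\<^sup>2 * Re (p \<one>))"
    have \<eta>: "0 < \<eta>" "(real (card C))\<^sup>2 * Re (p \<one>) * \<eta> = (\<delta> / 2)\<^sup>2"
      using n p1 \<delta> by (auto simp: \<eta>_def)
    obtain cs where cs: "cs \<in> V" "Sup (S ` V) - \<eta> < S cs"
      using less_cSupD[of "S ` V" "Sup (S ` V) - \<eta>"] \<open>[] \<in> V\<close> \<eta> by auto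
    have ch: "\<forall>(c, \<xi>)\<in>set cs. 0 < c \<and> character G \<xi>" using cs by (simp add: V_def)
    have r1: "Re (rem cs \<one>) = Re (p \<one>) - S cs" using rem1[OF ch] .
    have "posdef G H (\<lambda>x. \<Sum>(c, \<xi>)\<leftarrow>cs. complex_of_real c * \<xi> x)"
      by (rule posdef_sum_characters[OF H ch])
    hence sum: "posdef G H (\<lambda>x. p x - rem cs x)" by (simp add: rem_def)
    obtain \<xi> where \<xi>: "character G \<xi>" "posdef G H (\<lambda>x. rem cs x - complex_of_real \<eta> * \<xi> x)"
    proof (rule dominated_character[OF H pos(1)[OF cs(1)] _ C(1,2) order_refl n])
      show "0 < Re (rem cs \<one>)" using big[OF cs(1)] \<delta> r1 by simp
      show "0 \<le> (\<delta> / 2)\<^sup>2" by simp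
      show "(\<delta> / 2)\<^sup>2 \<le> (cmod (rem cs (x \<otimes> inv y)))\<^sup>2"
        if "P \<in> C" "x \<in> P" "y \<in> P" "x \<in> H" "y \<in> H" for P x y
      proof -
        have "Re (p (x \<otimes> inv y)) - Re (rem cs (x \<otimes> inv y)) \<le> Re (p \<one>) - Re (rem cs \<one>)"
          using posdef_bound[OF H sum quotient_mem[OF H that(4,5)]] complex_Re_le_cmod order_trans by fastforce
        hence "\<delta> / 2 \<le> Re (rem cs (x \<otimes> inv y))" using C(3)[OF that] big[OF cs(1)] r1 by simp
        also have "\<dots> \<le> cmod (rem cs (x \<otimes> inv y))" by (rule complex_Re_le_cmod)
        finally show ?thesis using \<delta> by (intro power_mono) auto
      qed
      have "S cs \<ge> 0" unfolding S_def using ch by (intro sum_list_nonneg) auto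
      hence "(real (card C))\<^sup>2 * Re (rem cs \<one>) * \<eta> \<le> (real (card C))\<^sup>2 * Re (p \<one>) * \<eta>"
        using \<eta>(1) r1 by (intro mult_right_mono mult_left_mono) auto
      thus "(real (card C))\<^sup>2 * Re (rem cs \<one>) * \<eta> \<le> (\<delta> / 2)\<^sup>2" using \<eta>(2) by simp
    qed
    have "(\<eta>, \<xi>) # cs \<in> V" using ch \<xi> \<eta>(1) by (simp add: V_def rem_def algebra_simps)
    hence "S ((\<eta>, \<xi>) # cs) \<le> Sup (S ` V)" using bdd by (intro cSup_upper) auto
    thus False using cs(2) by (simp add: S_def)
  qed
  then obtain cs where "cs \<in> V" "Re (p \<one>) - S cs < \<delta>" by blast
  thus ?thesis using that[of cs] by (auto simp: V_def S_def)
qed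

end

section \<open>Invariant means of almost periodic functions\<close>

definition avg :: "('a, 'b) monoid_scheme \<Rightarrow> 'a list \<Rightarrow> ('a \<Rightarrow> real) \<Rightarrow> 'a \<Rightarrow> real"
  where "avg G zs f x = (\<Sum>z\<leftarrow>zs. f (z \<otimes>\<^bsub>G\<^esub> x)) / length zs"

text \<open>A function has a mean if some averages of its translates are uniformly close to a constant. For
  an almost periodic function this constant is its Haar integral over the completion.\<close>

definition has_mean :: "('a, 'b) monoid_scheme \<Rightarrow> 'a set \<Rightarrow> ('a \<Rightarrow> real) \<Rightarrow> real \<Rightarrow> bool"
  where "has_mean G H f c \<longleftrightarrow>
    (\<forall>e>0. \<exists>zs. zs \<noteq> [] \<and> set zs \<subseteq> H \<and> (\<forall>x\<in>H. \<bar>avg G zs f x - c\<bar> \<le> e))"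

lemma avg_le: "zs \<noteq> [] \<Longrightarrow> (\<And>z. z \<in> set zs \<Longrightarrow> f (z \<otimes>\<^bsub>G\<^esub> x) \<le> b) \<Longrightarrow> avg G zs f x \<le> b"
proof -
  assume ne: "zs \<noteq> []" and "\<And>z. z \<in> set zs \<Longrightarrow> f (z \<otimes>\<^bsub>G\<^esub> x) \<le> b"
  hence "(\<Sum>z\<leftarrow>zs. f (z \<otimes>\<^bsub>G\<^esub> x)) \<le> (\<Sum>z\<leftarrow>zs. b)" by (intro sum_list_mono)
  thus ?thesis using ne by (simp add: avg_def sum_list_triv pos_divide_le_eq mult.commute)
qed

lemma avg_ge: "zs \<noteq> [] \<Longrightarrow> (\<And>z. z \<in> set zs \<Longrightarrow> b \<le> f (z \<otimes>\<^bsub>G\<^esub> x)) \<Longrightarrow> b \<le> avg G zs f x"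
proof -
  assume ne: "zs \<noteq> []" and "\<And>z. z \<in> set zs \<Longrightarrow> b \<le> f (z \<otimes>\<^bsub>G\<^esub> x)"
  hence "(\<Sum>z\<leftarrow>zs. b) \<le> (\<Sum>z\<leftarrow>zs. f (z \<otimes>\<^bsub>G\<^esub> x))" by (intro sum_list_mono)
  thus ?thesis using ne by (simp add: avg_def sum_list_triv pos_le_divide_eq mult.commute)
qed

lemma avg_add: "avg G zs (\<lambda>x. f x + g x) x = avg G zs f x + avg G zs g x"
  by (simp add: avg_def sum_list_addf add_divide_distrib)

lemma avg_cmult: "avg G zs (\<lambda>x. c * f x) x = c * avg G zs f x"
  by (simp add: avg_def sum_list_const_mult)

context comm_group
begin

lemma avg_avg:
  assumes "x \<in> carrier G" "set ws \<subseteq> carrier G" "set zs \<subseteq> carrier G"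
  shows "avg G ws (avg G zs f) x = avg G (prods G zs ws) f x"
proof -
  have "(\<Sum>w\<leftarrow>ws. \<Sum>z\<leftarrow>zs. f (z \<otimes> (w \<otimes> x))) = (\<Sum>w\<leftarrow>ws. \<Sum>z\<leftarrow>zs. f ((z \<otimes> w) \<otimes> x))"
    by (intro arg_cong[of _ _ sum_list] map_cong refl) (use assms in \<open>auto simp: m_assoc subset_iff\<close>)
  moreover have "(\<Sum>w\<leftarrow>ws. g w / c) = (\<Sum>w\<leftarrow>ws. g w) / c" for g :: "'a \<Rightarrow> real" and c
    by (induction ws) (auto simp: add_divide_distrib)
  ultimately show ?thesis
    unfolding avg_def sum_list_prods length_prods sum_list_swap[of _ ws zs]
    by (simp add: sum_list_swap[of _ zs ws])
qed

lemma avg_prods_commute: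
  assumes "set ws \<subseteq> carrier G" "set zs \<subseteq> carrier G"
  shows "avg G (prods G ws zs) f x = avg G (prods G zs ws) f x"
  unfolding avg_def length_prods sum_list_prods sum_list_swap[of _ zs ws] mult.commute[of "length zs"]
  by (intro arg_cong2[of _ _ _ _ "(/)"] arg_cong[of _ _ sum_list] map_cong refl)
     (use assms m_comm in \<open>auto simp: subset_iff\<close>)

text \<open>Averaging once more does not spoil an approximation. Two approximations can thus be replaced by
  their common convolution, which makes the mean additive and unique.\<close>

lemma avg_prods_close:
  assumes H: "subgroup H G" and ws: "set ws \<subseteq> H" "ws \<noteq> []" and zs: "set zs \<subseteq> H"
    and close: "\<And>x. x \<in> H \<Longrightarrow> \<bar>avg G zs f x - c\<bar> \<le> e" and x: "x \<in> H"
  shows "\<bar>avg G (prods G zs ws) f x - c\<bar> \<le> e"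
proof -
  have s: "x \<in> carrier G" "set ws \<subseteq> carrier G" "set zs \<subseteq> carrier G"
    using ws zs x subgroup.subset[OF H] by auto
  have "avg G zs f (w \<otimes> x) \<le> c + e \<and> c - e \<le> avg G zs f (w \<otimes> x)" if "w \<in> set ws" for w
    using close[of "w \<otimes> x"] that ws x subgroup.m_closed[OF H] by (auto simp: abs_le_iff)
  hence "avg G ws (avg G zs f) x \<le> c + e" "c - e \<le> avg G ws (avg G zs f) x"
    using ws(2) avg_le[of ws "avg G zs f"] avg_ge[of ws "c - e" "avg G zs f"] by blast+
  thus ?thesis unfolding avg_avg[OF s] by (simp add: abs_le_iff)
qed

lemma has_mean_add:
  assumes H: "subgroup H G" and "has_mean G H f c" "has_mean G H g d"
  shows "has_mean G H (\<lambda>x. f x + g x) (c + d)"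
  unfolding has_mean_def
proof (intro allI impI)
  fix e :: real assume "0 < e"
  hence "0 < e / 2" by simp
  with assms(2,3) obtain zs ws where
    zs: "zs \<noteq> []" "set zs \<subseteq> H" "\<And>x. x \<in> H \<Longrightarrow> \<bar>avg G zs f x - c\<bar> \<le> e / 2" and
    ws: "ws \<noteq> []" "set ws \<subseteq> H" "\<And>x. x \<in> H \<Longrightarrow> \<bar>avg G ws g x - d\<bar> \<le> e / 2"
    unfolding has_mean_def by meson
  have "\<bar>avg G (prods G zs ws) (\<lambda>x. f x + g x) x - (c + d)\<bar> \<le> e" if x: "x \<in> H" for x
  proof -
    have "\<bar>avg G (prods G zs ws) f x - c\<bar> \<le> e / 2"
      using avg_prods_close[OF H ws(2,1) zs(2,3) x] .
    moreover have "\<bar>avg G (prods G zs ws) g x - d\<bar> \<le> e / 2"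
      using avg_prods_close[OF H zs(2,1) ws(2,3) x] zs(2) ws(2) subgroup.subset[OF H]
      by (subst avg_prods_commute) auto
    ultimately show ?thesis unfolding avg_add by linarith
  qed
  moreover have "prods G zs ws \<noteq> []" using length_prods[of G zs ws] zs(1) ws(1) by auto
  ultimately show "\<exists>zs. zs \<noteq> [] \<and> set zs \<subseteq> H \<and> (\<forall>x\<in>H. \<bar>avg G zs (\<lambda>x. f x + g x) x - (c + d)\<bar> \<le> e)"
    using prods_closed[OF H zs(2) ws(2)] by blast
qed

lemma has_mean_const: "subgroup H G \<Longrightarrow> has_mean G H (\<lambda>x. c) c"
  using subgroup.one_closed[of H G]
  by (auto simp: has_mean_def avg_def intro!: exI[of _ "[\<one>]"])

lemma has_mean_cmult:
  assumes H: "subgroup H G" and f: "has_mean G H f c" shows "has_mean G H (\<lambda>x. a * f x) (a * c)"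
proof (cases "a = 0")
  case True
  thus ?thesis using has_mean_const[OF H, of 0] by simp
next
  case False
  show ?thesis
    unfolding has_mean_def
  proof (intro allI impI)
    fix e :: real assume "0 < e"
    hence "0 < e / \<bar>a\<bar>" using False by simp
    then obtain zs where zs: "zs \<noteq> []" "set zs \<subseteq> H" "\<And>x. x \<in> H \<Longrightarrow> \<bar>avg G zs f x - c\<bar> \<le> e / \<bar>a\<bar>"
      using f unfolding has_mean_def by meson
    have "\<bar>avg G zs (\<lambda>x. a * f x) x - a * c\<bar> \<le> e" if "x \<in> H" for x
    proof -
      have "\<bar>avg G zs (\<lambda>x. a * f x) x - a * c\<bar> = \<bar>a\<bar> * \<bar>avg G zs f x - c\<bar>"
        unfolding avg_cmult abs_mult[symmetric] by (simp add: right_diff_distrib)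
      thus ?thesis using zs(3)[OF that] False by (simp add: pos_le_divide_eq mult.commute)
    qed
    thus "\<exists>zs. zs \<noteq> [] \<and> set zs \<subseteq> H \<and> (\<forall>x\<in>H. \<bar>avg G zs (\<lambda>x. a * f x) x - a * c\<bar> \<le> e)"
      using zs by blast
  qed
qed

lemma has_mean_sum_list:
  assumes H: "subgroup H G" and "\<And>i. i \<in> set is \<Longrightarrow> has_mean G H (F i) (c i)"
  shows "has_mean G H (\<lambda>x. \<Sum>i\<leftarrow>is. F i x) (\<Sum>i\<leftarrow>is. c i)"
  using assms(2) by (induction "is") (auto intro: has_mean_const[OF H] has_mean_add[OF H])

lemma has_mean_cong:
  assumes H: "subgroup H G" and "has_mean G H f c" "\<And>x. x \<in> H \<Longrightarrow> f x = g x"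
  shows "has_mean G H g c"
proof -
  have "avg G zs f x = avg G zs g x" if "set zs \<subseteq> H" "x \<in> H" for zs x
    unfolding avg_def
    by (intro arg_cong2[of _ _ _ _ "(/)"] arg_cong[of _ _ sum_list] map_cong refl assms(3))
       (use that subgroup.m_closed[OF H] in auto)
  thus ?thesis using assms(2) unfolding has_mean_def by metis
qed

lemma has_mean_translate:
  assumes H: "subgroup H G" and f: "has_mean G H f c" and h: "h \<in> H"
  shows "has_mean G H (\<lambda>x. f (h \<otimes> x)) c"
proof -
  have "avg G zs (\<lambda>x. f (h \<otimes> x)) x = avg G zs f (h \<otimes> x)" if "set zs \<subseteq> H" "x \<in> H" for zs x
    unfolding avg_def
    by (intro arg_cong2[of _ _ _ _ "(/)"] arg_cong[of _ _ sum_list] map_cong refl arg_cong[of _ _ f] m_lcomm)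
       (use that h subgroup.mem_carrier[OF H] in auto)
  thus ?thesis using f h subgroup.m_closed[OF H] unfolding has_mean_def by metis
qed

lemma has_mean_nonneg:
  assumes H: "subgroup H G" and f: "has_mean G H f c" and nn: "\<And>x. x \<in> H \<Longrightarrow> 0 \<le> f x"
  shows "0 \<le> c"
proof (rule ccontr)
  assume "\<not> 0 \<le> c"
  hence "0 < - c / 2" by simp
  then obtain zs where zs: "zs \<noteq> []" "set zs \<subseteq> H" "\<forall>x\<in>H. \<bar>avg G zs f x - c\<bar> \<le> - c / 2"
    using f unfolding has_mean_def by meson
  have 1: "\<one> \<in> H" using subgroup.one_closed[OF H] .
  have "0 \<le> avg G zs f \<one>"
    using zs(1,2) 1 subgroup.m_closed[OF H] nn by (intro avg_ge) auto
  with zs(3) 1 \<open>\<not> 0 \<le> c\<close> show False by fastforce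
qed

lemma has_mean_mono:
  assumes H: "subgroup H G" and f: "has_mean G H f c" and g: "has_mean G H g d"
    and le: "\<And>x. x \<in> H \<Longrightarrow> f x \<le> g x"
  shows "c \<le> d"
  using has_mean_nonneg[OF H has_mean_add[OF H g has_mean_cmult[OF H f, of "-1"]]] le by simp

lemma has_mean_unique:
  assumes "subgroup H G" "has_mean G H f c" "has_mean G H f d" shows "c = d"
  using has_mean_mono[OF assms(1,2,3)] has_mean_mono[OF assms(1,3,2)] by simp

text \<open>Let \<open>w\<close> be the infimum of the oscillations of the averages of \<open>f\<close>. All averages share the
  modulus of continuity of \<open>f\<close>, so a finite net of fixed size meets, from every point, a point where
  a given average of oscillation close to \<open>w\<close> stays clear of its upper bound. Averaging once more
  over this net lowers the upper bound by a fixed fraction of \<open>w\<close>; hence \<open>w = 0\<close>.\<close>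

lemma has_mean_exists:
  fixes f d :: "'a \<Rightarrow> real"
  assumes H: "subgroup H G"
    and lip: "\<And>x y. x \<in> H \<Longrightarrow> y \<in> H \<Longrightarrow> \<bar>f x - f y\<bar> \<le> L * d (x \<otimes> inv y)"
    and bound: "\<And>x. x \<in> H \<Longrightarrow> \<bar>f x\<bar> \<le> B" and L: "0 < L"
    and net: "\<And>e. 0 < e \<Longrightarrow> \<exists>F. finite F \<and> F \<subseteq> H \<and> (\<forall>x\<in>H. \<exists>z\<in>F. d (z \<otimes> inv x) < e)"
  obtains c where "has_mean G H f c"
proof -
  define A where "A = (\<lambda>zs a b. set zs \<subseteq> H \<and> zs \<noteq> [] \<and> (\<forall>x\<in>H. a \<le> avg G zs f x \<and> avg G zs f x \<le> b))"
  define W where "W = {b - a |a b zs. A zs a b}"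
  define w where "w = Inf W"
  have 1: "\<one> \<in> H" using subgroup.one_closed[OF H] .
  have car: "x \<in> carrier G" if "x \<in> H" for x using subgroup.mem_carrier[OF H that] .
  have "A [\<one>] (- B) B" using bound car 1 by (force simp: A_def avg_def abs_le_iff)
  hence ne: "W \<noteq> {}" by (auto simp: W_def)
  have ab: "a \<le> b" if "A zs a b" for zs a b using that 1 unfolding A_def by force
  hence bdd: "bdd_below W" by (auto simp: bdd_below_def W_def intro!: exI[of _ 0])
  have "0 \<le> w" unfolding w_def using ne ab by (intro cInf_greatest) (auto simp: W_def)
  have wle: "w \<le> b - a" if "A zs a b" for zs a b
    unfolding w_def using bdd that by (intro cInf_lower) (auto simp: W_def)
  have alip: "\<bar>avg G zs f x - avg G zs f y\<bar> \<le> L * d (x \<otimes> inv y)"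
    if zs: "set zs \<subseteq> H" "zs \<noteq> []" and xy: "x \<in> H" "y \<in> H" for zs x y
  proof -
    have "avg G zs f x - avg G zs f y = avg G zs (\<lambda>t. f (t \<otimes> x) - f (t \<otimes> y)) \<one>"
      using zs car by (simp add: avg_def sum_list_subtractf diff_divide_distrib)
        (intro arg_cong2[of _ _ _ _ "(-)"] arg_cong2[of _ _ _ _ "(/)"] arg_cong[of _ _ sum_list] map_cong refl, auto)
    moreover have "\<bar>f (z \<otimes> x) - f (z \<otimes> y)\<bar> \<le> L * d (x \<otimes> inv y)" if "z \<in> set zs" for z
      using lip[of "z \<otimes> x" "z \<otimes> y"] that zs xy subgroup.m_closed[OF H] quotient_translate[of z x y] car by auto
    hence "f (z \<otimes> x) - f (z \<otimes> y) \<le> L * d (x \<otimes> inv y) \<and> - (L * d (x \<otimes> inv y)) \<le> f (z \<otimes> x) - f (z \<otimes> y)"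
      if "z \<in> set zs" for z using that by (force simp: abs_le_iff)
    hence "avg G zs (\<lambda>t. f (t \<otimes> x) - f (t \<otimes> y)) \<one> \<le> L * d (x \<otimes> inv y)"
      "- (L * d (x \<otimes> inv y)) \<le> avg G zs (\<lambda>t. f (t \<otimes> x) - f (t \<otimes> y)) \<one>"
      using zs car by (auto simp: subset_iff intro!: avg_le avg_ge)
    hence "\<bar>avg G zs (\<lambda>t. f (t \<otimes> x) - f (t \<otimes> y)) \<one>\<bar> \<le> L * d (x \<otimes> inv y)"
      by simp
    ultimately show ?thesis by simp
  qed
  have "w = 0"
  proof (rule ccontr)
    assume "w \<noteq> 0"
    hence w: "0 < w" using \<open>0 \<le> w\<close> by simp
    obtain F where F: "finite F" "F \<subseteq> H" "\<And>x. x \<in> H \<Longrightarrow> \<exists>z\<in>F. d (z \<otimes> inv x) < w / (4 * L)"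
      using net[of "w / (4 * L)"] w L by auto
    obtain fs where fs: "set fs = F" using F(1) finite_list by blast
    have fne: "fs \<noteq> []" using F(3)[OF 1] fs by auto
    define n where "n = real (length fs)"
    have n: "1 \<le> n" using fne by (simp add: n_def Suc_le_eq)
    have "w < w + w / (4 * n)" using w n by simp
    then obtain zs a b where z: "A zs a b" "b - a < w + w / (4 * n)"
      using cInf_lessD[OF ne, of "w + w / (4 * n)"] unfolding w_def W_def by auto
    have zs: "set zs \<subseteq> H" "zs \<noteq> []" "\<And>x. x \<in> H \<Longrightarrow> a \<le> avg G zs f x" "\<And>x. x \<in> H \<Longrightarrow> avg G zs f x \<le> b"
      using z(1) by (auto simp: A_def)
    have wn: "w / (4 * n) \<le> w / 4" using w n by (simp add: field_simps)
    show False
    proof (cases "\<exists>x0\<in>H. avg G zs f x0 \<le> (a + b) / 2")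
      case False
      hence "A zs ((a + b) / 2) b" using zs by (force simp: A_def)
      from wle[OF this] z(2) wn w show False by (simp add: field_simps)
    next
      case True
      then obtain x0 where x0: "x0 \<in> H" "avg G zs f x0 \<le> (a + b) / 2" by blast
      define b' where "b' = b - w / (4 * n)"
      have "a \<le> avg G fs (avg G zs f) x \<and> avg G fs (avg G zs f) x \<le> b'" if x: "x \<in> H" for x
      proof
        show "a \<le> avg G fs (avg G zs f) x"
        proof (rule avg_ge[OF fne])
          fix t assume "t \<in> set fs"
          thus "a \<le> avg G zs f (t \<otimes> x)" using fs F(2) x by (intro zs(3) subgroup.m_closed[OF H]) auto
        qed
        obtain t where t: "t \<in> F" "d (t \<otimes> inv (x0 \<otimes> inv x)) < w / (4 * L)"
          using F(3)[of "x0 \<otimes> inv x"] quotient_mem[OF H x0(1) x] by blast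
        have tH: "t \<in> H" "t \<otimes> x \<in> H" using t F x subgroup.m_closed[OF H] by auto
        have "t \<otimes> inv (x0 \<otimes> inv x) = (t \<otimes> x) \<otimes> inv x0"
          using car[OF tH(1)] car[OF x] car[OF x0(1)] by (simp add: inv_mult m_ac)
        hence "d ((t \<otimes> x) \<otimes> inv x0) < w / (4 * L)" using t by simp
        hence "L * d ((t \<otimes> x) \<otimes> inv x0) < w / 4" using L by (simp add: field_simps)
        moreover have "\<bar>avg G zs f (t \<otimes> x) - avg G zs f x0\<bar> \<le> L * d ((t \<otimes> x) \<otimes> inv x0)"
          using alip[OF zs(1,2) tH(2) x0(1)] .
        moreover have "w \<le> b - a" using wle[OF z(1)] .
        ultimately have low: "avg G zs f (t \<otimes> x) \<le> b - w / 4" using x0(2) by (simp add: abs_le_iff)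
        have "(\<Sum>z\<leftarrow>fs. avg G zs f (z \<otimes> x)) \<le> (\<Sum>z\<leftarrow>fs. b - (if z = t then w / 4 else 0))"
          using low zs(4) fs F(2) x subgroup.m_closed[OF H] by (intro sum_list_mono) auto
        also have "\<dots> = n * b - (\<Sum>z\<leftarrow>fs. if z = t then w / 4 else 0)"
          by (simp add: sum_list_subtractf sum_list_triv n_def)
        finally have "(\<Sum>z\<leftarrow>fs. avg G zs f (z \<otimes> x)) \<le> n * b - (\<Sum>z\<leftarrow>fs. if z = t then w / 4 else 0)" .
        moreover have "w / 4 \<le> (\<Sum>z\<leftarrow>fs. if z = t then w / 4 else 0)"
        proof -
          have "w / 4 \<in> set (map (\<lambda>z. if z = t then w / 4 else 0) fs)" using t(1) fs by force
          thus ?thesis using w by (intro member_le_sum_list) auto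
        qed
        ultimately have "(\<Sum>z\<leftarrow>fs. avg G zs f (z \<otimes> x)) \<le> n * b - w / 4" by linarith
        thus "avg G fs (avg G zs f) x \<le> b'"
          using n unfolding avg_def[of _ fs] n_def[symmetric] b'_def by (simp add: field_simps)
      qed
      hence "A (prods G zs fs) a b'"
        unfolding A_def using prods_closed[OF H zs(1), of fs] length_prods[of G zs fs] zs(1,2) fne fs F(2) subgroup.subset[OF H]
        by (auto simp: avg_avg[symmetric] car)
      from wle[OF this] z(2) show False by (simp add: b'_def)
    qed
  qed
  define c where "c = Sup {a. \<exists>zs b. A zs a b}"
  have cross: "a \<le> b'" if "A zs a b" "A zs' a' b'" for zs a b zs' a' b'
  proof -
    have s: "set zs \<subseteq> carrier G" "set zs' \<subseteq> carrier G" using that subgroup.subset[OF H] by (auto simp: A_def)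
    have "a \<le> avg G zs' (avg G zs f) \<one>"
      using that 1 subgroup.m_closed[OF H] by (intro avg_ge[of zs' a "avg G zs f"]) (auto simp: A_def)
    also have "\<dots> = avg G zs (avg G zs' f) \<one>"
      using s by (simp add: avg_avg avg_prods_commute)
    also have "\<dots> \<le> b'"
      using that 1 subgroup.m_closed[OF H] by (intro avg_le[of zs "avg G zs' f"]) (auto simp: A_def)
    finally show ?thesis .
  qed
  have ac: "a \<le> c \<and> c \<le> b" if z: "A zs a b" for zs a b
  proof
    have "bdd_above {a. \<exists>zs b. A zs a b}" using cross[OF _ z] by (auto simp: bdd_above_def)
    thus "a \<le> c" unfolding c_def using z by (intro cSup_upper) auto
    show "c \<le> b" unfolding c_def using z cross by (intro cSup_least) auto
  qed
 have small: "\<exists>zs a b. A zs a b \<and> b - a < e" if "0 < e" for e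
    using cInf_lessD[OF ne, of e] \<open>w = 0\<close> that unfolding w_def W_def by auto
  have "has_mean G H f c"
    unfolding has_mean_def
  proof (intro allI impI)
    fix e :: real assume "0 < e"
    then obtain zs a b where z: "A zs a b" "b - a < e" using small by blast
    have "\<bar>avg G zs f x - c\<bar> \<le> e" if "x \<in> H" for x
      using z ac[OF z(1)] that unfolding A_def abs_le_iff by force
    thus "\<exists>zs. zs \<noteq> [] \<and> set zs \<subseteq> H \<and> (\<forall>x\<in>H. \<bar>avg G zs f x - c\<bar> \<le> e)"
      using z(1) unfolding A_def by blast
  qed
  thus ?thesis using that by blast
qed

end

section \<open>Separation by characters\<close>

context comm_group
begin

lemma character_dist_one:
  assumes "character G \<xi>" "x \<in> carrier G"
  shows "(cmod (\<xi> x - 1))\<^sup>2 = 2 * (1 - Re (\<xi> x))"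
proof -
  have "(Re (\<xi> x))\<^sup>2 + (Im (\<xi> x))\<^sup>2 = 1"
    using assms by (simp add: character_def flip: cmod_power2)
  thus ?thesis unfolding cmod_power2 by (simp add: power2_eq_square algebra_simps)
qed

text \<open>The autocorrelation \<open>p\<close> of the bump function \<open>f = max 0 (1 - d)\<close> is positive definite, vanishes
  where \<open>d\<close> is at least \<open>2\<close>, and drops below its value at the neutral element by at most \<open>d\<close>. Where
  the characters of a combination that approximates \<open>p\<close> are close to \<open>1\<close>, \<open>p\<close> is nonzero and hence
  \<open>d < 2\<close>. A positive multiple of each of these characters is dominated by \<open>p\<close>, which makes the
  character continuous with respect to \<open>d\<close>.\<close>

lemma totally_bounded_length_characters:
  fixes d :: "'a \<Rightarrow> real"
  assumes H: "subgroup H G"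
    and d1: "d \<one> = 0" and dinv: "\<And>x. x \<in> H \<Longrightarrow> d (inv x) = d x"
    and dmult: "\<And>x y. x \<in> H \<Longrightarrow> y \<in> H \<Longrightarrow> d (x \<otimes> y) \<le> d x + d y"
    and dpos: "\<And>x. x \<in> H \<Longrightarrow> 0 \<le> d x"
    and net: "\<And>e. 0 < e \<Longrightarrow> \<exists>F. finite F \<and> F \<subseteq> H \<and> (\<forall>x\<in>H. \<exists>z\<in>F. d (z \<otimes> inv x) < e)"
  obtains \<Xi> where "finite \<Xi>"
    "\<And>\<xi>. \<xi> \<in> \<Xi> \<Longrightarrow> character G \<xi>"
    "\<And>\<xi>. \<xi> \<in> \<Xi> \<Longrightarrow> \<exists>c>0. \<forall>x\<in>H. (cmod (\<xi> x - 1))\<^sup>2 \<le> c * d x"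
    "\<And>x. x \<in> H \<Longrightarrow> (\<And>\<xi>. \<xi> \<in> \<Xi> \<Longrightarrow> cmod (\<xi> x - 1) < 1 / 2) \<Longrightarrow> d x < 2"
proof -
  define f where "f = (\<lambda>x. max 0 (1 - d x))"
  have 1: "\<one> \<in> H" using subgroup.one_closed[OF H] .
  have car: "x \<in> carrier G" if "x \<in> H" for x using subgroup.mem_carrier[OF H that] .
  note cl = subgroup.m_closed[OF H] subgroup.m_inv_closed[OF H]
  have dsym: "d (x \<otimes> inv y) = d (y \<otimes> inv x)" if "x \<in> H" "y \<in> H" for x y
    using dinv[OF quotient_mem[OF H that]] inv_quotient[of x y] that car by simp
  have f01: "0 \<le> f x" "x \<in> H \<Longrightarrow> f x \<le> 1" for x using dpos[of x] by (auto simp: f_def)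
  have dle: "d x \<le> d y + d (x \<otimes> inv y)" if "x \<in> H" "y \<in> H" for x y
  proof -
    have "x = (x \<otimes> inv y) \<otimes> y" using that car by (simp add: m_assoc)
    thus ?thesis using dmult[of "x \<otimes> inv y" y] that cl by (metis add.commute)
  qed
  have flip: "\<bar>f x - f y\<bar> \<le> d (x \<otimes> inv y)" if "x \<in> H" "y \<in> H" for x y
    using dle[OF that] dle[OF that(2,1)] dsym[OF that] dpos[OF quotient_mem[OF H that]]
    by (auto simp: f_def max_def)
  define g where "g = (\<lambda>x z. f z * f (x \<otimes> z))"
  have "\<exists>c. has_mean G H (g x) c" if x: "x \<in> H" for x
  proof -
    have "\<bar>g x z - g x z'\<bar> \<le> 2 * d (z \<otimes> inv z')" if z: "z \<in> H" "z' \<in> H" for z z'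
    proof -
      have a: "\<bar>f z - f z'\<bar> \<le> d (z \<otimes> inv z')" using flip[OF z] .
      have b: "\<bar>f (x \<otimes> z) - f (x \<otimes> z')\<bar> \<le> d (z \<otimes> inv z')"
        using flip[of "x \<otimes> z" "x \<otimes> z'"] x z cl quotient_translate[of x z z'] car by simp
      have "g x z - g x z' = (f z - f z') * f (x \<otimes> z) + f z' * (f (x \<otimes> z) - f (x \<otimes> z'))"
        by (simp add: g_def algebra_simps)
      also have "\<bar>\<dots>\<bar> \<le> \<bar>f z - f z'\<bar> * f (x \<otimes> z) + f z' * \<bar>f (x \<otimes> z) - f (x \<otimes> z')\<bar>"
        by (rule order_trans[OF abs_triangle_ineq]) (simp add: abs_mult f01)
      also have "\<dots> \<le> d (z \<otimes> inv z') * 1 + 1 * d (z \<otimes> inv z')"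
        using a b f01 x z cl by (intro add_mono mult_mono) auto
      finally show ?thesis by simp
    qed
    moreover have "\<bar>g x z\<bar> \<le> 1" if "z \<in> H" for z
      using f01 that x cl by (simp add: g_def abs_mult mult_le_one)
    ultimately show ?thesis using has_mean_exists[OF H, of "g x" 2 d 1] net by (metis zero_less_numeral)
  qed
  define p where "p = (\<lambda>x. SOME c. has_mean G H (g x) c)"
  have p: "has_mean G H (g x) (p x)" if "x \<in> H" for x
    unfolding p_def using someI_ex \<open>\<And>x. x \<in> H \<Longrightarrow> \<exists>c. has_mean G H (g x) c\<close> that by metis
  \<comment> \<open>substituting \<open>y z\<close> for \<open>z\<close>\<close>
  have p2: "has_mean G H (\<lambda>z. f (x \<otimes> z) * f (y \<otimes> z)) (p (x \<otimes> inv y))" if "x \<in> H" "y \<in> H" for x y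
  proof (rule has_mean_cong[OF H has_mean_translate[OF H p[OF quotient_mem[OF H that]] that(2)]])
    fix z assume z: "z \<in> H"
    have "(x \<otimes> inv y) \<otimes> (y \<otimes> z) = x \<otimes> (inv y \<otimes> y) \<otimes> z"
      using that z car by (simp only: m_assoc m_closed inv_closed)
    hence "(x \<otimes> inv y) \<otimes> (y \<otimes> z) = x \<otimes> z" using that z car by simp
    thus "g (x \<otimes> inv y) (y \<otimes> z) = f (x \<otimes> z) * f (y \<otimes> z)" by (simp add: g_def)
  qed
  define \<phi> where "\<phi> = (\<lambda>x. complex_of_real (p x))"
  have pinv: "p (inv x) = p x" if x: "x \<in> H" for x
  proof (rule has_mean_unique[OF H _ p[OF x]])
    have "has_mean G H (\<lambda>z. f (\<one> \<otimes> z) * f (x \<otimes> z)) (p (inv x))" using p2[OF 1 x] x car by simp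
    thus "has_mean G H (g x) (p (inv x))" by (rule has_mean_cong[OF H]) (simp add: g_def car)
  qed
  have pd: "posdef G H \<phi>"
    unfolding posdef_def
  proof (intro conjI ballI allI impI)
    fix xs assume xs: "supported H xs"
    have mem: "fst q \<in> H" if "q \<in> set xs" for q using xs that by (auto simp: supported_def)
    have Re: "Re (sum_list zs) = sum_list (map Re zs)" for zs by (induction zs) auto
    have cn: "cnj (sum_list zs) = sum_list (map cnj zs)" for zs by (induction zs) auto
    have eq: "Re (sesq G \<phi> xs xs) = (\<Sum>q\<leftarrow>xs. \<Sum>r\<leftarrow>xs. Re (snd q * cnj (snd r)) * p (fst q \<otimes> inv (fst r)))"
      by (simp add: sesq_def \<phi>_def case_prod_beta' Re comp_def)
    have "has_mean G H (\<lambda>z. \<Sum>q\<leftarrow>xs. \<Sum>r\<leftarrow>xs. Re (snd q * cnj (snd r)) * (f (fst q \<otimes> z) * f (fst r \<otimes> z)))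
        (Re (sesq G \<phi> xs xs))"
      unfolding eq by (intro has_mean_sum_list[OF H] has_mean_cmult[OF H] p2 mem)
    moreover have "0 \<le> (\<Sum>q\<leftarrow>xs. \<Sum>r\<leftarrow>xs. Re (snd q * cnj (snd r)) * (f (fst q \<otimes> z) * f (fst r \<otimes> z)))" for z
    proof -
      define s where "s = (\<Sum>q\<leftarrow>xs. snd q * complex_of_real (f (fst q \<otimes> z)))"
      have "s * cnj s = (\<Sum>q\<leftarrow>xs. \<Sum>r\<leftarrow>xs. (snd q * complex_of_real (f (fst q \<otimes> z))) * cnj (snd r * complex_of_real (f (fst r \<otimes> z))))"
        unfolding s_def cn by (simp only: sum_list_const_mult sum_list_mult_const map_map comp_def)
      also have "\<dots> = (\<Sum>q\<leftarrow>xs. \<Sum>r\<leftarrow>xs. (snd q * cnj (snd r)) * complex_of_real (f (fst q \<otimes> z) * f (fst r \<otimes> z)))"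
        by (simp add: mult_ac)
      finally have "Re (s * cnj s) = (\<Sum>q\<leftarrow>xs. \<Sum>r\<leftarrow>xs. Re (snd q * cnj (snd r)) * (f (fst q \<otimes> z) * f (fst r \<otimes> z)))"
        by (simp add: Re comp_def algebra_simps del: times_complex.sel) (simp add: algebra_simps)
      moreover have "0 \<le> Re (s * cnj s)" by simp
      ultimately show ?thesis by (simp only:)
    qed
    ultimately show "0 \<le> Re (sesq G \<phi> xs xs)" using has_mean_nonneg[OF H] by blast
  qed (simp add: \<phi>_def pinv)
  have pdrop: "p \<one> - p x \<le> d x" if x: "x \<in> H" for x
  proof -
    have "g \<one> z \<le> g x z + d x" if z: "z \<in> H" for z
    proof -
      have "x \<otimes> z \<otimes> inv z = x" using x z car by (simp add: m_assoc)
      hence "f z - f (x \<otimes> z) \<le> d x" using flip[of "x \<otimes> z" z] x z cl by (simp add: abs_le_iff)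
      have "f z * (f z - f (x \<otimes> z)) \<le> f z * d x"
        using \<open>f z - f (x \<otimes> z) \<le> d x\<close> f01 by (intro mult_left_mono)
      also have "\<dots> \<le> 1 * d x" using f01 z dpos[OF x] by (intro mult_right_mono)
      finally have "f z * (f z - f (x \<otimes> z)) \<le> d x" by simp
      thus ?thesis using z car by (simp add: g_def algebra_simps)
    qed
    from has_mean_mono[OF H p[OF 1] has_mean_add[OF H p[OF x] has_mean_const[OF H, of "d x"]] this]
    show ?thesis by simp
  qed
  have psupp: "d x < 2" if x: "x \<in> H" and "p x \<noteq> 0" for x
  proof (rule ccontr)
    assume "\<not> d x < 2"
    have "g x z = 0" if z: "z \<in> H" for z
    proof -
      have "x \<otimes> z \<otimes> inv z = x" using x z car by (simp add: m_assoc)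
      hence "d x \<le> d (x \<otimes> z) + d z" using dmult[of "x \<otimes> z" "inv z"] x z cl dinv[OF z] by simp
      with \<open>\<not> d x < 2\<close> show ?thesis by (auto simp: g_def f_def max_def)
    qed
    hence "has_mean G H (g x) 0" using has_mean_cong[OF H has_mean_const[OF H, of 0]] by simp
    with \<open>p x \<noteq> 0\<close> show False using has_mean_unique[OF H p[OF x]] by blast
  qed
  have p1: "0 < p \<one>"
  proof -
    obtain F where F: "finite F" "F \<subseteq> H" "\<And>x. x \<in> H \<Longrightarrow> \<exists>z\<in>F. d (z \<otimes> inv x) < 1 / 2"
      using net[of "1 / 2"] by auto
    obtain fs where fs: "set fs = F" using F(1) finite_list by blast
    have "has_mean G H (\<lambda>z. \<Sum>t\<leftarrow>fs. g \<one> (t \<otimes> z)) (\<Sum>t\<leftarrow>fs. p \<one>)"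
      using fs F(2) by (intro has_mean_sum_list[OF H] has_mean_translate[OF H] p 1) auto
    moreover have "1 / 4 \<le> (\<Sum>t\<leftarrow>fs. g \<one> (t \<otimes> z))" if z: "z \<in> H" for z
    proof -
      obtain t where t: "t \<in> F" "d (t \<otimes> z) < 1 / 2"
        using F(3)[of "inv z"] z cl car by auto
      have tH: "t \<otimes> z \<in> H" using t F z cl by auto
      have half: "1 / 2 \<le> f (t \<otimes> z)" using t by (simp add: f_def)
      have "(1 / 2) * (1 / 2) \<le> f (t \<otimes> z) * f (t \<otimes> z)" using half by (intro mult_mono) auto
      hence "1 / 4 \<le> g \<one> (t \<otimes> z)" using car[OF tH] by (simp add: g_def)
      also have "\<dots> \<le> (\<Sum>t\<leftarrow>fs. g \<one> (t \<otimes> z))"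
        using t fs by (intro member_le_sum_list) (auto simp: g_def f01)
      finally show ?thesis .
    qed
    ultimately have "1 / 4 \<le> (\<Sum>t\<leftarrow>fs. p \<one>)" using has_mean_mono[OF H has_mean_const[OF H]] by blast
    hence "0 < length fs * p \<one>" by (simp add: sum_list_triv)
    thus ?thesis by (simp add: zero_less_mult_iff)
  qed
  have tb: "\<exists>C. finite C \<and> H \<subseteq> \<Union>C \<and>
      (\<forall>P\<in>C. \<forall>x\<in>P. \<forall>y\<in>P. x \<in> H \<longrightarrow> y \<in> H \<longrightarrow> Re (\<phi> \<one>) - Re (\<phi> (x \<otimes> inv y)) < e)" if e: "0 < e" for e
  proof -
    obtain F where F: "finite F" "F \<subseteq> H" "\<And>x. x \<in> H \<Longrightarrow> \<exists>z\<in>F. d (z \<otimes> inv x) < e / 2"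
      using net[of "e / 2"] e by auto
    define P where "P = (\<lambda>z. {x. d (z \<otimes> inv x) < e / 2})"
    have "Re (\<phi> \<one>) - Re (\<phi> (x \<otimes> inv y)) < e"
      if "z \<in> F" "x \<in> P z" "y \<in> P z" "x \<in> H" "y \<in> H" for x y z
    proof -
      have z: "z \<in> H" using that F by auto
      have "(x \<otimes> inv z) \<otimes> (z \<otimes> inv y) = x \<otimes> (inv z \<otimes> z) \<otimes> inv y"
        using that z car by (simp only: m_assoc m_closed inv_closed)
      hence "x \<otimes> inv y = (x \<otimes> inv z) \<otimes> (z \<otimes> inv y)" using that z car by simp
      hence "d (x \<otimes> inv y) \<le> d (x \<otimes> inv z) + d (z \<otimes> inv y)"
        using dmult quotient_mem[OF H] that z by metis
      also have "\<dots> < e" using that dsym[OF _ z, of x] by (simp add: P_def)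
      finally show ?thesis using pdrop[OF quotient_mem[OF H that(4,5)]] by (simp add: \<phi>_def)
    qed
    thus ?thesis using F by (intro exI[of _ "P ` F"]) (auto simp: P_def)
  qed
  obtain cs where cs: "\<And>c \<xi>. (c, \<xi>) \<in> set cs \<Longrightarrow> 0 < c \<and> character G \<xi>"
      "posdef G H (\<lambda>x. \<phi> x - (\<Sum>(c, \<xi>)\<leftarrow>cs. complex_of_real c * \<xi> x))"
      "Re (\<phi> \<one>) - (\<Sum>(c, \<xi>)\<leftarrow>cs. c) < p \<one> / 4"
    using posdef_approx_characters[OF H pd tb, of "p \<one> / 4"] p1 by auto
  have ch: "\<forall>(c, \<xi>)\<in>set cs. 0 < c \<and> character G \<xi>" using cs(1) by auto
  show ?thesis
  proof (rule that[of "snd ` set cs"])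
    show "character G \<xi>" if "\<xi> \<in> snd ` set cs" for \<xi> using that cs(1) by force
    show "\<exists>c>0. \<forall>x\<in>H. (cmod (\<xi> x - 1))\<^sup>2 \<le> c * d x" if \<xi>: "\<xi> \<in> snd ` set cs" for \<xi>
    proof -
      obtain c where c: "(c, \<xi>) \<in> set cs" using \<xi> by force
      hence c0: "0 < c" "character G \<xi>" using cs(1) by auto
      \<comment> \<open>adding the other terms back shows that \<open>\<phi>\<close> dominates this one\<close>
      have "posdef G H (\<lambda>x. \<Sum>(c, \<xi>)\<leftarrow>remove1 (c, \<xi>) cs. complex_of_real c * \<xi> x)"
        using ch notin_set_remove1 by (intro posdef_sum_characters[OF H]) fastforce
      from posdef_add[OF cs(2) this]
      have "posdef G H (\<lambda>x. \<phi> x - complex_of_real c * \<xi> x)"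
        by (rule posdef_cong[OF H, rotated])
           (use sum_list_map_remove1[OF c, of "\<lambda>(c, \<xi>). complex_of_real c * \<xi> _"] in \<open>simp add: algebra_simps\<close>)
      note dom = posdef_bound[OF H this]
      have "(cmod (\<xi> x - 1))\<^sup>2 \<le> (2 / c) * d x" if x: "x \<in> H" for x
      proof -
        have "Re (\<phi> x - complex_of_real c * \<xi> x) \<le> Re (\<phi> \<one> - complex_of_real c * \<xi> \<one>)"
          using dom[OF x] complex_Re_le_cmod order_trans by blast
        hence "c * (1 - Re (\<xi> x)) \<le> d x"
          using pdrop[OF x] character_one[OF c0(2)] by (simp add: \<phi>_def algebra_simps)
        hence "1 - Re (\<xi> x) \<le> d x / c" using c0(1) by (simp add: pos_le_divide_eq mult.commute)
        thus ?thesis using character_dist_one[OF c0(2) car[OF x]] by simp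
      qed
      thus ?thesis using c0 by (intro exI[of _ "2 / c"]) auto
    qed
    show "d x < 2" if x: "x \<in> H" and close: "\<And>\<xi>. \<xi> \<in> snd ` set cs \<Longrightarrow> cmod (\<xi> x - 1) < 1 / 2" for x
    proof (rule psupp[OF x])
      define S where "S = (\<Sum>(c, \<xi>)\<leftarrow>cs. c)"
      have one: "(\<Sum>(c, \<xi>)\<leftarrow>cs. complex_of_real c * \<xi> \<one>) = complex_of_real S"
        using ch unfolding S_def by (induction cs) (auto simp: character_one)
      have "\<forall>(c, \<xi>)\<in>set cs. 0 < c \<and> 1 / 2 \<le> Re (\<xi> x)"
      proof (intro ballI, clarify)
        fix c \<xi> assume q: "(c, \<xi>) \<in> set cs"
        have "1 - Re (\<xi> x) \<le> cmod (\<xi> x - 1)" using abs_Re_le_cmod[of "\<xi> x - 1"] by (simp add: abs_le_iff)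
        also have "\<dots> < 1 / 2" using close q by force
        finally show "0 < c \<and> 1 / 2 \<le> Re (\<xi> x)" using cs(1)[OF q] by simp
      qed
      hence "S / 2 \<le> Re (\<Sum>(c, \<xi>)\<leftarrow>cs. complex_of_real c * \<xi> x)"
        unfolding S_def
      proof (induction cs)
        case (Cons q cs)
        obtain c \<xi> where q: "q = (c, \<xi>)" by force
        define k where "k = c * Re (\<xi> x)"
        have "c * (1 / 2) \<le> k" unfolding k_def using Cons.prems q by (intro mult_left_mono) auto
        thus ?case using Cons q by (simp flip: k_def)
      qed simp
      moreover have "\<bar>Re (\<phi> x - (\<Sum>(c, \<xi>)\<leftarrow>cs. complex_of_real c * \<xi> x))\<bar> \<le> p \<one> - S"
        using order_trans[OF abs_Re_le_cmod posdef_bound[OF H cs(2) x]] by (simp add: one \<phi>_def)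
      moreover have "p \<one> - S < p \<one> / 4" using cs(3) by (simp add: S_def \<phi>_def)
      ultimately have "0 < Re (\<phi> x)" using p1 by (simp add: abs_le_iff)
      thus "p x \<noteq> 0" by (simp add: \<phi>_def)
    qed
  qed simp
qed

end

section \<open>Length functions\<close>

text \<open>The entry \<open>x\<close> at which the partial sums pass \<open>t\<close> belongs to neither side, so that for half the
  total weight both sides weigh at most half.\<close>

lemma split_list_at_weight:
  fixes f :: "'a \<Rightarrow> real"
  assumes "xs \<noteq> []" "0 \<le> t" "t \<le> sum_list (map f xs)"
  shows "\<exists>as x bs. xs = as @ x # bs \<and> sum_list (map f as) \<le> t \<and>
    sum_list (map f bs) \<le> sum_list (map f xs) - t"
  using assms
proof (induction xs arbitrary: t)
  case (Cons x xs)
  show ?case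
  proof (cases "xs \<noteq> [] \<and> f x \<le> t")
    case True
    hence "\<exists>as y bs. xs = as @ y # bs \<and> sum_list (map f as) \<le> t - f x \<and>
        sum_list (map f bs) \<le> sum_list (map f xs) - (t - f x)"
      using Cons.prems(3) by (intro Cons.IH) auto
    then obtain as y bs where "xs = as @ y # bs" "sum_list (map f as) \<le> t - f x"
      "sum_list (map f bs) \<le> sum_list (map f xs) - (t - f x)" by blast
    thus ?thesis by (intro exI[of _ "x # as"] exI[of _ y] exI[of _ bs]) auto
  next
    case False
    thus ?thesis using Cons.prems by (intro exI[of _ "[]"] exI[of _ x] exI[of _ xs]) auto
  qed
qed simp

context comm_group
begin

text \<open>The sequence of neighbourhoods \<open>U n\<close> is turned into a length function (Birkhoff and Kakutani).
  The length of \<open>x\<close> is the infimum of the weights of its factorisations, where a factor from \<open>U n\<close>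
  costs \<open>2 ^ -n\<close>. Cutting a factorisation at half its weight into a product of three shows by
  induction that a product of weight below \<open>2 ^ -n\<close> lies in \<open>U n\<close>.\<close>

lemma length_function_exists:
  fixes U :: "nat \<Rightarrow> 'a set"
  assumes U0: "U 0 = carrier G" and one: "\<And>n. \<one> \<in> U n"
    and inv: "\<And>n x. x \<in> U n \<Longrightarrow> inv x \<in> U n"
    and sub: "\<And>n. U n \<subseteq> carrier G"
    and mult: "\<And>n x y z. x \<in> U (Suc n) \<Longrightarrow> y \<in> U (Suc n) \<Longrightarrow> z \<in> U (Suc n) \<Longrightarrow> x \<otimes> y \<otimes> z \<in> U n"
  obtains l :: "'a \<Rightarrow> real" where "l \<one> = 0" "\<And>x. x \<in> carrier G \<Longrightarrow> 0 \<le> l x"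
    "\<And>x. x \<in> carrier G \<Longrightarrow> l (inv x) = l x"
    "\<And>x y. x \<in> carrier G \<Longrightarrow> y \<in> carrier G \<Longrightarrow> l (x \<otimes> y) \<le> l x + l y"
    "\<And>x n. x \<in> U n \<Longrightarrow> l x \<le> (1 / 2) ^ n"
    "\<And>x n. x \<in> carrier G \<Longrightarrow> l x < (1 / 2) ^ n \<Longrightarrow> x \<in> U n"
proof -
  define chain_prod :: "(nat \<times> 'a) list \<Rightarrow> 'a"
    where "chain_prod = (\<lambda>cs. foldr (\<lambda>(n, x) y. x \<otimes> y) cs \<one>)"
  define chain_weight :: "(nat \<times> 'a) list \<Rightarrow> real"
    where "chain_weight = (\<lambda>cs. \<Sum>(n, x)\<leftarrow>cs. (1 / 2) ^ n)"
  define valid where "valid = (\<lambda>cs. \<forall>(n, x)\<in>set cs. x \<in> U n)"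
  have valid [simp]: "valid []" "valid ((n, x) # cs) \<longleftrightarrow> x \<in> U n \<and> valid cs"
    "valid (as @ bs) \<longleftrightarrow> valid as \<and> valid bs" for n x cs as bs
    by (auto simp: valid_def)
  have cp [simp]: "chain_prod [] = \<one>" "chain_prod ((n, x) # cs) = x \<otimes> chain_prod cs" for n x cs
    by (auto simp: chain_prod_def)
  have cw [simp]: "chain_weight [] = 0" "chain_weight ((n, x) # cs) = (1 / 2) ^ n + chain_weight cs"
    "chain_weight (as @ bs) = chain_weight as + chain_weight bs" for n x cs as bs
    by (auto simp: chain_weight_def)
  have cwpos: "0 \<le> chain_weight cs" for cs by (induction cs) auto
  have subD: "x \<in> carrier G" if "x \<in> U n" for x n using sub that by blast
  have cpc: "valid cs \<Longrightarrow> chain_prod cs \<in> carrier G" for cs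
    by (induction cs) (auto dest!: subD)
  have cpa: "valid as \<Longrightarrow> valid bs \<Longrightarrow> chain_prod (as @ bs) = chain_prod as \<otimes> chain_prod bs" for as bs
    by (induction as) (auto simp: m_assoc cpc dest!: subD)
  have anti: "U (Suc n) \<subseteq> U n" for n
    using mult[of _ n \<one> \<one>] one sub by (fastforce simp: subset_iff)
  have mono: "m \<le> n \<Longrightarrow> U n \<subseteq> U m" for m n
    by (rule lift_Suc_antimono_le[of U, OF anti])
  have key: "valid cs \<Longrightarrow> chain_weight cs < (1 / 2) ^ n \<Longrightarrow> chain_prod cs \<in> U n" for cs n
  proof (induction "length cs" arbitrary: cs n rule: less_induct)
    case less
    show ?case
    proof (cases "cs = []")
      case True
      thus ?thesis using one by simp
    next
      case False
      define W where "W = chain_weight cs"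
      have W: "0 \<le> W" "W < (1 / 2) ^ n" using cwpos less.prems by (auto simp: W_def)
      obtain as q bs where s: "cs = as @ q # bs" "chain_weight as \<le> W / 2" "chain_weight bs \<le> W / 2"
        using split_list_at_weight[OF False, of "W / 2" "\<lambda>(n, x). (1 / 2) ^ n"] W
        by (auto simp: W_def chain_weight_def)
      obtain k x where q: "q = (k, x)" by force
      have v: "valid as" "valid bs" "x \<in> U k" using less.prems s q by auto
      have ab: "chain_prod as \<in> U (Suc n)" "chain_prod bs \<in> U (Suc n)"
        using s v W by (auto intro!: less.hyps)
      have "(1 / 2 :: real) ^ k \<le> W" using cwpos[of as] cwpos[of bs] s q by (simp add: W_def)
      have "n < k"
      proof (rule ccontr)
        assume "\<not> n < k"
        hence "(1 / 2 :: real) ^ n \<le> (1 / 2) ^ k" by (intro power_decreasing) auto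
        with \<open>(1 / 2) ^ k \<le> W\<close> W(2) show False by linarith
      qed
      hence x: "x \<in> U (Suc n)" using v mono[of "Suc n" k] by auto
      have "chain_prod cs = chain_prod as \<otimes> (x \<otimes> chain_prod bs)"
        using s q v cpa[of as "q # bs"] by simp
      also have "\<dots> = chain_prod as \<otimes> x \<otimes> chain_prod bs"
        using cpc v sub by (simp add: m_assoc subset_iff)
      finally show ?thesis using mult[OF ab(1) x ab(2)] by simp
    qed
  qed
  define S where "S = (\<lambda>x. {chain_weight cs |cs. valid cs \<and> chain_prod cs = x})"
  define l where "l = (\<lambda>x. Inf (S x))"
  have bdd: "bdd_below (S x)" for x using cwpos by (auto simp: bdd_below_def S_def)
  have le: "l x \<le> chain_weight cs" if "valid cs" "chain_prod cs = x" for x cs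
    unfolding l_def using that bdd by (intro cInf_lower) (auto simp: S_def)
  have ne: "S x \<noteq> {}" if "x \<in> carrier G" for x
  proof -
    have "valid [(0, x)]" "chain_prod [(0, x)] = x" using that U0 by auto
    thus ?thesis unfolding S_def by blast
  qed
  have ex: "\<exists>cs. valid cs \<and> chain_prod cs = x \<and> chain_weight cs < b" if "x \<in> carrier G" "l x < b" for x b
    using cInf_lessD[OF ne[OF that(1)], of b] that(2) unfolding l_def S_def by auto
  have pos: "0 \<le> l x" if "x \<in> carrier G" for x
    unfolding l_def using ne[OF that] cwpos by (intro cInf_greatest) (auto simp: S_def)
  have linv: "l (inv x) \<le> l x" if x: "x \<in> carrier G" for x
  proof (rule field_le_epsilon)
    fix e :: real assume "0 < e"
    then obtain cs where cs: "valid cs" "chain_prod cs = x" "chain_weight cs < l x + e"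
      using ex[OF x, of "l x + e"] by auto
    have "valid cs \<Longrightarrow> valid (map (apsnd (m_inv G)) cs) \<and> chain_prod (map (apsnd (m_inv G)) cs) = inv (chain_prod cs)"
      for cs by (induction cs) (use inv sub cpc in \<open>auto simp: inv_mult subset_iff\<close>)
    moreover have "chain_weight (map (apsnd (m_inv G)) cs) = chain_weight cs" for cs
      by (induction cs) auto
    ultimately show "l (inv x) \<le> l x + e" using le[of "map (apsnd (m_inv G)) cs" "inv x"] cs by simp
  qed
  show ?thesis
  proof (rule that[of l])
    show "l \<one> = 0" using le[of "[]" \<one>] pos[of \<one>] by simp
    show "0 \<le> l x" if "x \<in> carrier G" for x using pos that .
    show "l (inv x) = l x" if "x \<in> carrier G" for x
      using linv[OF that] linv[of "inv x"] that by simp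
    show "l (x \<otimes> y) \<le> l x + l y" if xy: "x \<in> carrier G" "y \<in> carrier G" for x y
    proof (rule field_le_epsilon)
      fix e :: real assume "0 < e"
      then obtain as bs where "valid as" "chain_prod as = x" "chain_weight as < l x + e / 2"
        "valid bs" "chain_prod bs = y" "chain_weight bs < l y + e / 2"
        using ex[OF xy(1), of "l x + e / 2"] ex[OF xy(2), of "l y + e / 2"] by auto
      thus "l (x \<otimes> y) \<le> l x + l y + e" using le[of "as @ bs" "x \<otimes> y"] cpa[of as bs] by simp
    qed
    show "l x \<le> (1 / 2) ^ n" if "x \<in> U n" for x n
      using le[of "[(n, x)]" x] that subD[OF that] by simp
    show "x \<in> U n" if "x \<in> carrier G" "l x < (1 / 2) ^ n" for x n
      using ex[OF that] key by blast
  qed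
qed

end

section \<open>Totally bounded group topologies\<close>

text \<open>Instead of finitely many translates of \<open>U\<close>, finitely many arbitrary pieces whose quotients lie
  in \<open>U\<close> are asked for. In this form the condition passes to intersections and to subgroups without
  a choice of new translates.\<close>

definition small_cover :: "('a, 'b) monoid_scheme \<Rightarrow> 'a set \<Rightarrow> bool"
  where "small_cover G U \<longleftrightarrow> (\<exists>C. finite C \<and> carrier G \<subseteq> \<Union>C \<and>
    (\<forall>P\<in>C. \<forall>x\<in>P. \<forall>y\<in>P. x \<in> carrier G \<longrightarrow> y \<in> carrier G \<longrightarrow> x \<otimes>\<^bsub>G\<^esub> inv\<^bsub>G\<^esub> y \<in> U))"

definition tb_group_topology :: "('a, 'b) monoid_scheme \<Rightarrow> 'a topology \<Rightarrow> bool"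
  where "tb_group_topology G T \<longleftrightarrow> group_topology G T \<and>
    (\<forall>U. openin T U \<longrightarrow> \<one>\<^bsub>G\<^esub> \<in> U \<longrightarrow> small_cover G U)"

lemma small_cover_mono: "small_cover G U \<Longrightarrow> U \<subseteq> V \<Longrightarrow> small_cover G V"
  unfolding small_cover_def by (meson subsetD)

lemma small_cover_Int:
  assumes "small_cover G U" "small_cover G V" shows "small_cover G (U \<inter> V)"
proof -
  obtain C where C: "finite C" "carrier G \<subseteq> \<Union>C"
    "\<forall>P\<in>C. \<forall>x\<in>P. \<forall>y\<in>P. x \<in> carrier G \<longrightarrow> y \<in> carrier G \<longrightarrow> x \<otimes>\<^bsub>G\<^esub> inv\<^bsub>G\<^esub> y \<in> U"
    using assms(1) unfolding small_cover_def by blast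
  obtain D where D: "finite D" "carrier G \<subseteq> \<Union>D"
    "\<forall>P\<in>D. \<forall>x\<in>P. \<forall>y\<in>P. x \<in> carrier G \<longrightarrow> y \<in> carrier G \<longrightarrow> x \<otimes>\<^bsub>G\<^esub> inv\<^bsub>G\<^esub> y \<in> V"
    using assms(2) unfolding small_cover_def by blast
  let ?E = "(\<lambda>(P, Q). P \<inter> Q) ` (C \<times> D)"
  have "finite ?E" using C D by blast
  moreover have "carrier G \<subseteq> \<Union>?E" using C(2) D(2) by fastforce
  moreover have "\<forall>P\<in>?E. \<forall>x\<in>P. \<forall>y\<in>P. x \<in> carrier G \<longrightarrow> y \<in> carrier G \<longrightarrow> x \<otimes>\<^bsub>G\<^esub> inv\<^bsub>G\<^esub> y \<in> U \<inter> V"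
    using C(3) D(3) by blast
  ultimately show ?thesis unfolding small_cover_def by blast
qed

context comm_group
begin

lemma group_topology_mult_nhd:
  assumes T: "group_topology G T" and U: "openin T U" "\<one> \<in> U"
  obtains V where "openin T V" "\<one> \<in> V" "\<And>x y. x \<in> V \<Longrightarrow> y \<in> V \<Longrightarrow> x \<otimes> y \<in> U"
proof -
  let ?S = "{p \<in> topspace (prod_topology T T). (\<lambda>(x, y). x \<otimes> y) p \<in> U}"
  have "openin (prod_topology T T) ?S"
    using T U unfolding group_topology_def by (intro openin_continuous_map_preimage[of _ T]) auto
  moreover have "(\<one>, \<one>) \<in> ?S" using T U by (auto simp: group_topology_def)
  ultimately obtain A B where AB: "openin T A" "openin T B" "\<one> \<in> A" "\<one> \<in> B" "A \<times> B \<subseteq> ?S"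
    unfolding openin_prod_topology_alt by meson
  thus ?thesis using that[of "A \<inter> B"] by (auto simp: subset_iff)
qed

lemma group_topology_inv_open:
  "group_topology G T \<Longrightarrow> openin T U \<Longrightarrow> openin T {x \<in> carrier G. inv x \<in> U}"
  using openin_continuous_map_preimage[of T T "\<lambda>x. inv x" U] by (simp add: group_topology_def)

lemma group_topology_translate_open:
  assumes T: "group_topology G T" and U: "openin T U" and a: "a \<in> carrier G"
  shows "openin T {x \<in> carrier G. a \<otimes> x \<in> U}"
proof -
  have "continuous_map T (prod_topology T T) (\<lambda>x. (a, x))"
    using T a by (intro continuous_map_pairedI) (auto simp: group_topology_def)
  from continuous_map_compose[OF this, of T "\<lambda>(x, y). x \<otimes> y"]
  have "continuous_map T T (\<lambda>x. a \<otimes> x)" using T by (simp add: group_topology_def comp_def)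
  from openin_continuous_map_preimage[OF this U] show ?thesis using T by (simp add: group_topology_def)
qed

lemma group_topology_symmetric_nhd:
  assumes T: "group_topology G T" and U: "openin T U" "\<one> \<in> U"
  obtains V where "openin T V" "\<one> \<in> V" "V \<subseteq> carrier G" "\<And>x. x \<in> V \<Longrightarrow> inv x \<in> V"
    "\<And>x y z. x \<in> V \<Longrightarrow> y \<in> V \<Longrightarrow> z \<in> V \<Longrightarrow> x \<otimes> y \<otimes> z \<in> U"
proof -
  obtain A where A: "openin T A" "\<one> \<in> A" "\<And>x y. x \<in> A \<Longrightarrow> y \<in> A \<Longrightarrow> x \<otimes> y \<in> U"
    using group_topology_mult_nhd[OF T U] by metis
  obtain B where B: "openin T B" "\<one> \<in> B" "\<And>x y. x \<in> B \<Longrightarrow> y \<in> B \<Longrightarrow> x \<otimes> y \<in> A"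
    using group_topology_mult_nhd[OF T A(1,2)] by metis
  define D where "D = A \<inter> B"
  have D: "openin T D" "\<one> \<in> D" using A B by (auto simp: D_def)
  have Dc: "D \<subseteq> carrier G" using openin_subset[OF D(1)] T by (simp add: group_topology_def)
  define V where "V = D \<inter> {x \<in> carrier G. inv x \<in> D}"
  show ?thesis
  proof (rule that[of V])
    show "openin T V" unfolding V_def using D group_topology_inv_open[OF T] by blast
  qed (use D Dc A B in \<open>auto simp: V_def D_def\<close>)
qed

lemma small_cover_iff_precompact:
  assumes T: "group_topology G T"
  shows "(\<forall>U. openin T U \<longrightarrow> \<one> \<in> U \<longrightarrow> small_cover G U) \<longleftrightarrow>
    (\<forall>U. U \<subseteq> carrier G \<and> (\<exists>V. openin T V \<and> \<one> \<in> V \<and> V \<subseteq> U) \<longrightarrow>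
      (\<exists>F. finite F \<and> F \<subseteq> carrier G \<and> F <#> U = carrier G))" (is "?L \<longleftrightarrow> ?R")
proof
  assume L: ?L
  show ?R
  proof (intro allI impI)
    fix U assume "U \<subseteq> carrier G \<and> (\<exists>V. openin T V \<and> \<one> \<in> V \<and> V \<subseteq> U)"
    then obtain V where U: "U \<subseteq> carrier G" and V: "openin T V" "\<one> \<in> V" "V \<subseteq> U" by blast
    obtain C where C: "finite C" "carrier G \<subseteq> \<Union>C"
      "\<And>P x y. P \<in> C \<Longrightarrow> x \<in> P \<Longrightarrow> y \<in> P \<Longrightarrow> x \<in> carrier G \<Longrightarrow> y \<in> carrier G \<Longrightarrow> x \<otimes> inv y \<in> V"
      using L V unfolding small_cover_def by meson
    define c where "c = (\<lambda>P. SOME x. x \<in> P \<inter> carrier G)"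
    define F where "F = c ` {P \<in> C. P \<inter> carrier G \<noteq> {}}"
    have c: "c P \<in> P \<inter> carrier G" if "P \<inter> carrier G \<noteq> {}" for P
      unfolding c_def by (rule someI_ex) (use that in blast)
    have F: "finite F" "F \<subseteq> carrier G" using C(1) c by (auto simp: F_def)
    have "x \<in> F <#> U" if x: "x \<in> carrier G" for x
    proof -
      obtain P where P: "P \<in> C" "x \<in> P" using C(2) x by blast
      have cP: "c P \<in> F" "c P \<in> P" "c P \<in> carrier G" using c[of P] P x by (auto simp: F_def)
      have "x \<otimes> inv (c P) \<in> U" using C(3)[OF P cP(2) x cP(3)] V by blast
      moreover have "x = c P \<otimes> (x \<otimes> inv (c P))"
        using x cP(3) by (simp add: m_lcomm[of "c P"])
      ultimately show ?thesis using cP(1) unfolding set_mult_def by blast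
    qed
    moreover have "F <#> U \<subseteq> carrier G" using F U by (auto simp: set_mult_def)
    ultimately show "\<exists>F. finite F \<and> F \<subseteq> carrier G \<and> F <#> U = carrier G" using F by blast
  qed
next
  assume R: ?R
  show ?L
  proof (intro allI impI)
    fix U assume U: "openin T U" "\<one> \<in> U"
    obtain V where V: "openin T V" "\<one> \<in> V" "V \<subseteq> carrier G" "\<And>x. x \<in> V \<Longrightarrow> inv x \<in> V"
      "\<And>x y z. x \<in> V \<Longrightarrow> y \<in> V \<Longrightarrow> z \<in> V \<Longrightarrow> x \<otimes> y \<otimes> z \<in> U"
      using group_topology_symmetric_nhd[OF T U] by metis
    obtain F where F: "finite F" "F \<subseteq> carrier G" "F <#> V = carrier G" using R[rule_format, of V] V(1-3) by blast
    define C where "C = (\<lambda>f. (\<lambda>v. f \<otimes> v) ` V) ` F"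
    have "finite C" using F(1) by (simp add: C_def)
    moreover have "carrier G \<subseteq> \<Union>C"
    proof
      fix x assume "x \<in> carrier G"
      hence "x \<in> F <#> V" using F(3) by simp
      thus "x \<in> \<Union>C" by (auto simp: C_def set_mult_def)
    qed
    moreover have "x \<otimes> inv y \<in> U" if P: "P \<in> C" "x \<in> P" "y \<in> P" for P x y
    proof -
      obtain f v w where *: "f \<in> F" "v \<in> V" "w \<in> V" "x = f \<otimes> v" "y = f \<otimes> w"
        using P by (auto simp: C_def)
      hence "x \<otimes> inv y = v \<otimes> inv w" using F(2) V(3) by (auto intro!: quotient_translate)
      moreover have "v \<otimes> inv w \<otimes> \<one> \<in> U" using V * by blast
      moreover have "v \<in> carrier G" "w \<in> carrier G" using * V(3) by auto
      ultimately show ?thesis using * by simp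
    qed
    ultimately show "small_cover G U" unfolding small_cover_def by blast
  qed
qed

lemma precompact_iff_tb:
  "precompact_group_topology G T \<longleftrightarrow> tb_group_topology G T \<and> Hausdorff_space T"
  using small_cover_iff_precompact[of T]
  unfolding precompact_group_topology_def tb_group_topology_def by blast

lemma tb_length_function:
  assumes T: "tb_group_topology G T" and V: "openin T V" "\<one> \<in> V"
  obtains d :: "'a \<Rightarrow> real" where "d \<one> = 0" "\<And>x. x \<in> carrier G \<Longrightarrow> d (inv x) = d x"
    "\<And>x y. x \<in> carrier G \<Longrightarrow> y \<in> carrier G \<Longrightarrow> d (x \<otimes> y) \<le> d x + d y"
    "\<And>x. x \<in> carrier G \<Longrightarrow> 0 \<le> d x"
    "\<And>e. 0 < e \<Longrightarrow> \<exists>F. finite F \<and> F \<subseteq> carrier G \<and> (\<forall>x\<in>carrier G. \<exists>z\<in>F. d (z \<otimes> inv x) < e)"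
    "\<And>x. x \<in> carrier G \<Longrightarrow> d x < 2 \<Longrightarrow> x \<in> V"
    "\<And>e. 0 < e \<Longrightarrow> \<exists>W. openin T W \<and> \<one> \<in> W \<and> (\<forall>x\<in>W. d x < e)"
proof -
  have gt: "group_topology G T" using T by (simp add: tb_group_topology_def)
  have ts: "topspace T = carrier G" using gt by (simp add: group_topology_def)
  \<comment> \<open>The zeroth neighbourhood must be everything, for the length to be finite. The first one lies in
    \<open>V\<close>, and multiplying the length by \<open>4\<close> moves its threshold \<open>1 / 2\<close> to \<open>2\<close>.\<close>
  define Good where "Good = (\<lambda>(n::nat) W. openin T W \<and> \<one> \<in> W \<and> W \<subseteq> carrier G \<and> (\<forall>x\<in>W. inv x \<in> W) \<and>
    (n = 0 \<longrightarrow> W = carrier G) \<and> (n = 1 \<longrightarrow> W \<subseteq> V))"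
  define Step where "Step = (\<lambda>(n::nat) W W'. \<forall>x\<in>W'. \<forall>y\<in>W'. \<forall>z\<in>W'. x \<otimes> y \<otimes> z \<in> W)"
  have "\<exists>U. \<forall>n. Good n (U n) \<and> Step n (U n) (U (Suc n))"
  proof (rule dependent_nat_choice)
    show "\<exists>W. Good 0 W" using openin_topspace[of T] ts by (auto simp: Good_def)
    fix W n assume W: "Good n W"
    hence WV: "openin T (W \<inter> V)" "\<one> \<in> W \<inter> V" using V by (auto simp: Good_def)
    obtain W' where W': "openin T W'" "\<one> \<in> W'" "W' \<subseteq> carrier G" "\<And>x. x \<in> W' \<Longrightarrow> inv x \<in> W'"
      "\<And>x y z. x \<in> W' \<Longrightarrow> y \<in> W' \<Longrightarrow> z \<in> W' \<Longrightarrow> x \<otimes> y \<otimes> z \<in> W \<inter> V"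
      by (rule group_topology_symmetric_nhd[OF gt WV]) blast
    have "x \<in> V" if "x \<in> W'" for x using W'(5)[OF that W'(2) W'(2)] W'(3) that by auto
    thus "\<exists>W'. Good (Suc n) W' \<and> Step n W W'"
      using W' by (intro exI[of _ W']) (auto simp: Good_def Step_def)
  qed
  then obtain U where U: "\<And>n. Good n (U n)" "\<And>n. Step n (U n) (U (Suc n))" by blast
  obtain l :: "'a \<Rightarrow> real" where l: "l \<one> = 0" "\<And>x. x \<in> carrier G \<Longrightarrow> 0 \<le> l x"
    "\<And>x. x \<in> carrier G \<Longrightarrow> l (inv x) = l x"
    "\<And>x y. x \<in> carrier G \<Longrightarrow> y \<in> carrier G \<Longrightarrow> l (x \<otimes> y) \<le> l x + l y"
    "\<And>x n. x \<in> U n \<Longrightarrow> l x \<le> (1 / 2) ^ n"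
    "\<And>x n. x \<in> carrier G \<Longrightarrow> l x < (1 / 2) ^ n \<Longrightarrow> x \<in> U n"
  proof (rule length_function_exists[of U])
    show "U 0 = carrier G" using U(1)[of 0] by (simp add: Good_def)
    show "\<one> \<in> U n" "U n \<subseteq> carrier G" for n using U(1)[of n] by (simp_all add: Good_def)
    show "inv x \<in> U n" if "x \<in> U n" for n x using U(1)[of n] that by (simp add: Good_def)
    show "x \<otimes> y \<otimes> z \<in> U n" if "x \<in> U (Suc n)" "y \<in> U (Suc n)" "z \<in> U (Suc n)" for n x y z
      using U(2)[of n] that by (simp add: Step_def)
  qed blast
  have small: "\<exists>n. \<forall>x\<in>U n. 4 * l x < e" if e: "0 < e" for e
  proof -
    obtain n where "(1 / 2 :: real) ^ n < e / 4" using real_arch_pow_inv[of "e / 4" "1 / 2"] e by auto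
    thus ?thesis using l(5)[of _ n] by (intro exI[of _ n]) force
  qed
  have opn: "openin T (U n)" "\<one> \<in> U n" for n using U(1)[of n] by (simp_all add: Good_def)
  show ?thesis
  proof (rule that[of "\<lambda>x. 4 * l x"])
    show "\<exists>F. finite F \<and> F \<subseteq> carrier G \<and> (\<forall>x\<in>carrier G. \<exists>z\<in>F. 4 * l (z \<otimes> inv x) < e)" if e: "0 < e" for e
    proof -
      obtain n where n: "\<forall>x\<in>U n. 4 * l x < e" using small[OF e] by blast
      obtain C where C: "finite C" "carrier G \<subseteq> \<Union>C"
        "\<And>P x y. P \<in> C \<Longrightarrow> x \<in> P \<Longrightarrow> y \<in> P \<Longrightarrow> x \<in> carrier G \<Longrightarrow> y \<in> carrier G \<Longrightarrow> x \<otimes> inv y \<in> U n"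
        using T opn[of n] unfolding tb_group_topology_def small_cover_def by meson
      define c where "c = (\<lambda>P. SOME x. x \<in> P \<inter> carrier G)"
      have c: "c P \<in> P \<inter> carrier G" if "P \<inter> carrier G \<noteq> {}" for P
        unfolding c_def by (rule someI_ex) (use that in blast)
      have "\<exists>z\<in>c ` {P \<in> C. P \<inter> carrier G \<noteq> {}}. 4 * l (z \<otimes> inv x) < e" if x: "x \<in> carrier G" for x
      proof -
        obtain P where P: "P \<in> C" "x \<in> P" using C(2) x by blast
        have "c P \<otimes> inv x \<in> U n" using C(3)[OF P(1) _ P(2)] c[of P] P x by blast
        thus ?thesis using n P x by blast
      qed
      thus ?thesis using C(1) c by (intro exI[of _ "c ` {P \<in> C. P \<inter> carrier G \<noteq> {}}"]) auto
    qed
    show "\<exists>W. openin T W \<and> \<one> \<in> W \<and> (\<forall>x\<in>W. 4 * l x < e)" if "0 < e" for e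
      using small[OF that] opn by blast
    show "x \<in> V" if "x \<in> carrier G" "4 * l x < 2" for x
      using l(6)[of x 1] that U(1)[of 1] by (auto simp: Good_def)
    show "4 * l (x \<otimes> y) \<le> 4 * l x + 4 * l y" if "x \<in> carrier G" "y \<in> carrier G" for x y
      using l(4)[OF that] by simp
  qed (simp_all add: l(1-3))
qed

end

section \<open>Suprema of group topologies\<close>

lemma topology_le_antisym: "topology_le S T \<Longrightarrow> topology_le T S \<Longrightarrow> S = T"
  unfolding topology_le_def topology_eq by blast

definition sup_topology :: "'a topology set \<Rightarrow> 'a topology"
  where "sup_topology \<T> = topology_generated_by (\<Union>T\<in>\<T>. {U. openin T U})"

lemma topology_le_sup: "T \<in> \<T> \<Longrightarrow> topology_le T (sup_topology \<T>)"
  unfolding topology_le_def sup_topology_def by (auto intro: topology_generated_by_Basis)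

text \<open>A property of neighbourhoods of a point that passes to intersections and supersets need only be
  checked for the given topologies.\<close>

lemma sup_topology_nhd_induct:
  assumes "openin (sup_topology \<T>) U" "x \<in> U"
    and basis: "\<And>T U. T \<in> \<T> \<Longrightarrow> openin T U \<Longrightarrow> x \<in> U \<Longrightarrow> P U"
    and int: "\<And>U V. P U \<Longrightarrow> P V \<Longrightarrow> P (U \<inter> V)"
    and mono: "\<And>U V. P U \<Longrightarrow> U \<subseteq> V \<Longrightarrow> P V"
  shows "P U"
proof -
  have "generate_topology_on (\<Union>T\<in>\<T>. {U. openin T U}) U"
    using assms(1) by (simp add: sup_topology_def openin_topology_generated_by_iff)
  hence "x \<in> U \<longrightarrow> P U"
  proof induction
    case (Int a b)
    thus ?case using int by blast
  next
    case (UN K)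
    show ?case
    proof
      assume "x \<in> \<Union>K"
      then obtain k where "k \<in> K" "x \<in> k" by blast
      thus "P (\<Union>K)" using UN.IH mono[of k "\<Union>K"] by blast
    qed
  qed (use basis in auto)
  thus ?thesis using assms(2) by blast
qed

context comm_group
begin

lemma topspace_sup_topology:
  assumes "\<T> \<noteq> {}" "\<And>T. T \<in> \<T> \<Longrightarrow> group_topology G T"
  shows "topspace (sup_topology \<T>) = carrier G"
proof -
  have "\<Union>{U. openin T U} = carrier G" if "T \<in> \<T>" for T
    using assms(2)[OF that] by (auto simp: group_topology_def topspace_def)
  hence "(\<Union>T\<in>\<T>. \<Union>{U. openin T U}) = carrier G" using assms(1) by simp
  moreover have "\<Union>(\<Union>T\<in>\<T>. {U. openin T U}) = (\<Union>T\<in>\<T>. \<Union>{U. openin T U})" by blast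
  ultimately show ?thesis unfolding sup_topology_def topology_generated_by_topspace by (simp only:)
qed

lemma group_topology_sup:
  assumes ne: "\<T> \<noteq> {}" and gt: "\<And>T. T \<in> \<T> \<Longrightarrow> group_topology G T"
  shows "group_topology G (sup_topology \<T>)"
proof -
  let ?S = "sup_topology \<T>"
  note ts = topspace_sup_topology[OF ne gt]
  have id: "continuous_map ?S T (\<lambda>x. x)" if "T \<in> \<T>" for T
    unfolding continuous_map_def
  proof (intro conjI allI impI)
    have tT: "topspace T = carrier G" using gt[OF that] by (simp add: group_topology_def)
    show "(\<lambda>x. x) \<in> topspace ?S \<rightarrow> topspace T" using ts tT by simp
    fix U assume U: "openin T U"
    hence "{x \<in> topspace ?S. x \<in> U} = U" using openin_subset[OF U] tT ts by auto
    thus "openin ?S {x \<in> topspace ?S. x \<in> U}"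
      using topology_le_sup[OF that] U by (simp add: topology_le_def)
  qed
  have into: "continuous_map Y ?S f" if "\<And>T. T \<in> \<T> \<Longrightarrow> continuous_map Y T f" for Y :: "'c topology" and f
    unfolding sup_topology_def
  proof (rule continuous_on_generated_topo)
    fix U assume "U \<in> (\<Union>T\<in>\<T>. {U. openin T U})"
    then obtain T where "T \<in> \<T>" "openin T U" by blast
    thus "openin Y (f -` U \<inter> topspace Y)"
      using that openin_continuous_map_preimage[of Y T f U] by (simp add: vimage_def Int_def conj_commute)
  next
    obtain T where T: "T \<in> \<T>" using ne by blast
    have "f ` topspace Y \<subseteq> topspace T" using that[OF T] by (auto simp: continuous_map_def)
    moreover have "topspace T \<subseteq> \<Union>(\<Union>T\<in>\<T>. {U. openin T U})" using T openin_topspace[of T] by blast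
    ultimately show "f ` topspace Y \<subseteq> \<Union>(\<Union>T\<in>\<T>. {U. openin T U})" by blast
  qed
  have "continuous_map (prod_topology ?S ?S) T (\<lambda>(x, y). x \<otimes> y)" if T: "T \<in> \<T>" for T
  proof -
    have "continuous_map (prod_topology ?S ?S) (prod_topology T T) (\<lambda>p. (fst p, snd p))"
      by (intro continuous_map_pairedI continuous_map_compose[OF continuous_map_fst id[OF T], unfolded comp_def]
          continuous_map_compose[OF continuous_map_snd id[OF T], unfolded comp_def])
    from continuous_map_compose[OF this, of T "\<lambda>(x, y). x \<otimes> y"]
    show ?thesis using gt[OF T] by (simp add: group_topology_def comp_def case_prod_beta')
  qed
  moreover have "continuous_map ?S T (\<lambda>x. inv x)" if T: "T \<in> \<T>" for T
    using continuous_map_compose[OF id[OF T], of T "\<lambda>x. inv x"] gt[OF T]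
    by (simp add: group_topology_def comp_def)
  ultimately show ?thesis unfolding group_topology_def by (intro conjI ts into)
qed

lemma tb_group_topology_sup:
  assumes "\<T> \<noteq> {}" "\<And>T. T \<in> \<T> \<Longrightarrow> tb_group_topology G T"
  shows "tb_group_topology G (sup_topology \<T>)"
  unfolding tb_group_topology_def
proof (intro conjI allI impI)
  show "group_topology G (sup_topology \<T>)"
    using assms by (intro group_topology_sup) (auto simp: tb_group_topology_def)
  fix U assume "openin (sup_topology \<T>) U" "\<one> \<in> U"
  thus "small_cover G U"
    by (rule sup_topology_nhd_induct)
       (use assms(2) small_cover_Int small_cover_mono in \<open>auto simp: tb_group_topology_def\<close>)
qed

lemma precompact_sup:
  assumes T: "T \<in> \<T>" "Hausdorff_space T" and tb: "\<And>T. T \<in> \<T> \<Longrightarrow> tb_group_topology G T"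
  shows "precompact_group_topology G (sup_topology \<T>)"
proof -
  have "topspace T = topspace (sup_topology \<T>)"
    using topspace_sup_topology[of \<T>] T tb by (auto simp: tb_group_topology_def group_topology_def)
  hence "Hausdorff_space (sup_topology \<T>)"
    using T(2) topology_le_sup[OF T(1)] unfolding Hausdorff_space_def topology_le_def by metis
  thus ?thesis using tb_group_topology_sup[of \<T>] T(1) tb by (auto simp: precompact_iff_tb)
qed

lemma limitin_sup:
  assumes ne: "\<T> \<noteq> {}" and gt: "\<And>T. T \<in> \<T> \<Longrightarrow> group_topology G T"
    and lim: "\<And>T. T \<in> \<T> \<Longrightarrow> limitin T u \<one> F"
  shows "limitin (sup_topology \<T>) u \<one> F"
  unfolding limitin_def
proof (intro conjI allI impI)
  show "\<one> \<in> topspace (sup_topology \<T>)" using topspace_sup_topology[OF ne gt] by simp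
  fix U assume "openin (sup_topology \<T>) U \<and> \<one> \<in> U"
  hence "openin (sup_topology \<T>) U" "\<one> \<in> U" by auto
  thus "\<forall>\<^sub>F n in F. u n \<in> U"
    by (rule sup_topology_nhd_induct)
       (use lim in \<open>auto simp: limitin_def eventually_conj_iff elim: eventually_mono\<close>)
qed

text \<open>The supremum of all precompact topologies in which \<open>u\<close> converges is itself one of them.\<close>

lemma TB_topology_finest:
  assumes "TB_sequence G u"
  shows "is_finest_TB_topology G u (TB_topology G u)"
proof -
  define \<T> where "\<T> = {T. precompact_group_topology G T \<and> limitin T u \<one> sequentially}"
  obtain T0 where T0: "T0 \<in> \<T>" using assms by (auto simp: TB_sequence_def \<T>_def)
  have tb: "tb_group_topology G T" "group_topology G T" "Hausdorff_space T" if "T \<in> \<T>" for T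
    using that precompact_iff_tb by (auto simp: \<T>_def tb_group_topology_def)
  have "is_finest_TB_topology G u (sup_topology \<T>)"
    unfolding is_finest_TB_topology_def
  proof (intro conjI allI impI)
    show "precompact_group_topology G (sup_topology \<T>)" using precompact_sup T0 tb by blast
    show "limitin (sup_topology \<T>) u \<one> sequentially"
      using T0 tb by (intro limitin_sup) (auto simp: \<T>_def)
    fix T assume "precompact_group_topology G T \<and> limitin T u \<one> sequentially"
    thus "topology_le T (sup_topology \<T>)" by (intro topology_le_sup) (simp add: \<T>_def)
  qed
  moreover from this have "T = sup_topology \<T>" if "is_finest_TB_topology G u T" for T
    using that topology_le_antisym unfolding is_finest_TB_topology_def by blast
  ultimately show ?thesis unfolding TB_topology_def by (rule theI)
qed

section \<open>The finest topology and its restriction to a subgroup\<close>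

text \<open>Values of characters lie in a disc, which is covered by finitely many small ones.\<close>

lemma tb_character_topology:
  assumes \<xi>: "character G \<xi>"
  shows "tb_group_topology G (pullback_topology (carrier G) \<xi> euclidean)" (is "tb_group_topology G ?T")
  unfolding tb_group_topology_def
proof (intro conjI allI impI)
  have ts: "topspace ?T = carrier G" by (simp add: topspace_pullback_topology)
  have c: "continuous_map ?T euclidean \<xi>"
    using continuous_map_pullback[of euclidean euclidean id "carrier G" \<xi>] by simp
  show "group_topology G ?T"
    unfolding group_topology_def
  proof (intro conjI)
    show "topspace ?T = carrier G" by (rule ts)
    have "continuous_map (prod_topology ?T ?T) (prod_topology euclidean euclidean) (\<lambda>p. (\<xi> (fst p), \<xi> (snd p)))"
      by (intro continuous_map_pairedI continuous_map_compose[OF continuous_map_fst c, unfolded comp_def]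
          continuous_map_compose[OF continuous_map_snd c, unfolded comp_def])
    moreover have "continuous_map (prod_topology euclidean euclidean) euclidean (\<lambda>p :: complex \<times> complex. fst p * snd p)"
      unfolding prod_topology_euclidean by (auto intro!: continuous_intros)
    ultimately have "continuous_map (prod_topology ?T ?T) euclidean
        ((\<lambda>p. fst p * snd p) \<circ> (\<lambda>p. (\<xi> (fst p), \<xi> (snd p))))"
      by (rule continuous_map_compose)
    hence "continuous_map (prod_topology ?T ?T) euclidean (\<lambda>p. \<xi> (fst p) * \<xi> (snd p))"
      by (simp add: comp_def)
    hence "continuous_map (prod_topology ?T ?T) euclidean (\<xi> \<circ> (\<lambda>(x, y). x \<otimes> y))"
      by (rule continuous_map_eq) (auto simp: ts character_mult[OF \<xi>])
    thus "continuous_map (prod_topology ?T ?T) ?T (\<lambda>(x, y). x \<otimes> y)"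
      by (rule continuous_map_pullback') (auto simp: ts)
    have "continuous_map ?T euclidean (\<lambda>x. cnj (\<xi> x))"
      using continuous_map_compose[OF c, of euclidean cnj] by (simp add: comp_def continuous_on_cnj)
    hence "continuous_map ?T euclidean (\<xi> \<circ> (\<lambda>x. inv x))"
      by (rule continuous_map_eq) (auto simp: ts character_inv[OF \<xi>])
    thus "continuous_map ?T ?T (\<lambda>x. inv x)"
      by (rule continuous_map_pullback') (auto simp: ts)
  qed
  fix U assume U: "openin ?T U" "\<one> \<in> U"
  then obtain W where W: "open W" "U = \<xi> -` W \<inter> carrier G" by (auto simp: openin_pullback_topology)
  have "\<xi> \<one> \<in> W" using U W by auto
  then obtain e where e: "0 < e" "ball 1 e \<subseteq> W"
    using W(1) character_one[OF \<xi>] open_contains_ball by metis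
  obtain K :: "complex set" where K: "finite K" "cball 0 1 \<subseteq> (\<Union>k\<in>K. ball k (e / 2))"
    using compact_cball[of "0::complex" 1] e(1) unfolding compact_eq_totally_bounded by (meson half_gt_zero)
  define C where "C = (\<lambda>k. {x. dist k (\<xi> x) < e / 2}) ` K"
  have "carrier G \<subseteq> \<Union>C"
  proof
    fix x assume "x \<in> carrier G"
    hence "\<xi> x \<in> cball 0 1" using \<xi> by (simp add: character_def)
    with K(2) obtain k where "k \<in> K" "\<xi> x \<in> ball k (e / 2)" by blast
    thus "x \<in> \<Union>C" by (auto simp: C_def)
  qed
  moreover have "x \<otimes> inv y \<in> U" if P: "P \<in> C" "x \<in> P" "y \<in> P" and xy: "x \<in> carrier G" "y \<in> carrier G" for P x y
  proof -
    obtain k where "dist k (\<xi> x) < e / 2" "dist k (\<xi> y) < e / 2" using P by (auto simp: C_def)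
    hence d: "cmod (\<xi> y - \<xi> x) < e" using dist_triangle_half_r[of k "\<xi> y" e "\<xi> x"] by (simp add: dist_norm)
    have u: "cmod (\<xi> y) = 1" using \<xi> xy by (simp add: character_def)
    hence "\<xi> y * cnj (\<xi> y) = 1" by (metis complex_norm_square of_real_1 power_one)
    hence "1 - \<xi> (x \<otimes> inv y) = (\<xi> y - \<xi> x) * cnj (\<xi> y)"
      using xy by (simp add: character_mult[OF \<xi>] character_inv[OF \<xi>] algebra_simps)
    hence "cmod (1 - \<xi> (x \<otimes> inv y)) < e" using d u by (simp add: norm_mult)
    hence "\<xi> (x \<otimes> inv y) \<in> W" using e(2) by (auto simp: dist_norm subset_iff)
    thus ?thesis using W xy by simp
  qed
  ultimately show "small_cover G U" unfolding small_cover_def using K(1) by (intro exI[of _ C]) (auto simp: C_def)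
qed

text \<open>Adding to \<open>T\<close> the topology induced by a character along which \<open>u\<close> tends to \<open>1\<close> gives a
  precompact topology in which \<open>u\<close> still converges; as \<open>T\<close> is the finest such topology, the
  character was continuous already.\<close>

lemma finest_TB_character_open:
  assumes fin: "is_finest_TB_topology G u T" and ran: "range u \<subseteq> carrier G"
    and \<xi>: "character G \<xi>" and lim: "(\<lambda>n. \<xi> (u n)) \<longlonglongrightarrow> 1" and W: "open W"
  shows "openin T {x \<in> carrier G. \<xi> x \<in> W}"
proof -
  let ?P = "pullback_topology (carrier G) \<xi> euclidean"
  have T: "tb_group_topology G T" "Hausdorff_space T" "limitin T u \<one> sequentially"
    using fin by (auto simp: is_finest_TB_topology_def precompact_iff_tb)
  have P: "tb_group_topology G ?P" using tb_character_topology[OF \<xi>] .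
  have "limitin ?P u \<one> sequentially"
    unfolding limitin_def
  proof (intro conjI allI impI)
    show "\<one> \<in> topspace ?P" by (simp add: topspace_pullback_topology)
    fix U assume "openin ?P U \<and> \<one> \<in> U"
    then obtain V where "open V" "U = \<xi> -` V \<inter> carrier G" "1 \<in> V"
      using character_one[OF \<xi>] by (auto simp: openin_pullback_topology)
    moreover from this have "\<forall>\<^sub>F n in sequentially. \<xi> (u n) \<in> V" using lim topological_tendstoD by blast
    moreover have "u n \<in> carrier G" for n using ran by blast
    ultimately show "\<forall>\<^sub>F n in sequentially. u n \<in> U" by simp
  qed
  hence "precompact_group_topology G (sup_topology {T, ?P})" "limitin (sup_topology {T, ?P}) u \<one> sequentially"
    using T P by (auto intro!: precompact_sup[of T] limitin_sup simp: tb_group_topology_def)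
  hence "topology_le (sup_topology {T, ?P}) T" using fin by (simp add: is_finest_TB_topology_def)
  moreover have "topology_le ?P (sup_topology {T, ?P})" by (intro topology_le_sup) simp
  moreover have "openin ?P {x \<in> carrier G. \<xi> x \<in> W}"
    using W by (auto simp: openin_pullback_topology)
  ultimately show ?thesis unfolding topology_le_def by blast
qed

lemma tb_group_topology_subgroup:
  assumes H: "subgroup H G" and T: "tb_group_topology G T"
  shows "tb_group_topology (G\<lparr>carrier := H\<rparr>) (subtopology T H)"
  unfolding tb_group_topology_def
proof (intro conjI allI impI)
  have HG: "H \<subseteq> carrier G" using subgroup.subset[OF H] .
  have gt: "topspace T = carrier G" "continuous_map (prod_topology T T) T (\<lambda>(x, y). x \<otimes> y)"
    "continuous_map T T (\<lambda>x. inv x)"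
    using T by (auto simp: tb_group_topology_def group_topology_def)
  have ts: "topspace (subtopology T H) = H" using gt(1) HG by auto
  have "continuous_map (prod_topology (subtopology T H) (subtopology T H)) T (\<lambda>(x, y). x \<otimes> y)"
    using continuous_map_from_subtopology[OF gt(2), of "H \<times> H"] by (simp add: subtopology_Times)
  hence 1: "continuous_map (prod_topology (subtopology T H) (subtopology T H)) (subtopology T H) (\<lambda>(x, y). x \<otimes> y)"
    unfolding continuous_map_in_subtopology using ts subgroup.m_closed[OF H] by auto
  have "continuous_map (subtopology T H) T (\<lambda>x. inv x)"
    using continuous_map_from_subtopology[OF gt(3)] .
  hence "continuous_map (subtopology T H) (subtopology T H) (\<lambda>x. inv x)"
    unfolding continuous_map_in_subtopology using ts subgroup.m_inv_closed[OF H] by auto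
  hence 2: "continuous_map (subtopology T H) (subtopology T H) (\<lambda>x. inv\<^bsub>G\<lparr>carrier := H\<rparr>\<^esub> x)"
    by (rule continuous_map_eq) (use ts m_inv_consistent[OF H] in auto)
  show "group_topology (G\<lparr>carrier := H\<rparr>) (subtopology T H)"
    using 1 2 ts by (simp add: group_topology_def)
  fix U assume U: "openin (subtopology T H) U" "\<one>\<^bsub>G\<lparr>carrier := H\<rparr>\<^esub> \<in> U"
  then obtain V where V: "openin T V" "U = V \<inter> H" by (auto simp: openin_subtopology)
  with U T have "small_cover G V" by (auto simp: tb_group_topology_def)
  then obtain C where C: "finite C" "carrier G \<subseteq> \<Union>C"
    "\<And>P x y. P \<in> C \<Longrightarrow> x \<in> P \<Longrightarrow> y \<in> P \<Longrightarrow> x \<in> carrier G \<Longrightarrow> y \<in> carrier G \<Longrightarrow> x \<otimes> inv y \<in> V"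
    unfolding small_cover_def by meson
  have "x \<otimes> inv\<^bsub>G\<lparr>carrier := H\<rparr>\<^esub> y \<in> U" if "P \<in> C" "x \<in> P" "y \<in> P" "x \<in> H" "y \<in> H" for P x y
    using C(3)[OF that(1-3)] that(4,5) HG quotient_mem[OF H that(4,5)] m_inv_consistent[OF H that(5)] V(2) by auto
  thus "small_cover (G\<lparr>carrier := H\<rparr>) U"
    unfolding small_cover_def using C HG by (intro exI[of _ C]) auto
qed

text \<open>A neighbourhood in \<open>H\<close> contains the set of points at which finitely many characters of \<open>G\<close>
  are close to \<open>1\<close>. These characters are continuous on \<open>H\<close>, so \<open>u\<close> tends to \<open>1\<close> along each of
  them, and this makes them continuous on all of \<open>G\<close> for the finest topology there.\<close>

lemma finest_TB_topology_subgroup_nhd: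
  assumes H: "subgroup H G" and ran: "range u \<subseteq> H"
    and T: "is_finest_TB_topology G u T"
    and \<zeta>: "tb_group_topology (G\<lparr>carrier := H\<rparr>) \<zeta>" "limitin \<zeta> u \<one> sequentially"
    and V: "openin \<zeta> V" "\<one> \<in> V"
  obtains B where "openin T B" "\<one> \<in> B" "B \<inter> H \<subseteq> V"
proof -
  have HG: "H \<subseteq> carrier G" using subgroup.subset[OF H] .
  interpret K: comm_group "G\<lparr>carrier := H\<rparr>"
    using group.group_comm_groupI[OF subgroup.subgroup_is_group[OF H group_axioms]] HG m_comm by auto
  have inv: "inv\<^bsub>G\<lparr>carrier := H\<rparr>\<^esub> x = inv x" if "x \<in> H" for x using m_inv_consistent[OF H that] .
  have V1: "\<one>\<^bsub>G\<lparr>carrier := H\<rparr>\<^esub> \<in> V" using V(2) by simp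
  obtain d :: "'a \<Rightarrow> real" where d: "d \<one> = 0" "\<And>x. x \<in> H \<Longrightarrow> d (inv x) = d x"
    "\<And>x y. x \<in> H \<Longrightarrow> y \<in> H \<Longrightarrow> d (x \<otimes> y) \<le> d x + d y"
    "\<And>x. x \<in> H \<Longrightarrow> 0 \<le> d x"
    "\<And>e. 0 < e \<Longrightarrow> \<exists>F. finite F \<and> F \<subseteq> H \<and> (\<forall>x\<in>H. \<exists>z\<in>F. d (z \<otimes> inv x) < e)"
    "\<And>x. x \<in> H \<Longrightarrow> d x < 2 \<Longrightarrow> x \<in> V"
    "\<And>e. 0 < e \<Longrightarrow> \<exists>W. openin \<zeta> W \<and> \<one> \<in> W \<and> (\<forall>x\<in>W. d x < e)"
    by (rule K.tb_length_function[OF \<zeta>(1) V(1) V1]) (simp add: inv)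
  obtain \<Xi> where X: "finite \<Xi>" "\<And>\<xi>. \<xi> \<in> \<Xi> \<Longrightarrow> character G \<xi>"
    "\<And>\<xi>. \<xi> \<in> \<Xi> \<Longrightarrow> \<exists>c>0. \<forall>x\<in>H. (cmod (\<xi> x - 1))\<^sup>2 \<le> c * d x"
    "\<And>x. x \<in> H \<Longrightarrow> (\<And>\<xi>. \<xi> \<in> \<Xi> \<Longrightarrow> cmod (\<xi> x - 1) < 1 / 2) \<Longrightarrow> d x < 2"
    using totally_bounded_length_characters[OF H d(1-5)] by metis
  have lim: "(\<lambda>n. \<xi> (u n)) \<longlonglongrightarrow> 1" if \<xi>: "\<xi> \<in> \<Xi>" for \<xi>
  proof (rule tendstoI)
    fix e :: real assume e: "0 < e"
    obtain c where c: "0 < c" "\<And>x. x \<in> H \<Longrightarrow> (cmod (\<xi> x - 1))\<^sup>2 \<le> c * d x" using X(3)[OF \<xi>] by blast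
    have "0 < e\<^sup>2 / c" using e c by simp
    from d(7)[OF this] obtain W where W: "openin \<zeta> W" "\<one> \<in> W" "\<forall>x\<in>W. d x < e\<^sup>2 / c" by blast
    have "\<forall>\<^sub>F n in sequentially. u n \<in> W" using \<zeta>(2) W(1,2) by (simp add: limitin_def)
    thus "\<forall>\<^sub>F n in sequentially. dist (\<xi> (u n)) 1 < e"
    proof eventually_elim
      case (elim n)
      have "u n \<in> H" using ran by blast
      hence "(cmod (\<xi> (u n) - 1))\<^sup>2 \<le> c * d (u n)" using c(2) by blast
      also have "\<dots> < e\<^sup>2" using bspec[OF W(3) elim] c(1) by (simp add: pos_less_divide_eq mult.commute)
      finally have "cmod (\<xi> (u n) - 1) < e" using e by (intro power_less_imp_less_base[of _ 2 e]) auto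
      thus ?case by (simp add: dist_norm)
    qed
  qed
  define B where "B = carrier G \<inter> (\<Inter>\<xi>\<in>\<Xi>. {x \<in> carrier G. \<xi> x \<in> ball 1 (1 / 2)})"
  have ts: "topspace T = carrier G"
    using T by (simp add: is_finest_TB_topology_def precompact_group_topology_def group_topology_def)
  have "openin T B"
  proof (cases "\<Xi> = {}")
    case True
    thus ?thesis using openin_topspace[of T] ts by (simp add: B_def)
  next
    case False
    have "openin T {x \<in> carrier G. \<xi> x \<in> ball 1 (1 / 2)}" if "\<xi> \<in> \<Xi>" for \<xi>
      using T X(2)[OF that] lim[OF that] ran HG by (intro finest_TB_character_open[of u]) auto
    thus ?thesis unfolding B_def using X(1) False openin_topspace[of T] ts
      by (intro openin_Int openin_Inter) auto
  qed
  moreover have "\<one> \<in> B" using X(2) by (auto simp: B_def character_one)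
  moreover have "x \<in> V" if "x \<in> B \<inter> H" for x
    using that by (intro d(6) X(4)) (auto simp: B_def dist_norm norm_minus_commute)
  ultimately show ?thesis using that by blast
qed

text \<open>The restriction of \<open>T\<close> is one of the topologies of which \<open>\<zeta>\<close> is the finest. Conversely, the
  comparison of neighbourhoods of the neutral element spreads to all points by translation.\<close>

lemma finest_TB_topology_subgroup:
  assumes H: "subgroup H G" and ran: "range u \<subseteq> H"
    and T: "is_finest_TB_topology G u T"
    and \<zeta>: "is_finest_TB_topology (G\<lparr>carrier := H\<rparr>) u \<zeta>"
  shows "subtopology T H = \<zeta>"
proof (rule topology_le_antisym)
  have HG: "H \<subseteq> carrier G" using subgroup.subset[OF H] .
  interpret K: comm_group "G\<lparr>carrier := H\<rparr>"
    using group.group_comm_groupI[OF subgroup.subgroup_is_group[OF H group_axioms]] HG m_comm by auto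
  have uH: "u n \<in> H" for n using ran by blast
  have Tp: "tb_group_topology G T" "Hausdorff_space T" "limitin T u \<one> sequentially"
    using T by (auto simp: is_finest_TB_topology_def precompact_iff_tb)
  have z: "tb_group_topology (G\<lparr>carrier := H\<rparr>) \<zeta>" "limitin \<zeta> u \<one> sequentially"
    using \<zeta> by (auto simp: is_finest_TB_topology_def K.precompact_iff_tb)
  have "precompact_group_topology (G\<lparr>carrier := H\<rparr>) (subtopology T H)"
    using tb_group_topology_subgroup[OF H Tp(1)] Hausdorff_space_subtopology[OF Tp(2)]
    by (simp add: K.precompact_iff_tb)
  moreover have "limitin (subtopology T H) u \<one> sequentially"
    using Tp(3) uH subgroup.one_closed[OF H] by (simp add: limitin_subtopology)
  ultimately show "topology_le (subtopology T H) \<zeta>"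
    using \<zeta> by (simp add: is_finest_TB_topology_def)
  show "topology_le \<zeta> (subtopology T H)"
    unfolding topology_le_def
  proof (intro allI impI)
    fix V assume V: "openin \<zeta> V"
    have tz: "topspace \<zeta> = H" "group_topology (G\<lparr>carrier := H\<rparr>) \<zeta>"
      using z by (auto simp: tb_group_topology_def group_topology_def)
    have VH: "V \<subseteq> H" using openin_subset[OF V] tz by simp
    show "openin (subtopology T H) V"
      unfolding openin_subopen[of _ V]
    proof
      fix a assume a: "a \<in> V"
      have aH: "a \<in> H" "a \<in> carrier G" "inv a \<in> carrier G" using a VH HG by auto
      have "openin \<zeta> {x \<in> H. a \<otimes> x \<in> V}"
        using K.group_topology_translate_open[OF tz(2) V, of a] aH by simp
      moreover have "\<one> \<in> {x \<in> H. a \<otimes> x \<in> V}" using a aH subgroup.one_closed[OF H] by simp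
      ultimately obtain B where B: "openin T B" "\<one> \<in> B" "B \<inter> H \<subseteq> {x \<in> H. a \<otimes> x \<in> V}"
        by (rule finest_TB_topology_subgroup_nhd[OF H ran T z])
      define A where "A = {x \<in> carrier G. inv a \<otimes> x \<in> B} \<inter> H"
      have "openin (subtopology T H) A"
        unfolding A_def openin_subtopology
        using group_topology_translate_open[OF _ B(1) aH(3)] Tp(1) by (auto simp: tb_group_topology_def)
      moreover have "a \<in> A" using aH B(2) by (simp add: A_def)
      moreover have "x \<in> V" if "x \<in> A" for x
      proof -
        have x: "x \<in> H" "x \<in> carrier G" "inv a \<otimes> x \<in> B" using that by (auto simp: A_def)
        have "inv a \<otimes> x \<in> H" using x aH subgroup.m_closed[OF H] subgroup.m_inv_closed[OF H] by blast
        hence "a \<otimes> (inv a \<otimes> x) \<in> V" using B(3) x by blast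
        thus ?thesis using x aH by (simp add: m_assoc[symmetric])
      qed
      ultimately show "\<exists>A. openin (subtopology T H) A \<and> a \<in> A \<and> A \<subseteq> V" by blast
    qed
  qed
qed

end

theorem proposition1p7:
  fixes G :: "('a, 'b) monoid_scheme" and u :: "nat \<Rightarrow> 'a" and H :: "'a set"
  assumes "comm_group G"
    and "TB_sequence G u"
    and "subgroup H G"
    and "generate G (range u) \<subseteq> H"
  shows "finest_precompact_extension G H (TB_topology (G\<lparr>carrier := H\<rparr>) u) (TB_topology G u) \<and>
    subtopology (TB_topology G u) H = TB_topology (G\<lparr>carrier := H\<rparr>) u"
proof -
  interpret comm_group G by fact
  note H = \<open>subgroup H G\<close>
  have HG: "H \<subseteq> carrier G" using subgroup.subset[OF H] .
  interpret K: comm_group "G\<lparr>carrier := H\<rparr>"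
    using group.group_comm_groupI[OF subgroup.subgroup_is_group[OF H group_axioms]] HG m_comm by auto
  have ran: "range u \<subseteq> H" using assms(4) generate.incl[of _ "range u" G] by blast
  hence uH: "u n \<in> H" for n by blast
  have T: "is_finest_TB_topology G u (TB_topology G u)" using TB_topology_finest[OF assms(2)] .
  have Tp: "tb_group_topology G (TB_topology G u)" "Hausdorff_space (TB_topology G u)"
    "limitin (TB_topology G u) u \<one>\<^bsub>G\<^esub> sequentially"
    using T by (auto simp: is_finest_TB_topology_def precompact_iff_tb)
  have "precompact_group_topology (G\<lparr>carrier := H\<rparr>) (subtopology (TB_topology G u) H)"
    using tb_group_topology_subgroup[OF H Tp(1)] Hausdorff_space_subtopology[OF Tp(2)]
    by (simp add: K.precompact_iff_tb)
  moreover have "limitin (subtopology (TB_topology G u) H) u \<one>\<^bsub>G\<^esub> sequentially"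
    using Tp(3) uH subgroup.one_closed[OF H] by (simp add: limitin_subtopology)
  ultimately have "TB_sequence (G\<lparr>carrier := H\<rparr>) u" using ran by (auto simp: TB_sequence_def)
  hence \<zeta>: "is_finest_TB_topology (G\<lparr>carrier := H\<rparr>) u (TB_topology (G\<lparr>carrier := H\<rparr>) u)"
    by (rule K.TB_topology_finest)
  have eq: "subtopology (TB_topology G u) H = TB_topology (G\<lparr>carrier := H\<rparr>) u"
    using finest_TB_topology_subgroup[OF H ran T \<zeta>] .
  have "topology_le T' (TB_topology G u)"
    if T': "precompact_group_topology G T'" "subtopology T' H = TB_topology (G\<lparr>carrier := H\<rparr>) u" for T'
  proof -
    have "limitin (subtopology T' H) u \<one>\<^bsub>G\<^esub> sequentially"
      using \<zeta> T'(2) by (simp add: is_finest_TB_topology_def)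
    hence "limitin T' u \<one>\<^bsub>G\<^esub> sequentially" by (simp add: limitin_subtopology)
    thus ?thesis using T T'(1) by (simp add: is_finest_TB_topology_def)
  qed
  thus ?thesis
    using T \<zeta> eq by (simp add: finest_precompact_extension_def is_finest_TB_topology_def)
qed

end
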